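(* Let $(\Omega,\sigma)$ be a minimal continuous flow on a compact metric space, let $a,b:\Omega\to\mathbb{R}$ be continuous, and let $g:\Omega\times\mathbb{R}\to\mathbb{R}$ satisfy, for some real numbers $r_1<r_2$: - the partial derivative $g_x$ exists, and $g,g_x$ are continuous on $\Omega\times\mathbb{R}$; - $g(\omega,x)=0$ if $r_1\le x\le r_2$, $g(\omega,x)>0$ if $x<r_1$, and $g(\omega,x)<0$ if $x>r_2$; - $\lim_{x\to\pm\infty}g(\omega,x)/x=-\infty$ uniformly on $\Omega$; - $g_x(\omega,x)<0$ whenever $x\notin[r_1,r_2]$. Let $(\Omega\times\mathbb{R},\tau)$ be the flow induced by the family $x'=a(\omega\cdot t)\,x+b(\omega\cdot t)+g(\omega\cdot t,x)$, $\omega\in\Omega$, let $\mathcal{A}=\bigcup_{\omega\in\Omega}\big(\{\omega\}\times[\alpha_{\mathcal{A}}(\omega),\beta_{\mathcal{A}}(\omega)]\big)$ be its global attractor, and let $\Omega_c\subseteq\Omega$ be the residual set of common continuity points of $\alpha_{\mathcal{A}}$ and $\beta_{\mathcal{A}}$. Assume also that - $\mathcal{A}$ is a pinched set, and the only $\tau$-minimal set $\mathcal{M}$ is contained either in $\Omega\times[r_1,r_2)$ or in $\Omega\times(r_1,r_2]$; - $\sup\Sigma_a=0$ and $a\in\mathcal{R}_m(\Omega)$ for a measure $m\in\mathfrak{M}_{\mathrm{erg}}(\Omega,\sigma)$. Let $\Omega_l:=\{\omega\in\Omega^a : r_1\le\alpha_{\mathcal{A}}(\omega\cdot t)\le\beta_{\mathcal{A}}(\omega\cdot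 t)\le r_2\text{ for all }t\in\mathbb{R}\}$, a $\sigma$-invariant set with $m(\Omega_l)=1$. Define $\eta_c=c\,\alpha_{\mathcal{A}}+(1-c)\,\beta_{\mathcal{A}}$ for $c\in[0,1]$. Then: (i) $\int_{\mathcal{A}}h(\omega,x)\,d\mu_c:=\int_\Omega h(\omega,\eta_c(\omega))\,dm$ for $h\in C(\mathcal{A},\mathbb{R})$ defines a regular Borel $\tau$-ergodic measure $\mu_c$ concentrated on $\mathcal{A}$. Define $\mathcal{S}_c:=\operatorname{Supp}\mu_c$ for $c\in[0,1]$. Then: (ii) There exists a $\sigma$-invariant set $\Omega_{AY}\subseteq\Omega_l$ with $m(\Omega_{AY})=1$ such that $(\bar\omega,\eta_c(\bar\omega))\in\mathcal{S}_c$ and $\mathcal{S}_c=\mathcal{O}_\tau(\bar\omega,\eta_c(\bar\omega))$ for all $\bar\omega\in\Omega_{AY}$ and $c\in[0,1]$. In particular, $(\mathcal{S}_c,\tau)$ is a transitive flow on a pinched compact set for any $c\in[0,1]$. (iii) One of the following situations holds: (1) $\mathcal{M}$ is a copy of the base, in which case there exists just one $c_0\in[0,1]$ such that $\mathcal{M}=\mathcal{S}_{c_0}$, and the restricted flow $(\mathcal{S}_c,\tau)$ is Auslander–Yorke chaotic for any $c\in[0,1]$, $c\neq c_0$; (2) $\mathcal{M}$ is not a copy of the base, in which case the restricted flow $(\mathcal{S}_c,\tau)$ is Auslander–Yorke chaotic for any $c\in[0,1]$. (iv) $\widetilde{\mathcal{S}}:=\bigcup_{c\in[0,1]}\mathcal{S}_c$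 is a compact $\tau$-invariant subset of $\mathcal{A}$, all its points are sensitive, the restricted flow $(\widetilde{\mathcal{S}},\tau)$ is chain recurrent, $\mathcal{A}_\omega=\widetilde{\mathcal{S}}_\omega$ for every $\omega\in\Omega_{AY}\cup\Omega_c$, $\widetilde{\mathcal{S}}=\operatorname{Supp}\widetilde\mu$ for the $\tau$-invariant Borel probability measure $\widetilde\mu$ on $\mathcal{A}$ given by $\int_{\mathcal{A}}h(\omega,x)\,d\widetilde\mu:=\int_0^1\int_\Omega h(\omega,\eta_c(\omega))\,dm\,dc$ for $h\in C(\mathcal{A},\mathbb{R})$, and there exists a dense $\tau$-invariant subset $\widetilde{\mathcal{X}}\subseteq\widetilde{\mathcal{S}}$ of $\tau$-generic points.
   Context: Write $\omega\cdot t:=\sigma(t,\omega)$. The induced (local) flow is $\tau(t,\omega,x_0)=(\omega\cdot t,x(t,\omega,x_0))$, where $x(t,\omega,x_0)$ is the maximal solution of the equation corresponding to $\omega$ with $x(0,\omega,x_0)=x_0$; $\Omega\times\mathbb{R}$ carries the distance $\mathrm{dist}_\Omega(\omega_1,\omega_2)+|x_1-x_2|$. A set is $\tau$-invariant if it is composed of globally defined orbits and is mapped onto itself by $\tau_t$ for all $t\in\mathbb{R}$. A $\tau$-minimal set is a nonempty compact $\tau$-invariant set with no proper nonempty compact $\tau$-invariant subset ($(\Omega,\sigma)$ minimal: $\Omega$ itself is minimal for $\sigma$). $\mathfrak{M}_{\mathrm{erg}}(\Omega,\sigma)$ is the set of $\sigma$-ergodic Borel probability measures. $\operatorname{Supp}$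 is the topological support of a measure. Sacker–Sell spectrum: the family $x'=c(\omega\cdot t)\,x$, $\omega\in\Omega$ ($c$ continuous) has exponential dichotomy over $\Omega$ if there are $\kappa\ge1$, $\gamma>0$ such that either $\exp\int_0^t c(\omega\cdot l)\,dl\le\kappa e^{-\gamma t}$ for all $\omega\in\Omega$, $t\ge0$, or $\exp\int_0^t c(\omega\cdot l)\,dl\le\kappa e^{\gamma t}$ for all $\omega\in\Omega$, $t\le0$. $\Sigma_a$ is the set of $\lambda\in\mathbb{R}$ such that $x'=(a(\omega\cdot t)-\lambda)\,x$, $\omega\in\Omega$, does not have exponential dichotomy over $\Omega$. (It is known that $\Sigma_a$ is the compact interval with endpoints the infimum and supremum of $\int_\Omega a\,dm$ over the $\sigma$-invariant Borel probability measures $m$.) $a$ admits a continuous primitive if there is a continuous $h_a:\Omega\to\mathbb{R}$ with $h_a(\omega\cdot t)-h_a(\omega)=\int_0^t a(\omega\cdot s)\,ds$ for all $\omega,t$. $\mathcal{R}_m(\Omega)$ is the set of continuous $a:\Omega\to\mathbb{R}$ with $\int_\Omega a\,dm=0$ which do not admit a continuous primitive and satisfy $\sup_{t\le0}\int_0^t a(\omega\cdot s)\,ds<\infty$ for $m$-a.e. $\omega$. For $a\in\mathcal{R}_m(\Omega)$, $\Omega^a$ is the set of $\omega\in\Omega$ with $\sup_{t\in\mathbb{R}}\int_0^t a(\omega\cdot s)\,ds<\infty$, $\inf_{t\le0}\int_0^t a(\omega\cdot s)\,ds=-\infty$ and $\inf_{t\ge0}\int_0^t a(\omega\cdot s)\,ds=-\infty$;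 it is $\sigma$-invariant with $m(\Omega^a)=1$. Background: under the stated conditions all forward semiorbits are globally defined and bounded, and $\tau$ has a global attractor $\mathcal{A}$, i.e. a compact $\tau$-invariant set with $\lim_{t\to\infty}\mathrm{dist}(\tau_t(\mathcal{C}),\mathcal{A})=0$ (Hausdorff semidistance) for every bounded $\mathcal{C}$; it has the displayed form, with $\alpha_{\mathcal{A}}$ lower and $\beta_{\mathcal{A}}$ upper semicontinuous, both $\tau$-equilibria ($\alpha(\omega\cdot t)=x(t,\omega,\alpha(\omega))$ for all $t,\omega$). Sections: $\mathcal{K}_\omega:=\{x : (\omega,x)\in\mathcal{K}\}$. A compact $\tau$-invariant set is pinched if some section is a singleton; when $\mathcal{A}$ is pinched there is exactly one $\tau$-minimal set. A copy of the base is the graph of a continuous $\tau$-equilibrium. $\mathcal{O}_\tau(\omega,x)$ is the omega limit set: limits $\lim_n\tau(t_n,\omega,x)$ with $t_n\uparrow\infty$. For a continuous flow $(Y,\phi)$ on a compact metric space: it is transitive if for any nonempty open $U,V$ there is $t>0$ with $\phi_t(U)\cap V\ne\emptyset$ (equivalently, some forward semiorbit is dense); a point $y_1$ is $\varepsilon$-sensitive if for every $\delta>0$ there is $y_2\in Y$ with $\mathrm{dist}(y_1,y_2)\le\delta$ and $\sup_{t\ge0}\mathrm{dist}(\phi_t(y_1),\phi_t(y_2))>\varepsilon$, and sensitive if it is $\varepsilon$-sensitive for some $\varepsilon>0$; the flow is sensitive if for a common $\varepsilon>0$ all points are $\varepsilon$-sensitive; it is Auslander–Yorke chaotic if it is transitive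 and sensitive; it is chain recurrent if for all $\varepsilon>0$, $T>0$ and $y,\widetilde y\in Y$ there are $k\ge1$, points $y_0=y,\dots,y_k=\widetilde y$ in $Y$ and times $s_0,\dots,s_{k-1}\ge T$ with $\mathrm{dist}(\phi_{s_i}(y_i),y_{i+1})<\varepsilon$ for all $i=0,\dots,k-1$; a point $y$ is generic if $\lim_{t\to\infty}\frac1t\int_0^t f(\phi_s(y))\,ds$ exists for all $f\in C(Y,\mathbb{R})$. In (iii)–(iv) these notions refer to the flow $\tau$ restricted to the indicated compact invariant set ($\mathcal{S}_c$ or $\widetilde{\mathcal{S}}$). *)

theory Defs
  imports "HOL-Probability.Probability"
begin

text \<open>A local flow is given by a map \<open>\<phi>\<close> (time first) together with a map \<open>D\<close> assigning to every
  point the interval on which its orbit is defined; \<open>\<phi> t y\<close> is meaningful only for \<open>t \<in> D y\<close>.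
  A global flow has \<open>D = (\<lambda>_. UNIV)\<close>.\<close>

definition continuous_flow_on :: "'y::topological_space set \<Rightarrow> (real \<Rightarrow> 'y \<Rightarrow> 'y) \<Rightarrow> bool" where
  "continuous_flow_on Y \<phi> \<longleftrightarrow>
     continuous_on (UNIV \<times> Y) (\<lambda>(t, y). \<phi> t y) \<and>
     (\<forall>y\<in>Y. \<phi> 0 y = y \<and> (\<forall>t. \<phi> t y \<in> Y) \<and> (\<forall>s t. \<phi> (s + t) y = \<phi> s (\<phi> t y)))"

definition invariant_set :: "('y \<Rightarrow> real set) \<Rightarrow> (real \<Rightarrow> 'y \<Rightarrow> 'y) \<Rightarrow> 'y set \<Rightarrow> bool" where
  "invariant_set D \<phi> K \<longleftrightarrow> (\<forall>y\<in>K. D y = UNIV) \<and> (\<forall>t. \<phi> t ` K = K)"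

definition minimal_set ::
  "('y::topological_space \<Rightarrow> real set) \<Rightarrow> (real \<Rightarrow> 'y \<Rightarrow> 'y) \<Rightarrow> 'y set \<Rightarrow> bool" where
  "minimal_set D \<phi> M \<longleftrightarrow> M \<noteq> {} \<and> compact M \<and> invariant_set D \<phi> M \<and>
     (\<forall>K. K \<subseteq> M \<and> K \<noteq> {} \<and> compact K \<and> invariant_set D \<phi> K \<longrightarrow> K = M)"

subsection \<open>The skew-product local flow of a family of scalar equations\<close>

definition local_solution ::
  "(real \<Rightarrow> 'w \<Rightarrow> 'w) \<Rightarrow> ('w \<Rightarrow> real \<Rightarrow> real) \<Rightarrow> 'w \<Rightarrow> real \<Rightarrow> real set \<Rightarrow> (real \<Rightarrow> real) \<Rightarrow> bool" where
  "local_solution \<sigma> f \<omega> x0 J x \<longleftrightarrow> open J \<and> is_interval J \<and> 0 \<in> J \<and> x 0 = x0 \<and>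
     (\<forall>t\<in>J. (x has_real_derivative f (\<sigma> t \<omega>) (x t)) (at t))"

text \<open>The maximal solution is obtained by gluing all solutions on open intervals around \<open>0\<close>;
  the value is well defined under uniqueness of solutions (e.g. \<open>f\<close> of class \<open>C\<^sup>1\<close> in the
  second variable).\<close>

definition sol_dom ::
  "(real \<Rightarrow> 'w \<Rightarrow> 'w) \<Rightarrow> ('w \<Rightarrow> real \<Rightarrow> real) \<Rightarrow> 'w \<Rightarrow> real \<Rightarrow> real set" where
  "sol_dom \<sigma> f \<omega> x0 = \<Union>{J. \<exists>x. local_solution \<sigma> f \<omega> x0 J x}"

definition sol ::
  "(real \<Rightarrow> 'w \<Rightarrow> 'w) \<Rightarrow> ('w \<Rightarrow> real \<Rightarrow> real) \<Rightarrow> real \<Rightarrow> 'w \<Rightarrow> real \<Rightarrow> real" where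
  "sol \<sigma> f t \<omega> x0 = (THE v. \<exists>J x. local_solution \<sigma> f \<omega> x0 J x \<and> t \<in> J \<and> x t = v)"

definition skew_dom ::
  "(real \<Rightarrow> 'w \<Rightarrow> 'w) \<Rightarrow> ('w \<Rightarrow> real \<Rightarrow> real) \<Rightarrow> 'w \<times> real \<Rightarrow> real set" where
  "skew_dom \<sigma> f = (\<lambda>(\<omega>, x0). sol_dom \<sigma> f \<omega> x0)"

definition skew_flow ::
  "(real \<Rightarrow> 'w \<Rightarrow> 'w) \<Rightarrow> ('w \<Rightarrow> real \<Rightarrow> real) \<Rightarrow> real \<Rightarrow> 'w \<times> real \<Rightarrow> 'w \<times> real" where
  "skew_flow \<sigma> f t = (\<lambda>(\<omega>, x0). (\<sigma> t \<omega>, sol \<sigma> f t \<omega> x0))"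

text \<open>The metric used on the phase space; the library metric on products is the Euclidean
  combination (same topology, same bounded sets).\<close>

definition sum_dist :: "'w::metric_space \<times> real \<Rightarrow> 'w \<times> real \<Rightarrow> real" where
  "sum_dist y z = dist (fst y) (fst z) + \<bar>snd y - snd z\<bar>"

definition semidist :: "('y \<Rightarrow> 'y \<Rightarrow> real) \<Rightarrow> 'y set \<Rightarrow> 'y set \<Rightarrow> ennreal" where
  "semidist d C K = (SUP y\<in>C. INF z\<in>K. ennreal (d y z))"

definition global_attractor ::
  "('w::metric_space \<times> real \<Rightarrow> real set) \<Rightarrow> (real \<Rightarrow> 'w \<times> real \<Rightarrow> 'w \<times> real) \<Rightarrow>
   ('w \<times> real) set \<Rightarrow> bool" where
  "global_attractor D \<tau> A \<longleftrightarrow> (\<forall>y. {0..} \<subseteq> D y) \<and> compact A \<and> invariant_set D \<tau> A \<and>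
     (\<forall>C. bounded C \<longrightarrow> ((\<lambda>t. semidist sum_dist (\<tau> t ` C) A) \<longlongrightarrow> 0) at_top)"

definition fiber :: "('w \<times> real) set \<Rightarrow> 'w \<Rightarrow> real set" where
  "fiber K \<omega> = {x. (\<omega>, x) \<in> K}"

definition pinched ::
  "('w::metric_space \<times> real \<Rightarrow> real set) \<Rightarrow> (real \<Rightarrow> 'w \<times> real \<Rightarrow> 'w \<times> real) \<Rightarrow>
   ('w \<times> real) set \<Rightarrow> bool" where
  "pinched D \<tau> K \<longleftrightarrow> compact K \<and> invariant_set D \<tau> K \<and> (\<exists>\<omega> x. fiber K \<omega> = {x})"

definition equilibrium ::
  "(real \<Rightarrow> 'w \<Rightarrow> 'w) \<Rightarrow> ('w \<times> real \<Rightarrow> real set) \<Rightarrow> (real \<Rightarrow> 'w \<times> real \<Rightarrow> 'w \<times> real) \<Rightarrow>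
   ('w \<Rightarrow> real) \<Rightarrow> bool" where
  "equilibrium \<sigma> D \<tau> e \<longleftrightarrow>
     (\<forall>\<omega>. D (\<omega>, e \<omega>) = UNIV \<and> (\<forall>t. \<tau> t (\<omega>, e \<omega>) = (\<sigma> t \<omega>, e (\<sigma> t \<omega>))))"

definition copy_of_base ::
  "(real \<Rightarrow> 'w::topological_space \<Rightarrow> 'w) \<Rightarrow> ('w \<times> real \<Rightarrow> real set) \<Rightarrow>
   (real \<Rightarrow> 'w \<times> real \<Rightarrow> 'w \<times> real) \<Rightarrow> ('w \<times> real) set \<Rightarrow> bool" where
  "copy_of_base \<sigma> D \<tau> K \<longleftrightarrow>
     (\<exists>e. continuous_on UNIV e \<and> equilibrium \<sigma> D \<tau> e \<and> K = range (\<lambda>\<omega>. (\<omega>, e \<omega>)))"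

subsection \<open>Measures\<close>

text \<open>Borel probability measures concentrated on an invariant set \<open>Y\<close> on which \<open>\<phi>\<close> is a global
  flow.\<close>

definition invariant_measure ::
  "(real \<Rightarrow> 'y \<Rightarrow> 'y) \<Rightarrow> 'y::topological_space set \<Rightarrow> 'y measure \<Rightarrow> bool" where
  "invariant_measure \<phi> Y \<mu> \<longleftrightarrow> prob_space \<mu> \<and> sets \<mu> = sets borel \<and> emeasure \<mu> Y = 1 \<and>
     (\<forall>t. \<forall>B\<in>sets borel. B \<subseteq> Y \<longrightarrow> emeasure \<mu> (\<phi> t ` B) = emeasure \<mu> B)"

definition ergodic_measure ::
  "(real \<Rightarrow> 'y \<Rightarrow> 'y) \<Rightarrow> 'y::topological_space set \<Rightarrow> 'y measure \<Rightarrow> bool" where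
  "ergodic_measure \<phi> Y \<mu> \<longleftrightarrow> invariant_measure \<phi> Y \<mu> \<and>
     (\<forall>B\<in>sets borel. B \<subseteq> Y \<and> (\<forall>t. \<phi> t ` B = B) \<longrightarrow> emeasure \<mu> B = 0 \<or> emeasure \<mu> B = 1)"

definition regular_borel_measure :: "'y::topological_space measure \<Rightarrow> bool" where
  "regular_borel_measure \<mu> \<longleftrightarrow> sets \<mu> = sets borel \<and>
     (\<forall>K. compact K \<longrightarrow> emeasure \<mu> K < \<infinity>) \<and>
     (\<forall>B\<in>sets borel. emeasure \<mu> B = (SUP K\<in>{K. compact K \<and> K \<subseteq> B}. emeasure \<mu> K) \<and>
                      emeasure \<mu> B = (INF U\<in>{U. open U \<and> B \<subseteq> U}. emeasure \<mu> U))"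

definition represents_functional ::
  "'y::topological_space set \<Rightarrow> (('y \<Rightarrow> real) \<Rightarrow> real) \<Rightarrow> 'y measure \<Rightarrow> bool" where
  "represents_functional Y L \<mu> \<longleftrightarrow> regular_borel_measure \<mu> \<and> emeasure \<mu> (- Y) = 0 \<and>
     (\<forall>h. continuous_on Y h \<longrightarrow> (LINT y:Y|\<mu>. h y) = L h)"

definition Supp :: "'y::topological_space measure \<Rightarrow> 'y set" where
  "Supp \<mu> = {y. \<forall>U. open U \<and> y \<in> U \<longrightarrow> emeasure \<mu> U > 0}"

subsection \<open>The linear coefficient\<close>

text \<open>The interval integral is oriented, so the cocycle has the right sign for \<open>t < 0\<close>.\<close>

definition cocycle_int :: "(real \<Rightarrow> 'w \<Rightarrow> 'w) \<Rightarrow> ('w \<Rightarrow> real) \<Rightarrow> 'w \<Rightarrow> real \<Rightarrow> real" where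
  "cocycle_int \<sigma> c \<omega> t = (LBINT s=0..t. c (\<sigma> s \<omega>))"

definition exp_dichotomy :: "(real \<Rightarrow> 'w \<Rightarrow> 'w) \<Rightarrow> ('w \<Rightarrow> real) \<Rightarrow> bool" where
  "exp_dichotomy \<sigma> c \<longleftrightarrow> (\<exists>\<kappa>\<ge>1. \<exists>\<gamma>>0.
     (\<forall>\<omega>. \<forall>t\<ge>0. exp (cocycle_int \<sigma> c \<omega> t) \<le> \<kappa> * exp (- \<gamma> * t)) \<or>
     (\<forall>\<omega>. \<forall>t\<le>0. exp (cocycle_int \<sigma> c \<omega> t) \<le> \<kappa> * exp (\<gamma> * t)))"

definition sacker_sell :: "(real \<Rightarrow> 'w \<Rightarrow> 'w) \<Rightarrow> ('w \<Rightarrow> real) \<Rightarrow> real set" where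
  "sacker_sell \<sigma> a = {l. \<not> exp_dichotomy \<sigma> (\<lambda>\<omega>. a \<omega> - l)}"

definition continuous_primitive ::
  "(real \<Rightarrow> 'w::topological_space \<Rightarrow> 'w) \<Rightarrow> ('w \<Rightarrow> real) \<Rightarrow> bool" where
  "continuous_primitive \<sigma> a \<longleftrightarrow>
     (\<exists>h. continuous_on UNIV h \<and> (\<forall>\<omega> t. h (\<sigma> t \<omega>) - h \<omega> = cocycle_int \<sigma> a \<omega> t))"

definition R_class ::
  "(real \<Rightarrow> 'w::topological_space \<Rightarrow> 'w) \<Rightarrow> 'w measure \<Rightarrow> ('w \<Rightarrow> real) set" where
  "R_class \<sigma> m = {a. continuous_on UNIV a \<and> (\<integral>\<omega>. a \<omega> \<partial>m) = 0 \<and> \<not> continuous_primitive \<sigma> a \<and>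
     (AE \<omega> in m. bdd_above (cocycle_int \<sigma> a \<omega> ` {..0}))}"

definition Omega_sup :: "(real \<Rightarrow> 'w \<Rightarrow> 'w) \<Rightarrow> ('w \<Rightarrow> real) \<Rightarrow> 'w set" where
  "Omega_sup \<sigma> a = {\<omega>. bdd_above (range (cocycle_int \<sigma> a \<omega>)) \<and>
     \<not> bdd_below (cocycle_int \<sigma> a \<omega> ` {..0}) \<and> \<not> bdd_below (cocycle_int \<sigma> a \<omega> ` {0..})}"

subsection \<open>Dynamics of a flow on a compact set \<open>Y\<close>\<close>

definition omega_limit :: "(real \<Rightarrow> 'y::topological_space \<Rightarrow> 'y) \<Rightarrow> 'y \<Rightarrow> 'y set" where
  "omega_limit \<phi> y =
     {z. \<exists>t. incseq t \<and> filterlim t at_top sequentially \<and> (\<lambda>n. \<phi> (t n) y) \<longlonglongrightarrow> z}"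

definition transitive_on :: "'y::topological_space set \<Rightarrow> (real \<Rightarrow> 'y \<Rightarrow> 'y) \<Rightarrow> bool" where
  "transitive_on Y \<phi> \<longleftrightarrow> (\<forall>U V. openin (top_of_set Y) U \<and> openin (top_of_set Y) V \<and>
     U \<noteq> {} \<and> V \<noteq> {} \<longrightarrow> (\<exists>t>0. \<phi> t ` U \<inter> V \<noteq> {}))"

text \<open>The supremum is taken in \<open>ereal\<close> so that it needs no boundedness side condition.\<close>

definition eps_sensitive_point ::
  "('y \<Rightarrow> 'y \<Rightarrow> real) \<Rightarrow> 'y set \<Rightarrow> (real \<Rightarrow> 'y \<Rightarrow> 'y) \<Rightarrow> real \<Rightarrow> 'y \<Rightarrow> bool" where
  "eps_sensitive_point d Y \<phi> \<epsilon> y1 \<longleftrightarrow>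
     (\<forall>\<delta>>0. \<exists>y2\<in>Y. d y1 y2 \<le> \<delta> \<and> (SUP t\<in>{0..}. ereal (d (\<phi> t y1) (\<phi> t y2))) > ereal \<epsilon>)"

definition sensitive_point ::
  "('y \<Rightarrow> 'y \<Rightarrow> real) \<Rightarrow> 'y set \<Rightarrow> (real \<Rightarrow> 'y \<Rightarrow> 'y) \<Rightarrow> 'y \<Rightarrow> bool" where
  "sensitive_point d Y \<phi> y \<longleftrightarrow> (\<exists>\<epsilon>>0. eps_sensitive_point d Y \<phi> \<epsilon> y)"

definition sensitive_on :: "('y \<Rightarrow> 'y \<Rightarrow> real) \<Rightarrow> 'y set \<Rightarrow> (real \<Rightarrow> 'y \<Rightarrow> 'y) \<Rightarrow> bool" where
  "sensitive_on d Y \<phi> \<longleftrightarrow> (\<exists>\<epsilon>>0. \<forall>y\<in>Y. eps_sensitive_point d Y \<phi> \<epsilon> y)"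

definition auslander_yorke_chaotic ::
  "('y::topological_space \<Rightarrow> 'y \<Rightarrow> real) \<Rightarrow> 'y set \<Rightarrow> (real \<Rightarrow> 'y \<Rightarrow> 'y) \<Rightarrow> bool" where
  "auslander_yorke_chaotic d Y \<phi> \<longleftrightarrow> transitive_on Y \<phi> \<and> sensitive_on d Y \<phi>"

definition chain_recurrent_on ::
  "('y \<Rightarrow> 'y \<Rightarrow> real) \<Rightarrow> 'y set \<Rightarrow> (real \<Rightarrow> 'y \<Rightarrow> 'y) \<Rightarrow> bool" where
  "chain_recurrent_on d Y \<phi> \<longleftrightarrow>
     (\<forall>\<epsilon>>0. \<forall>T>0. \<forall>y\<in>Y. \<forall>y'\<in>Y. \<exists>k\<ge>1. \<exists>(p :: nat \<Rightarrow> 'y) (s :: nat \<Rightarrow> real).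
        p 0 = y \<and> p k = y' \<and> (\<forall>i\<le>k. p i \<in> Y) \<and>
        (\<forall>i<k. s i \<ge> T \<and> d (\<phi> (s i) (p i)) (p (Suc i)) < \<epsilon>))"

definition generic_point :: "'y::topological_space set \<Rightarrow> (real \<Rightarrow> 'y \<Rightarrow> 'y) \<Rightarrow> 'y \<Rightarrow> bool" where
  "generic_point Y \<phi> y \<longleftrightarrow> (\<forall>f :: 'y \<Rightarrow> real. continuous_on Y f \<longrightarrow>
     (\<exists>L. ((\<lambda>t. (1 / t) * (LBINT s=0..t. f (\<phi> s y))) \<longlongrightarrow> L) at_top))"

end

theory Submission
  imports Defs
begin

text \<open>On \<open>\<Omega>\<^sup>a\<close> a point of the minimal set can be moved by a small multiple of \<open>exp (\<integral>\<^sub>0\<^sup>t a)\<close>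
  inside the zone where the equation is linear, so \<open>\<alpha> < \<beta>\<close> there. Then \<open>ln (\<beta> - \<alpha>)\<close> is a measurable
  primitive of \<open>a\<close> plus a nonpositive function, whose mean must vanish: almost everywhere the
  attractor lies in the linear zone, and all convex combinations \<open>\<eta>\<^sub>c\<close> are equilibria. The
  supports \<open>S\<^sub>c\<close> are projections of the support of the joint distribution of
  \<open>(\<omega>, \<alpha> \<omega>, \<beta> \<omega>)\<close>, and almost every orbit of this triple is dense in that support, which gives
  transitivity for all \<open>c\<close> at once. If \<open>S\<^sub>c\<close> were not sensitive, the syndetic returns to an open
  set with a small forward orbit would force \<open>S\<^sub>c\<close> into the minimal set; and a nonsensitive pinched
  minimal set has singleton fibres. Generic points come from Birkhoff's theorem applied to
  countably many functions, a partition of unity for each mesh size.\<close>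

subsection \<open>Measurability without second countability\<close>

text \<open>Two obstacles shape the proof. An almost everywhere statement proved separately for each
  \<open>c\<close> has an exceptional set that depends on \<open>c\<close>, and uncountably many
  null sets cannot be discarded together. Hence recurrence and time averages are established for the
  one base map \<open>J\<close>, whose values record \<omega>, \<alpha> \<omega> and \<beta>
  \<omega>, and are transported to each \<open>c\<close> by the continuous map
  \<open>proj c\<close>. Second, the measurable primitives that occur, such as ln (\<beta> -
  \<alpha>), are not known to be integrable; only their increments over unit time are bounded. This
  still forces the increments to have mean zero, which annihilates a nonnegative defect. The same
  device extends the bound on the backward integrals of \<open>a\<close>, part of
  \<open>R_class\<close>, to all times. Pinching acts through one singleton fibre: any two nonempty
  compact invariant sets share a point over it, so \<open>M\<close> lies in every support. This
  common part lets chains pass from one value of \<open>c\<close> to another and makes the points of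
  a support that is a copy of the base sensitive in the union.\<close>

lemma borel_measurable_Pair_second_countable:
  fixes f :: "'x \<Rightarrow> 'a::topological_space" and r :: "'x \<Rightarrow> 'b::second_countable_topology"
  assumes f: "f \<in> borel_measurable M" and r: "r \<in> borel_measurable M"
  shows "(\<lambda>x. (f x, r x)) \<in> borel_measurable M"
proof (rule borel_measurableI)
  fix U :: "('a \<times> 'b) set" assume U: "open U"
  obtain B :: "'b set set" where B: "countable B" "topological_basis B"
    using ex_countable_basis by blast
  \<comment> \<open>\<open>V b\<close> is the largest open set whose product with \<open>b\<close>
    stays inside \<open>U\<close>. A countable basis in the second factor alone thus writes
    \<open>U\<close> as a countable union of open rectangles, whatever the first factor is.\<close>
  define V where "V b = \<Union>{W. open W \<and> W \<times> b \<subseteq> U}" for b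
  have V: "open (V b)" for b unfolding V_def by auto
  have "(f x, r x) \<in> U \<longleftrightarrow> (\<exists>b\<in>B. f x \<in> V b \<and> r x \<in> b)" for x
  proof
    assume "(f x, r x) \<in> U"
    then obtain W T where WT: "open W" "open T" "f x \<in> W" "r x \<in> T" "W \<times> T \<subseteq> U"
      using open_prod_elim[OF U] by (metis mem_Times_iff fst_conv snd_conv)
    obtain b where b: "b \<in> B" "r x \<in> b" "b \<subseteq> T"
      using B(2) WT(2,4) by (meson topological_basisE)
    then have "W \<times> b \<subseteq> U" using WT(5) by blast
    then show "\<exists>b\<in>B. f x \<in> V b \<and> r x \<in> b" using b WT unfolding V_def by blast
  qed (auto simp: V_def)
  then have eq: "(\<lambda>x. (f x, r x)) -` U \<inter> space M
      = (\<Union>b\<in>B. (f -` V b \<inter> space M) \<inter> (r -` b \<inter> space M))" by auto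
  have "open b" if "b \<in> B" for b using B(2) that by (rule topological_basis_open)
  then have "(f -` V b \<inter> space M) \<inter> (r -` b \<inter> space M) \<in> sets M" if "b \<in> B" for b
    using that V f r by (intro sets.Int measurable_sets[of f M borel] measurable_sets[of r M borel]) auto
  then show "(\<lambda>x. (f x, r x)) -` U \<inter> space M \<in> sets M"
    unfolding eq using B(1) by (intro sets.countable_UN') auto
qed

subsection \<open>Topological supports\<close>

lemma closed_Supp: "closed (Supp \<mu>)"
proof -
  have "open (- Supp \<mu>)"
  proof (subst open_subopen, intro ballI)
    fix y assume "y \<in> - Supp \<mu>"
    then obtain U where "open U" "y \<in> U" "\<not> emeasure \<mu> U > 0" by (auto simp: Supp_def)
    then show "\<exists>T. open T \<and> y \<in> T \<and> T \<subseteq> - Supp \<mu>" by (auto simp: Supp_def intro!: exI[of _ U])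
  qed
  then show ?thesis by (simp add: closed_def)
qed

lemma emeasure_compact_disjoint_Supp:
  fixes \<mu> :: "'a::metric_space measure"
  assumes s: "sets \<mu> = sets borel" and K: "compact K" "K \<inter> Supp \<mu> = {}"
  shows "emeasure \<mu> K = 0"
proof -
  have "\<forall>y\<in>K. \<exists>U. open U \<and> y \<in> U \<and> emeasure \<mu> U = 0"
    using K(2) unfolding Supp_def by (auto simp: disjoint_iff)
  then obtain U where U: "\<And>y. y \<in> K \<Longrightarrow> open (U y) \<and> y \<in> U y \<and> emeasure \<mu> (U y) = 0" by metis
  obtain D where D: "D \<subseteq> K" "finite D" "K \<subseteq> (\<Union>y\<in>D. U y)"
    using compactE_image[OF K(1), of K U] U by blast
  have m: "U y \<in> sets \<mu>" if "y \<in> D" for y unfolding s using that D U by auto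
  have "emeasure \<mu> K \<le> emeasure \<mu> (\<Union>y\<in>D. U y)" using D m by (intro emeasure_mono) auto
  also have "\<dots> \<le> (\<Sum>y\<in>D. emeasure \<mu> (U y))" using D m by (intro emeasure_subadditive_finite) auto
  also have "\<dots> = 0" using D U by (intro sum.neutral) auto
  finally show ?thesis by simp
qed

lemma Supp_subset_closed:
  assumes "closed K" "emeasure \<mu> (- K) = 0"
  shows "Supp \<mu> \<subseteq> K"
  using assms by (auto simp: Supp_def)

text \<open>The complement of the support is a possibly uncountable union of null open sets. Inside
  the compact carrier \<open>K\<close> it is exhausted by the compact sets \<open>F n\<close>, and
  each of these is covered by finitely many null open sets.\<close>

lemma emeasure_Compl_Supp:
  fixes \<mu> :: "'a::metric_space measure"
  assumes s: "sets \<mu> = sets borel" and K: "compact K" "emeasure \<mu> (- K) = 0"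
  shows "emeasure \<mu> (- Supp \<mu>) = 0"
proof -
  define F where "F n = K \<inter> {y. infdist y (Supp \<mu>) \<ge> inverse (real (Suc n))}" for n
  have Kb: "K \<in> sets \<mu>" unfolding s using K by (simp add: borel_compact)
  have nb: "- K \<in> sets \<mu>" unfolding s using compact_imp_closed[OF K(1)] by auto
  have cl: "closed {y. infdist y (Supp \<mu>) \<ge> e}" for e
    by (intro closed_Collect_le continuous_intros)
  have "emeasure \<mu> (K - Supp \<mu>) = 0"
  proof (cases "Supp \<mu> = {}")
    \<comment> \<open>\<open>infdist\<close> to the empty set is 0 by convention, so the exhaustion
      by distance would consist of empty sets here; \<open>K\<close> itself is then disjoint from
      the support.\<close>
    case True then show ?thesis using emeasure_compact_disjoint_Supp[OF s K(1)] by simp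
  next
    case False
    have "emeasure \<mu> (F n) = 0" for n
    proof (rule emeasure_compact_disjoint_Supp[OF s])
      show "compact (F n)" unfolding F_def by (intro compact_Int_closed K cl)
      show "F n \<inter> Supp \<mu> = {}" using inverse_positive_iff_positive[of "real (Suc n)"]
        by (auto simp: F_def)
    qed
    moreover have "F n \<in> sets \<mu>" for n
      unfolding s F_def using K cl by (intro sets.Int borel_compact borel_closed) auto
    ultimately have "emeasure \<mu> (\<Union>n. F n) = 0" by (intro emeasure_UN_eq_0) auto
    moreover have "K - Supp \<mu> = (\<Union>n. F n)"
    proof -
      have "y \<notin> Supp \<mu> \<longleftrightarrow> infdist y (Supp \<mu>) > 0" for y
        using in_closed_iff_infdist_zero[OF closed_Supp False, of y] infdist_nonneg[of y "Supp \<mu>"]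
        by linarith
      moreover have "x > 0 \<longleftrightarrow> (\<exists>n. x \<ge> inverse (real (Suc n)))" for x :: real
        using reals_Archimedean[of x] by (metis less_eq_real_def inverse_positive_iff_positive
          of_nat_0_less_iff order_less_le_trans zero_less_Suc)
      ultimately show ?thesis by (auto simp: F_def)
    qed
    ultimately show ?thesis by simp
  qed
  moreover have "emeasure \<mu> (- Supp \<mu>) \<le> emeasure \<mu> (K - Supp \<mu>) + emeasure \<mu> (- K)"
  proof -
    have "emeasure \<mu> (- Supp \<mu>) \<le> emeasure \<mu> ((K - Supp \<mu>) \<union> - K)"
      using Kb nb closed_Supp[of \<mu>] s by (intro emeasure_mono) (auto intro!: sets.Diff)
    also have "\<dots> \<le> emeasure \<mu> (K - Supp \<mu>) + emeasure \<mu> (- K)"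
      using Kb nb closed_Supp[of \<mu>] s by (intro emeasure_subadditive) (auto intro!: sets.Diff)
    finally show ?thesis .
  qed
  ultimately show ?thesis using K by simp
qed

text \<open>For an image measure only the closure of the image of the support can be expected; here
  the support is compact, so its image is already closed.\<close>

lemma Supp_distr:
  fixes \<nu> :: "'a::metric_space measure" and f :: "'a \<Rightarrow> 'b::metric_space"
  assumes s: "sets \<nu> = sets borel" and K: "compact K" "emeasure \<nu> (- K) = 0"
    and f: "continuous_on UNIV f"
  shows "Supp (distr \<nu> borel f) = f ` Supp \<nu>"
proof -
  have fm: "f \<in> \<nu> \<rightarrow>\<^sub>M borel"
    using borel_measurable_continuous_onI[OF f] measurable_cong_sets[OF s refl] by blast
  have sp: "space \<nu> = UNIV" using sets_eq_imp_space_eq[OF s] by simp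
  have cS: "compact (Supp \<nu>)"
    using Supp_subset_closed[OF compact_imp_closed[OF K(1)] K(2)] closed_Supp K(1)
    by (metis compact_Int_closed inf.absorb_iff2)
  have cf: "closed (f ` Supp \<nu>)"
    using cS f by (intro compact_imp_closed compact_continuous_image) (auto intro: continuous_on_subset)
  show ?thesis
  proof
    show "f ` Supp \<nu> \<subseteq> Supp (distr \<nu> borel f)"
    proof (clarsimp simp: Supp_def)
      fix y U assume y: "\<forall>U. open U \<and> y \<in> U \<longrightarrow> 0 < emeasure \<nu> U" and U: "open U" "f y \<in> U"
      have "open (f -` U)" using f U by (simp add: continuous_on_open_vimage)
      then show "0 < emeasure (distr \<nu> borel f) U" using y U fm by (simp add: emeasure_distr sp)
    qed
    show "Supp (distr \<nu> borel f) \<subseteq> f ` Supp \<nu>"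
    proof (rule Supp_subset_closed[OF cf])
      have "emeasure (distr \<nu> borel f) (- f ` Supp \<nu>) = emeasure \<nu> (f -` (- f ` Supp \<nu>))"
        using fm cf by (subst emeasure_distr) (auto simp: sp)
      also have "\<dots> \<le> emeasure \<nu> (- Supp \<nu>)"
        using closed_Supp[of \<nu>] s by (intro emeasure_mono) auto
      finally show "emeasure (distr \<nu> borel f) (- f ` Supp \<nu>) = 0"
        using emeasure_Compl_Supp[OF s K] by simp
    qed
  qed
qed

subsection \<open>Regularity and uniqueness of representing measures\<close>

lemma closed_open_approx_closed:
  fixes \<mu> :: "'a::metric_space measure"
  assumes "finite_measure \<mu>" and s: "sets \<mu> = sets borel" and B: "closed B" and e: "e > 0"
  shows "\<exists>U. open U \<and> B \<subseteq> U \<and> measure \<mu> (U - B) < e"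
proof (cases "B = {}")
  case True then show ?thesis using e by (intro exI[of _ "{}"]) auto
next
  case False
  interpret finite_measure \<mu> by fact
  define U where "U n = {y. infdist y B < inverse (real (Suc n))}" for n
  have oU: "open (U n)" for n unfolding U_def by (intro open_Collect_less continuous_intros)
  have BU: "B \<subseteq> U n" for n by (auto simp: U_def)
  have i: "(\<Inter>n. U n - B) = {}"
  proof -
    have False if y: "\<And>n. y \<in> U n" "y \<notin> B" for y
    proof -
      have "infdist y B > 0" using in_closed_iff_infdist_zero[OF B False, of y] that
        infdist_nonneg[of y B] by linarith
      then show False using reals_Archimedean[of "infdist y B"] y(1) by (auto simp: U_def)
        (metis less_asym)
    qed
    then show ?thesis by auto
  qed
  have dec: "decseq (\<lambda>n. U n - B)"
  proof (rule decseq_SucI)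
    fix n
    have "inverse (real (Suc (Suc n))) \<le> inverse (real (Suc n))"
      by (rule le_imp_inverse_le) auto
    then show "U (Suc n) - B \<subseteq> U n - B" unfolding U_def by (auto intro: less_le_trans)
  qed
  have "(\<lambda>n. measure \<mu> (U n - B)) \<longlonglongrightarrow> measure \<mu> (\<Inter>n. U n - B)"
    using oU B dec s by (intro finite_Lim_measure_decseq) (auto intro!: sets.Diff)
  then have "(\<lambda>n. measure \<mu> (U n - B)) \<longlonglongrightarrow> 0" unfolding i by simp
  then have "\<forall>\<^sub>F n in sequentially. measure \<mu> (U n - B) < e" using e by (rule order_tendstoD(2))
  then obtain n where "measure \<mu> (U n - B) < e" by (meson eventually_happens trivial_limit_sequentially)
  then show ?thesis using oU BU by blast
qed

text \<open>Sandwiching between a closed and an open set is preserved by complements and countable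
  unions, so it spreads from the closed sets to all Borel sets.\<close>

lemma closed_open_approx:
  fixes \<mu> :: "'a::metric_space measure"
  assumes fm: "finite_measure \<mu>" and s: "sets \<mu> = sets borel" and B: "B \<in> sets borel"
  shows "\<forall>e>0. \<exists>F U. closed F \<and> open U \<and> F \<subseteq> B \<and> B \<subseteq> U \<and> measure \<mu> (U - F) < e"
proof -
  interpret finite_measure \<mu> by fact
  have sm: "open U \<Longrightarrow> closed F \<Longrightarrow> U - F \<in> sets \<mu>" for U F unfolding s by (intro sets.Diff) auto
  have "B \<in> sigma_sets UNIV (Collect closed)" using B unfolding borel_eq_closed by simp
  then show ?thesis
  proof (induction rule: sigma_sets.induct)
    case (Basic B)
    then show ?case using closed_open_approx_closed[OF fm s, of B] by (metis mem_Collect_eq subset_refl)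
  next
    case Empty
    show ?case by (intro allI impI exI[of _ "{}"]) auto
  next
    case (Compl B)
    show ?case
    proof (intro allI impI)
      fix e :: real assume "e > 0"
      then obtain F U where "closed F" "open U" "F \<subseteq> B" "B \<subseteq> U" "measure \<mu> (U - F) < e"
        using Compl by meson
      moreover have "- F - - U = U - F" by auto
      ultimately show "\<exists>F U. closed F \<and> open U \<and> F \<subseteq> UNIV - B \<and> UNIV - B \<subseteq> U \<and> measure \<mu> (U - F) < e"
        by (intro exI[of _ "-U"] exI[of _ "-F"]) auto
    qed
  next
    case (Union B)
    show ?case
    proof (intro allI impI)
      fix e :: real assume e: "e > 0"
      \<comment> \<open>These errors add up to \<open>e / 2\<close>; the other half of the budget
        pays for replacing the infinite union of closed sets by a finite one.\<close>
      define d where "d n = e / 2 * (1/2) ^ Suc n" for n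
      have d: "d n > 0" for n using e by (simp add: d_def)
      have "\<forall>n. \<exists>F U. closed F \<and> open U \<and> F \<subseteq> B n \<and> B n \<subseteq> U \<and> measure \<mu> (U - F) < d n"
        using Union d by blast
      then obtain F U where FU: "\<And>n. closed (F n) \<and> open (U n) \<and> F n \<subseteq> B n \<and> B n \<subseteq> U n
        \<and> measure \<mu> (U n - F n) < d n" by metis
      have ds: "d sums (e / 2)"
      proof -
        have "(\<lambda>n. e / 2 * (1/2) ^ Suc n) sums (e / 2 * 1)" by (intro sums_mult power_half_series)
        then show ?thesis by (simp add: d_def[abs_def])
      qed
      have Un: "measure \<mu> (\<Union>n. U n - F n) \<le> e / 2"
      proof -
        have su: "summable (\<lambda>n. measure \<mu> (U n - F n))"
          by (rule summable_comparison_test'[OF sums_summable[OF ds], of 0]) (use FU in \<open>auto intro: less_imp_le\<close>)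
        have "measure \<mu> (\<Union>n. U n - F n) \<le> (\<Sum>n. measure \<mu> (U n - F n))"
          using su FU sm by (intro finite_measure_subadditive_countably) auto
        also have "\<dots> \<le> (\<Sum>n. d n)" using su sums_summable[OF ds] FU
          by (intro suminf_le) (auto intro: less_imp_le)
        also have "\<dots> = e / 2" using ds by (simp add: sums_iff)
        finally show ?thesis .
      qed
      \<comment> \<open>An infinite union of closed sets need not be closed, so a finite part
        \<open>G N\<close> serves as the inner set; continuity from above makes the neglected rest
        small.\<close>
      define G where "G N = (\<Union>n<N. F n)" for N :: nat
      have cG: "closed (G N)" for N unfolding G_def using FU by (intro closed_UN) auto
      have oU: "open (\<Union>n. U n)" using FU by auto
      have "(\<lambda>N. measure \<mu> ((\<Union>n. U n) - G N)) \<longlonglongrightarrow> measure \<mu> (\<Inter>N. (\<Union>n. U n) - G N)"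
      proof (rule finite_Lim_measure_decseq)
        show "range (\<lambda>N. \<Union> (range U) - G N) \<subseteq> sets \<mu>" using sm[OF oU cG] by auto
        show "decseq (\<lambda>N. \<Union> (range U) - G N)"
          by (rule decseq_SucI) (auto simp: G_def)
      qed
      moreover
      have "measure \<mu> (\<Inter>N. (\<Union>n. U n) - G N) \<le> measure \<mu> (\<Union>n. U n - F n)"
      proof (rule finite_measure_mono)
        show "(\<Inter>N. \<Union> (range U) - G N) \<subseteq> (\<Union>n. U n - F n)" by (fastforce simp: G_def)
        show "(\<Union>n. U n - F n) \<in> sets \<mu>" using FU sm by (intro sets.countable_UN) auto
      qed
      then have "measure \<mu> (\<Inter>N. (\<Union>n. U n) - G N) < e" using Un e by linarith
      ultimately have "\<forall>\<^sub>F N in sequentially. measure \<mu> ((\<Union>n. U n) - G N) < e"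
        by (rule order_tendstoD(2))
      then obtain N where "measure \<mu> ((\<Union>n. U n) - G N) < e"
        by (meson eventually_happens trivial_limit_sequentially)
      moreover have "G N \<subseteq> (\<Union>n. B n)" unfolding G_def using FU by (intro UN_mono) auto
      moreover have "(\<Union>n. B n) \<subseteq> (\<Union>n. U n)" using FU by (intro UN_mono) auto
      ultimately show "\<exists>F U. closed F \<and> open U \<and> F \<subseteq> \<Union> (range B) \<and> \<Union> (range B) \<subseteq> U \<and> measure \<mu> (U - F) < e"
        using cG[of N] oU by (intro exI[of _ "G N"] exI[of _ "\<Union>n. U n"]) simp
    qed
  qed
qed

text \<open>Finite Borel measures on a metric space are approximable from inside by closed sets;
  intersecting these with the compact set \<open>K\<close> of full measure makes them
  compact.\<close>

lemma regular_borel_measure_metric: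
  fixes \<mu> :: "'a::metric_space measure"
  assumes fm: "finite_measure \<mu>" and s: "sets \<mu> = sets borel"
    and K: "compact K" "emeasure \<mu> (- K) = 0"
  shows "regular_borel_measure \<mu>"
  unfolding regular_borel_measure_def
proof (intro conjI allI impI ballI)
  interpret finite_measure \<mu> by fact
  show "sets \<mu> = sets borel" by fact
  show "emeasure \<mu> C < \<infinity>" for C using emeasure_finite[of C] by (simp only: infinity_ennreal_def less_top)
  fix B :: "'a set" assume B: "B \<in> sets borel"
  have Bm: "B \<in> sets \<mu>" using B s by simp
  have Km: "K \<in> sets \<mu>" "- K \<in> sets \<mu>" unfolding s using compact_imp_closed[OF K(1)] by auto
  have *: "\<exists>C U. compact C \<and> open U \<and> C \<subseteq> B \<and> B \<subseteq> U \<and> emeasure \<mu> B \<le> emeasure \<mu> C + ennreal e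
      \<and> emeasure \<mu> U \<le> emeasure \<mu> B + ennreal e" if e: "e > 0" for e
  proof -
    obtain F U where FU: "closed F" "open U" "F \<subseteq> B" "B \<subseteq> U" "measure \<mu> (U - F) < e"
      using closed_open_approx[OF fm s B] e by meson
    have m: "F \<in> sets \<mu>" "U \<in> sets \<mu>" unfolding s using FU by auto
    have le: "emeasure \<mu> (U - F) \<le> ennreal e" using FU by (simp add: emeasure_eq_measure ennreal_leI)
    have "emeasure \<mu> U \<le> emeasure \<mu> (B \<union> (U - F))" using FU m Bm by (intro emeasure_mono) auto
    also have "\<dots> \<le> emeasure \<mu> B + emeasure \<mu> (U - F)" using m Bm by (intro emeasure_subadditive) auto
    finally have 1: "emeasure \<mu> U \<le> emeasure \<mu> B + ennreal e" using le by (meson add_left_mono order_trans)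
    have "emeasure \<mu> B \<le> emeasure \<mu> ((F \<inter> K) \<union> ((U - F) \<union> - K))"
      using FU m Km by (intro emeasure_mono) auto
    also have "\<dots> \<le> emeasure \<mu> (F \<inter> K) + emeasure \<mu> ((U - F) \<union> - K)"
      using m Km by (intro emeasure_subadditive) auto
    also have "\<dots> \<le> emeasure \<mu> (F \<inter> K) + (emeasure \<mu> (U - F) + emeasure \<mu> (- K))"
      using m Km by (intro add_left_mono emeasure_subadditive) auto
    also have "\<dots> \<le> emeasure \<mu> (F \<inter> K) + ennreal e" using le K by (simp add: add_left_mono)
    finally have 2: "emeasure \<mu> B \<le> emeasure \<mu> (F \<inter> K) + ennreal e" .
    show ?thesis using FU 1 2 K
      by (intro exI[of _ "F \<inter> K"] exI[of _ U]) (auto intro: closed_Int_compact)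
  qed
  show "emeasure \<mu> B = (SUP C\<in>{C. compact C \<and> C \<subseteq> B}. emeasure \<mu> C)"
  proof (rule antisym)
    show "emeasure \<mu> B \<le> (SUP C\<in>{C. compact C \<and> C \<subseteq> B}. emeasure \<mu> C)"
    proof (rule ennreal_le_epsilon)
      fix e :: real assume "e > 0"
      from *[OF this] obtain C where C: "compact C" "C \<subseteq> B" "emeasure \<mu> B \<le> emeasure \<mu> C + ennreal e" by blast
      have "emeasure \<mu> C \<le> (SUP C\<in>{C. compact C \<and> C \<subseteq> B}. emeasure \<mu> C)"
        using C by (intro SUP_upper) auto
      then show "emeasure \<mu> B \<le> (SUP C\<in>{C. compact C \<and> C \<subseteq> B}. emeasure \<mu> C) + ennreal e"
        using C(3) by (meson add_right_mono order_trans)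
    qed
    show "(SUP C\<in>{C. compact C \<and> C \<subseteq> B}. emeasure \<mu> C) \<le> emeasure \<mu> B"
      using Bm by (intro SUP_least emeasure_mono) auto
  qed
  show "emeasure \<mu> B = (INF U\<in>{U. open U \<and> B \<subseteq> U}. emeasure \<mu> U)"
  proof (rule antisym)
    show "emeasure \<mu> B \<le> (INF U\<in>{U. open U \<and> B \<subseteq> U}. emeasure \<mu> U)"
      using s by (intro INF_greatest emeasure_mono) auto
    show "(INF U\<in>{U. open U \<and> B \<subseteq> U}. emeasure \<mu> U) \<le> emeasure \<mu> B"
    proof (rule ennreal_le_epsilon)
      fix e :: real assume "e > 0"
      from *[OF this] obtain U where U: "open U" "B \<subseteq> U" "emeasure \<mu> U \<le> emeasure \<mu> B + ennreal e" by blast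
      then show "(INF U\<in>{U. open U \<and> B \<subseteq> U}. emeasure \<mu> U) \<le> emeasure \<mu> B + ennreal e"
        by (intro INF_lower2[of U]) auto
    qed
  qed
qed

lemma borel_measurable_indicator_scaleR_continuous:
  fixes h :: "'a::metric_space \<Rightarrow> real"
  assumes "compact A" "continuous_on A h"
  shows "(\<lambda>y. indicator A y *\<^sub>R h y) \<in> borel_measurable borel"
  using assms by (intro borel_measurable_continuous_on_indicator) (auto simp: borel_compact)

lemma compact_continuous_bounded:
  fixes h :: "'a::topological_space \<Rightarrow> real"
  assumes "compact A" "continuous_on A h"
  obtains B where "B \<ge> 0" "\<And>y. y \<in> A \<Longrightarrow> \<bar>h y\<bar> \<le> B"
proof -
  have "bounded (h ` A)" using assms by (intro compact_imp_bounded compact_continuous_image)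
  then obtain B where "B > 0" "\<forall>x\<in>h ` A. norm x \<le> B" using bounded_pos by metis
  then show thesis using that[of B] by auto
qed

text \<open>The integrands are continuous and decrease to the indicator of \<open>K\<close>, so
  integrals of continuous functions determine the measures of closed sets.\<close>

lemma emeasure_compact_LIMSEQ:
  fixes \<nu> :: "'a::metric_space measure"
  assumes "finite_measure \<nu>" and s: "sets \<nu> = sets borel" and A: "compact A"
    and K: "closed K" "K \<subseteq> A" "K \<noteq> {}"
  shows "(\<lambda>n. LINT y:A|\<nu>. max 0 (1 - real n * infdist y K)) \<longlonglongrightarrow> measure \<nu> K"
proof -
  interpret finite_measure \<nu> by fact
  have Km: "K \<in> sets \<nu>" unfolding s using K by auto
  have ma: "(\<lambda>y. indicator A y *\<^sub>R max 0 (1 - real n * infdist y K)) \<in> borel_measurable \<nu>" for n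
    unfolding measurable_cong_sets[OF s refl]
    by (intro borel_measurable_indicator_scaleR_continuous A continuous_intros)
  have "(\<lambda>n. LINT y:A|\<nu>. max 0 (1 - real n * infdist y K)) \<longlonglongrightarrow> (LINT y|\<nu>. indicator K y)"
    unfolding set_lebesgue_integral_def
  proof (rule integral_dominated_convergence[where w = "\<lambda>_. 1"])
    show "indicat_real K \<in> borel_measurable \<nu>" using Km by simp
    show "AE y in \<nu>. norm (indicator A y *\<^sub>R max 0 (1 - real n * infdist y K)) \<le> 1" for n
      by (auto simp: indicator_def infdist_nonneg)
    show "AE y in \<nu>. (\<lambda>n. indicator A y *\<^sub>R max 0 (1 - real n * infdist y K)) \<longlonglongrightarrow> indicator K y"
    proof (rule AE_I2)
      fix y
      show "(\<lambda>n. indicator A y *\<^sub>R max 0 (1 - real n * infdist y K)) \<longlonglongrightarrow> indicator K y"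
      proof (cases "y \<in> K")
        case True then show ?thesis using K by (auto simp: indicator_def)
      next
        case False
        then have p: "infdist y K > 0" using in_closed_iff_infdist_zero[OF K(1,3), of y]
          infdist_nonneg[of y K] by linarith
        obtain N where N: "real N * infdist y K > 1" using reals_Archimedean3[OF p] by blast
        have "indicator A y *\<^sub>R max 0 (1 - real n * infdist y K) = 0" if "n \<ge> N" for n
        proof -
          have "real n * infdist y K \<ge> real N * infdist y K" using that p by (intro mult_right_mono) auto
          then show ?thesis using N by auto
        qed
        then have "\<forall>\<^sub>F n in sequentially. indicator A y *\<^sub>R max 0 (1 - real n * infdist y K) = 0"
          unfolding eventually_sequentially by blast
        then show ?thesis using False by (simp add: tendsto_eventually)
      qed
    qed
  qed (use ma in auto)
  then show ?thesis using Km sets_eq_imp_space_eq[OF s] by simp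
qed

lemma finite_measure_regular_compact:
  fixes \<nu> :: "'a::metric_space measure"
  assumes r: "regular_borel_measure \<nu>" and A: "compact A" "emeasure \<nu> (- A) = 0"
  shows "finite_measure \<nu>"
proof
  have s: "sets \<nu> = sets borel" using r by (simp add: regular_borel_measure_def)
  have sp: "space \<nu> = UNIV" using sets_eq_imp_space_eq[OF s] by simp
  have "emeasure \<nu> (space \<nu>) = emeasure \<nu> (A \<union> - A)" using sp by simp
  also have "\<dots> \<le> emeasure \<nu> A + emeasure \<nu> (- A)"
    using compact_imp_closed[OF A(1)] by (intro emeasure_subadditive) (auto simp: s)
  also have "\<dots> < \<infinity>" using A r by (auto simp: regular_borel_measure_def)
  finally show "emeasure \<nu> (space \<nu>) \<noteq> \<infinity>" by simp
qed

text \<open>Uniqueness as in Riesz's theorem: representing measures agree on closed subsets of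
  \<open>A\<close>, hence on all closed sets because the mass outside \<open>A\<close> is null,
  hence on the Borel sets because closed sets are an intersection-stable generator. Equality with a
  singleton records existence and uniqueness together.\<close>

lemma represents_functional_unique:
  fixes \<mu> :: "'a::metric_space measure"
  assumes fm: "finite_measure \<mu>" and s: "sets \<mu> = sets borel"
    and A: "compact A" "emeasure \<mu> (- A) = 0"
    and L: "\<And>h. continuous_on A h \<Longrightarrow> L h = (LINT y:A|\<mu>. h y)"
  shows "{\<nu>. represents_functional A L \<nu>} = {\<mu>}"
proof -
  have "represents_functional A L \<mu>"
    using regular_borel_measure_metric[OF fm s A] A L by (auto simp: represents_functional_def)
  moreover have "\<nu> = \<mu>" if \<nu>: "represents_functional A L \<nu>" for \<nu>
  proof -
    have r: "regular_borel_measure \<nu>" and A': "emeasure \<nu> (- A) = 0"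
      using \<nu> by (simp_all add: represents_functional_def)
    have eq: "(LINT y:A|\<nu>. h y) = (LINT y:A|\<mu>. h y)" if "continuous_on A h" for h :: "'a \<Rightarrow> real"
      using \<nu> L[OF that] that by (simp add: represents_functional_def)
    have s': "sets \<nu> = sets borel" using r by (simp add: regular_borel_measure_def)
    have fm': "finite_measure \<nu>" using finite_measure_regular_compact[OF r A(1) A'] .
    interpret mu: finite_measure \<mu> by fact
    interpret nu: finite_measure \<nu> by fact
    have cA: "closed A" using A by (simp add: compact_imp_closed)
    have K: "emeasure \<nu> K = emeasure \<mu> K" if K: "closed K" "K \<subseteq> A" for K
    proof (cases "K = {}")
      case False
      have "(\<lambda>n. LINT y:A|\<nu>. max 0 (1 - real n * infdist y K)) \<longlonglongrightarrow> measure \<nu> K"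
        using emeasure_compact_LIMSEQ[OF fm' s' A(1) K False] .
      moreover have "(LINT y:A|\<nu>. max 0 (1 - real n * infdist y K))
          = (LINT y:A|\<mu>. max 0 (1 - real n * infdist y K))" for n
        by (intro eq continuous_intros)
      moreover note emeasure_compact_LIMSEQ[OF fm s A(1) K False]
      ultimately have "measure \<nu> K = measure \<mu> K" using LIMSEQ_unique by auto
      then show ?thesis by (simp add: mu.emeasure_eq_measure nu.emeasure_eq_measure)
    qed auto
    have sub: "emeasure \<kappa> F = emeasure \<kappa> (F \<inter> A)"
      if "sets \<kappa> = sets borel" "emeasure \<kappa> (- A) = 0" "closed F" for F and \<kappa> :: "'a measure"
    proof (rule antisym)
      have m: "F \<inter> A \<in> sets \<kappa>" "- A \<in> sets \<kappa>" "F \<in> sets \<kappa>" using that cA by auto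
      have "emeasure \<kappa> F \<le> emeasure \<kappa> ((F \<inter> A) \<union> - A)" using m by (intro emeasure_mono) auto
      also have "\<dots> \<le> emeasure \<kappa> (F \<inter> A) + emeasure \<kappa> (- A)" using m by (intro emeasure_subadditive)
      finally show "emeasure \<kappa> F \<le> emeasure \<kappa> (F \<inter> A)" using that by simp
      show "emeasure \<kappa> (F \<inter> A) \<le> emeasure \<kappa> F" using m by (intro emeasure_mono) auto
    qed
    show "\<nu> = \<mu>"
    proof (rule measure_eqI_generator_eq[where E = "Collect closed" and \<Omega> = UNIV and A = "\<lambda>_. UNIV"])
      show "Int_stable (Collect closed)" by (auto simp: Int_stable_def)
      show "emeasure \<nu> X = emeasure \<mu> X" if "X \<in> Collect closed" for X
      proof -
        have "closed X" using that by simp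
        then have "closed (X \<inter> A)" "X \<inter> A \<subseteq> A" using cA by auto
        from K[OF this] show ?thesis
          using sub[OF s' A' \<open>closed X\<close>] sub[OF s A(2) \<open>closed X\<close>] by simp
      qed
      show "sets \<nu> = sigma_sets UNIV (Collect closed)" "sets \<mu> = sigma_sets UNIV (Collect closed)"
        unfolding s s' by (simp_all add: borel_eq_closed)
      show "emeasure \<nu> UNIV \<noteq> \<infinity>" by simp
    qed auto
  qed
  ultimately show ?thesis by blast
qed

subsection \<open>Flows and cocycles\<close>

locale base_flow =
  fixes \<sigma> :: "real \<Rightarrow> 'w::metric_space \<Rightarrow> 'w"
  assumes flow: "continuous_flow_on UNIV \<sigma>"
begin

lemma flow_0 [simp]: "\<sigma> 0 \<omega> = \<omega>"
  using flow by (auto simp: continuous_flow_on_def)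

lemma flow_add: "\<sigma> (s + t) \<omega> = \<sigma> s (\<sigma> t \<omega>)"
  using flow by (auto simp: continuous_flow_on_def)

lemma flow_neg [simp]: "\<sigma> (- t) (\<sigma> t \<omega>) = \<omega>" "\<sigma> t (\<sigma> (- t) \<omega>) = \<omega>"
  by (simp_all flip: flow_add)

lemma continuous_on_flow [continuous_intros]:
  assumes "continuous_on S f" "continuous_on S h"
  shows "continuous_on S (\<lambda>x. \<sigma> (f x) (h x))"
proof -
  have "continuous_on UNIV (\<lambda>(t, y). \<sigma> t y)" using flow by (simp add: continuous_flow_on_def)
  then have "continuous_on S (\<lambda>x. (\<lambda>(t, y). \<sigma> t y) (f x, h x))"
    by (rule continuous_on_compose2[OF _ continuous_on_Pair[OF assms]]) auto
  then show ?thesis by simp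
qed

lemma flow_image: "\<sigma> t ` B = \<sigma> (- t) -` B"
  by (auto simp: image_iff) (metis flow_neg(2))

lemma flow_invariant_imageI:
  assumes "\<And>t \<omega>. \<omega> \<in> B \<Longrightarrow> \<sigma> t \<omega> \<in> B"
  shows "\<sigma> t ` B = B"
proof
  show "\<sigma> t ` B \<subseteq> B" using assms by auto
  show "B \<subseteq> \<sigma> t ` B" unfolding flow_image using assms by auto
qed

lemma interval_integral_has_real_derivative:
  fixes f :: "real \<Rightarrow> real"
  assumes "continuous_on UNIV f"
  shows "((\<lambda>t. LBINT s=0..t. f s) has_real_derivative f t) (at t)"
proof -
  \<comment> \<open>The point \<open>t\<close> is interior to this interval, so the derivative
    within it is the full derivative.\<close>
  let ?a = "- \<bar>t\<bar> - 1" and ?b = "\<bar>t\<bar> + 1"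
  have "((\<lambda>u. LBINT y=ereal 0..ereal u. f y) has_vector_derivative f t) (at t within {?a..?b})"
    by (rule interval_integral_FTC2) (use assms in \<open>auto intro: continuous_on_subset\<close>)
  moreover have "at t within {?a..?b} = at t" by (rule at_within_Icc_at) auto
  ultimately show ?thesis
    by (simp add: has_real_derivative_iff_has_vector_derivative zero_ereal_def)
qed

text \<open>The bounds \<alpha> and \<beta> may be discontinuous on the base, but along each orbit
  they are solutions. Continuity along orbits is the notion that covers functions of them and still
  supports the calculus of \<open>cocycle_int\<close>.\<close>

definition orbit_continuous :: "('w \<Rightarrow> real) \<Rightarrow> bool" where
  "orbit_continuous F \<longleftrightarrow> (\<forall>\<omega>. continuous_on UNIV (\<lambda>t. F (\<sigma> t \<omega>)))"

lemma orbit_continuousI: "continuous_on UNIV F \<Longrightarrow> orbit_continuous F"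
  unfolding orbit_continuous_def
proof
  fix \<omega>
  assume "continuous_on UNIV F"
  then show "continuous_on UNIV (\<lambda>t. F (\<sigma> t \<omega>))"
    by (rule continuous_on_compose2) (auto intro: continuous_on_flow continuous_on_id continuous_on_const)
qed

lemma cocycle_int_deriv:
  assumes "orbit_continuous F"
  shows "(cocycle_int \<sigma> F \<omega> has_real_derivative F (\<sigma> t \<omega>)) (at t)"
  using interval_integral_has_real_derivative[of "\<lambda>s. F (\<sigma> s \<omega>)"] assms
  unfolding cocycle_int_def[abs_def] orbit_continuous_def by blast

lemma cocycle_int_0 [simp]: "cocycle_int \<sigma> F \<omega> 0 = 0"
  by (simp add: cocycle_int_def flip: zero_ereal_def)

lemma cocycle_int_add:
  assumes F: "orbit_continuous F"
  shows "cocycle_int \<sigma> F \<omega> (s + t) = cocycle_int \<sigma> F \<omega> s + cocycle_int \<sigma> F (\<sigma> s \<omega>) t"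
proof -
  let ?d = "\<lambda>t. cocycle_int \<sigma> F \<omega> (s + t) - cocycle_int \<sigma> F (\<sigma> s \<omega>) t"
  have "(?d has_real_derivative 0) (at t)" for t
  proof -
    have "((\<lambda>t. cocycle_int \<sigma> F \<omega> (s + t)) has_real_derivative F (\<sigma> (s + t) \<omega>)) (at t)"
      using DERIV_shift[of "cocycle_int \<sigma> F \<omega>" "F (\<sigma> (s + t) \<omega>)" t s] cocycle_int_deriv[OF F, of \<omega> "s + t"]
      by (simp add: add.commute)
    then show ?thesis
      using cocycle_int_deriv[OF F, of "\<sigma> s \<omega>" t]
      by (auto intro!: derivative_eq_intros simp flip: flow_add simp: add.commute)
  qed
  then have "?d t = ?d 0" using DERIV_isconst_all[of ?d] by blast
  then show ?thesis by simp
qed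

lemma cocycle_int_lipschitz:
  assumes F: "orbit_continuous F" and C: "\<And>\<omega>. \<bar>F \<omega>\<bar> \<le> C"
  shows "\<bar>cocycle_int \<sigma> F \<omega> t - cocycle_int \<sigma> F \<omega> s\<bar> \<le> C * \<bar>t - s\<bar>"
proof -
  have *: "\<bar>cocycle_int \<sigma> F \<omega> t - cocycle_int \<sigma> F \<omega> s\<bar> \<le> C * \<bar>t - s\<bar>" if "s < t" for s t
  proof -
    have "\<exists>z>s. z < t \<and> cocycle_int \<sigma> F \<omega> t - cocycle_int \<sigma> F \<omega> s = (t - s) * F (\<sigma> z \<omega>)"
      by (rule MVT2[OF that]) (rule cocycle_int_deriv[OF F])
    then obtain z where "cocycle_int \<sigma> F \<omega> t - cocycle_int \<sigma> F \<omega> s = (t - s) * F (\<sigma> z \<omega>)" by blast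
    then show ?thesis using C[of "\<sigma> z \<omega>"] that
      by (simp add: abs_mult mult.commute mult_right_mono)
  qed
  show ?thesis using *[of s t] *[of t s] by (cases s t rule: linorder_cases) (auto simp: abs_minus_commute)
qed

lemma cocycle_int_bound:
  assumes "orbit_continuous F" "\<And>\<omega>. \<bar>F \<omega>\<bar> \<le> C"
  shows "\<bar>cocycle_int \<sigma> F \<omega> t\<bar> \<le> C * \<bar>t\<bar>"
  using cocycle_int_lipschitz[OF assms, of \<omega> t 0] by simp

lemma cocycle_int_minus:
  "cocycle_int \<sigma> (\<lambda>\<omega>. - F \<omega>) \<omega> t = - cocycle_int \<sigma> F \<omega> t"
  by (simp add: cocycle_int_def interval_lebesgue_integral_uminus)

end

text \<open>Continuity in \<open>s\<close> allows \<open>s\<close> to be replaced by the nearest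
  grid point below it. On a fixed grid only countably many sections \<open>h s\<close> occur, so the
  approximants are jointly measurable.\<close>

lemma caratheodory_measurable:
  fixes h :: "real \<Rightarrow> 'a \<Rightarrow> real"
  assumes h: "\<And>s. h s \<in> borel_measurable M"
    and c: "\<And>x. x \<in> space M \<Longrightarrow> continuous_on UNIV (\<lambda>s. h s x)"
  shows "(\<lambda>(s, x). h s x) \<in> borel_measurable (lborel \<Otimes>\<^sub>M M)"
proof -
  define q where "q n s = real_of_int \<lfloor>real (Suc n) * s\<rfloor> / real (Suc n)" for n s
  have q: "(\<lambda>n. q n s) \<longlonglongrightarrow> s" for s
  proof -
    have "\<bar>q n s - s\<bar> \<le> inverse (real (Suc n))" for n
    proof -
      define k where "k = real (Suc n)"
      have k: "k > 0" by (simp add: k_def)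
      have "q n s - s = (real_of_int \<lfloor>k * s\<rfloor> - k * s) * inverse k"
        using k unfolding q_def k_def[symmetric] by (simp add: field_simps)
      then have "\<bar>q n s - s\<bar> = \<bar>real_of_int \<lfloor>k * s\<rfloor> - k * s\<bar> * inverse k"
        using k by (simp add: abs_mult)
      moreover have "\<bar>real_of_int \<lfloor>k * s\<rfloor> - k * s\<bar> \<le> 1" by linarith
      ultimately show ?thesis using k mult_right_mono[of "\<bar>real_of_int \<lfloor>k * s\<rfloor> - k * s\<bar>" 1 "inverse k"]
        by (simp add: k_def)
    qed
    then have "(\<lambda>n. q n s - s) \<longlonglongrightarrow> 0"
      by (intro Lim_null_comparison[OF _ LIMSEQ_inverse_real_of_nat]) auto
    then show ?thesis using LIM_zero_iff by blast
  qed
  have "(\<lambda>z. h (fst z) (snd z)) \<in> borel_measurable (lborel \<Otimes>\<^sub>M M)"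
  proof (rule borel_measurable_LIMSEQ_real)
    fix z :: "real \<times> 'a" assume z: "z \<in> space (lborel \<Otimes>\<^sub>M M)"
    then have "isCont (\<lambda>s. h s (snd z)) (fst z)"
      using c[of "snd z"] by (auto simp: space_pair_measure continuous_on_eq_continuous_at)
    then show "(\<lambda>n. h (q n (fst z)) (snd z)) \<longlonglongrightarrow> h (fst z) (snd z)"
      using q by (rule isCont_tendsto_compose)
  next
    fix n
    have "(\<lambda>z. (\<lambda>i z. h (real_of_int i / real (Suc n)) (snd z)) \<lfloor>real (Suc n) * fst z\<rfloor> z)
        \<in> borel_measurable (lborel \<Otimes>\<^sub>M M)"
    proof (rule measurable_compose_countable[where f = "\<lambda>i z. h (real_of_int i / real (Suc n)) (snd z)"
        and g = "\<lambda>z. \<lfloor>real (Suc n) * fst z\<rfloor>"])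
      show "(\<lambda>z. h (real_of_int i / real (Suc n)) (snd z)) \<in> borel_measurable (lborel \<Otimes>\<^sub>M M)" for i
        by (rule measurable_compose[OF measurable_snd h])
      have "fst \<in> borel_measurable (lborel \<Otimes>\<^sub>M M :: (real \<times> 'a) measure)"
        using measurable_fst[of lborel M] by simp
      then show "(\<lambda>z. \<lfloor>real (Suc n) * fst z\<rfloor>) \<in> measurable (lborel \<Otimes>\<^sub>M M) (count_space UNIV)"
        by measurable
    qed
    then show "(\<lambda>z. h (q n (fst z)) (snd z)) \<in> borel_measurable (lborel \<Otimes>\<^sub>M M)"
      by (simp add: q_def)
  qed
  then show ?thesis by (simp add: case_prod_beta)
qed

subsection \<open>Ergodic flows\<close>

locale ergodic_flow = base_flow +
  fixes m :: "'a measure"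
  assumes m_erg: "ergodic_measure \<sigma> UNIV m"

sublocale ergodic_flow \<subseteq> prob_space m
  using m_erg by (simp add: ergodic_measure_def invariant_measure_def)

context ergodic_flow
begin

lemma sets_m: "sets m = sets borel"
  using m_erg by (simp add: ergodic_measure_def invariant_measure_def)

lemma space_m [simp]: "space m = UNIV"
  using sets_eq_imp_space_eq[OF sets_m] by simp

lemma measurable_m: "measurable m N = measurable borel N"
  by (rule measurable_cong_sets[OF sets_m refl])

lemma flow_measurable [measurable]: "\<sigma> t \<in> borel_measurable m"
  unfolding measurable_m by (intro borel_measurable_continuous_onI continuous_intros)

lemma flow_measurable_compose:
  "F \<in> measurable borel N \<Longrightarrow> (\<lambda>\<omega>. F (\<sigma> t \<omega>)) \<in> measurable m N"
  by (rule measurable_compose[OF flow_measurable])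

lemma distr_flow: "distr m borel (\<sigma> t) = m"
proof (rule measure_eqI)
  fix B assume "B \<in> sets (distr m borel (\<sigma> t))"
  then have B: "B \<in> sets borel" by simp
  then have "emeasure (distr m borel (\<sigma> t)) B = emeasure m (\<sigma> (- t) ` B)"
    by (simp add: emeasure_distr flow_image)
  also have "\<dots> = emeasure m B"
    using m_erg B by (simp add: ergodic_measure_def invariant_measure_def)
  finally show "emeasure (distr m borel (\<sigma> t)) B = emeasure m B" .
qed (simp add: sets_m)

lemma emeasure_flow: "B \<in> sets borel \<Longrightarrow> emeasure m {\<omega>. \<sigma> t \<omega> \<in> B} = emeasure m B"
  using emeasure_distr[of "\<sigma> t" m borel B] distr_flow[of t] by (simp add: vimage_def)

lemma AE_flow:
  assumes "AE \<omega> in m. P \<omega>"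
  shows "AE \<omega> in m. P (\<sigma> t \<omega>)"
proof -
  obtain N where N: "N \<in> null_sets m" "{\<omega>. \<not> P \<omega>} \<subseteq> N" using assms by (auto simp: eventually_ae_filter)
  have "{\<omega>. \<sigma> t \<omega> \<in> N} \<in> null_sets m"
    using N emeasure_flow[of N t] measurable_sets[OF flow_measurable, of N t] sets_m
    by (auto simp: null_sets_def vimage_def)
  then show ?thesis using N(2) by (auto intro!: AE_I')
qed

lemma integral_flow:
  fixes F :: "'a \<Rightarrow> real"
  assumes "F \<in> borel_measurable borel"
  shows "(\<integral>\<omega>. F (\<sigma> t \<omega>) \<partial>m) = (\<integral>\<omega>. F \<omega> \<partial>m)"
  using integral_distr[OF flow_measurable[of t] assms] by (simp add: distr_flow)

lemma AE_invariant:
  assumes E: "E \<in> sets borel" and inv: "\<And>t \<omega>. \<omega> \<in> E \<Longrightarrow> \<sigma> t \<omega> \<in> E" and p: "emeasure m E \<noteq> 0"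
  shows "AE \<omega> in m. \<omega> \<in> E"
proof -
  have "\<forall>t. \<sigma> t ` E = E" using flow_invariant_imageI[OF inv] by simp
  then have "emeasure m E = 0 \<or> emeasure m E = 1"
    using m_erg E unfolding ergodic_measure_def by simp
  then have "prob E = 1" using p by (simp add: measure_def)
  then show ?thesis using E by (simp add: prob_eq_1 sets_m)
qed

lemma emeasure_eq_1: "E \<in> sets borel \<Longrightarrow> (AE \<omega> in m. \<omega> \<in> E) \<Longrightarrow> emeasure m E = 1"
  by (simp add: prob_eq_1 sets_m emeasure_eq_measure)

lemma cocycle_int_measurable:
  assumes F: "F \<in> borel_measurable borel" "orbit_continuous F"
  shows "(\<lambda>\<omega>. cocycle_int \<sigma> F \<omega> t) \<in> borel_measurable m"
proof -
  have *: "(\<lambda>\<omega>. cocycle_int \<sigma> F \<omega> t) \<in> borel_measurable m" if t: "t \<ge> 0" for t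
  proof -
    have [measurable]: "(\<lambda>(s, \<omega>). F (\<sigma> s \<omega>)) \<in> borel_measurable (lborel \<Otimes>\<^sub>M m)"
      using F by (intro caratheodory_measurable flow_measurable_compose) (auto simp: orbit_continuous_def)
    have "(\<lambda>\<omega>. LINT s|lborel. indicator {0..t} s * F (\<sigma> s \<omega>)) \<in> borel_measurable m"
      by measurable
    also have "(\<lambda>\<omega>. LINT s|lborel. indicator {0..t} s * F (\<sigma> s \<omega>)) = (\<lambda>\<omega>. cocycle_int \<sigma> F \<omega> t)"
      using t by (simp add: cocycle_int_def zero_ereal_def interval_integral_Icc set_lebesgue_integral_def)
    finally show ?thesis .
  qed
  show ?thesis
  proof (cases "t \<ge> 0")
    case False
    have "cocycle_int \<sigma> F \<omega> t = - cocycle_int \<sigma> F (\<sigma> t \<omega>) (- t)" for \<omega>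
      using cocycle_int_add[OF F(2), of \<omega> t "- t"] by simp
    moreover have "(\<lambda>\<omega>. cocycle_int \<sigma> F (\<sigma> t \<omega>) (- t)) \<in> borel_measurable m"
      using flow_measurable_compose[of "\<lambda>\<omega>. cocycle_int \<sigma> F \<omega> (- t)" borel t] *[of "- t"] False
      by (simp add: measurable_m)
    ultimately show ?thesis by simp
  qed (rule *)
qed

lemma integrable_bounded:
  fixes F :: "'a \<Rightarrow> real"
  assumes "F \<in> borel_measurable m" "\<And>\<omega>. \<bar>F \<omega>\<bar> \<le> C"
  shows "integrable m F"
  using assms by (intro integrable_const_bound[of _ C]) auto

text \<open>Fubini exchanges time and base; invariance of \<open>m\<close> makes the inner integral
  independent of time.\<close>

lemma integral_cocycle_int:
  assumes F: "F \<in> borel_measurable borel" "orbit_continuous F" and C: "\<And>\<omega>. \<bar>F \<omega>\<bar> \<le> C"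
  shows "(\<integral>\<omega>. cocycle_int \<sigma> F \<omega> 1 \<partial>m) = (\<integral>\<omega>. F \<omega> \<partial>m)"
proof -
  interpret P: pair_sigma_finite lborel m ..
  have mm [measurable]: "(\<lambda>(s, \<omega>). F (\<sigma> s \<omega>)) \<in> borel_measurable (lborel \<Otimes>\<^sub>M m)"
    using F by (intro caratheodory_measurable flow_measurable_compose) (auto simp: orbit_continuous_def)
  have i: "integrable (lborel \<Otimes>\<^sub>M m) (\<lambda>(s, \<omega>). indicator {0..1} s * F (\<sigma> s \<omega>))"
  proof (rule integrableI_bounded_set[where A = "{0..1} \<times> UNIV" and B = C])
    show "{0..1::real} \<times> UNIV \<in> sets (lborel \<Otimes>\<^sub>M m)" using sets.top[of m] by (intro pair_measureI) simp_all
    show "(\<lambda>(s, \<omega>). indicator {0..1} s * F (\<sigma> s \<omega>)) \<in> borel_measurable (lborel \<Otimes>\<^sub>M m)"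
      by measurable
    show "emeasure (lborel \<Otimes>\<^sub>M m) ({0..1::real} \<times> UNIV) < \<infinity>"
      using sets.top[of m] emeasure_space_1 by (subst emeasure_pair_measure_Times) auto
    show "AE x in lborel \<Otimes>\<^sub>M m. x \<in> {0..1} \<times> UNIV \<longrightarrow>
        norm (case x of (s, \<omega>) \<Rightarrow> indicat_real {0..1} s * F (\<sigma> s \<omega>)) \<le> C"
      using C by auto
    show "AE x in lborel \<Otimes>\<^sub>M m. x \<notin> {0..1} \<times> UNIV \<longrightarrow>
        (case x of (s, \<omega>) \<Rightarrow> indicat_real {0..1} s * F (\<sigma> s \<omega>)) = 0"
      by (auto simp: indicator_def split: prod.splits)
  qed
  have "(\<integral>\<omega>. cocycle_int \<sigma> F \<omega> 1 \<partial>m) = (\<integral>\<omega>. (LINT s|lborel. indicator {0..1} s * F (\<sigma> s \<omega>)) \<partial>m)"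
    by (simp add: cocycle_int_def zero_ereal_def interval_integral_Icc set_lebesgue_integral_def)
  also have "\<dots> = (LINT s|lborel. (\<integral>\<omega>. indicator {0..1} s * F (\<sigma> s \<omega>) \<partial>m))"
    by (rule P.Fubini_integral[OF i])
  also have "\<dots> = (LINT s|lborel. indicator {0..1::real} s * (\<integral>\<omega>. F \<omega> \<partial>m))"
    by (simp add: integral_flow[OF F(1)])
  also have "\<dots> = (\<integral>\<omega>. F \<omega> \<partial>m)" by simp
  finally show ?thesis .
qed

text \<open>The integral cannot be split, since \<open>u\<close> need not be integrable. The
  truncations \<open>v n\<close> are bounded, so invariance gives their increments mean zero, and
  truncation does not enlarge increments, so \<open>K\<close> dominates all of them.\<close>

lemma integral_bounded_coboundary:
  fixes u :: "'a \<Rightarrow> real"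
  assumes u: "u \<in> borel_measurable borel" and K: "AE \<omega> in m. \<bar>u (\<sigma> 1 \<omega>) - u \<omega>\<bar> \<le> K"
  shows "(\<integral>\<omega>. u (\<sigma> 1 \<omega>) - u \<omega> \<partial>m) = 0"
proof -
  define v where "v n \<omega> = max (- real n) (min (real n) (u \<omega>))" for n \<omega>
  have um: "u \<in> borel_measurable m" using u by (simp add: measurable_m)
  have vm: "v n \<in> borel_measurable borel" for n unfolding v_def using u by measurable
  have vm': "v n \<in> borel_measurable m" for n using vm by (simp add: measurable_m)
  have vi: "integrable m (v n)" for n
    by (rule integrable_bounded[where C = "real n"]) (use vm' in \<open>auto simp: v_def\<close>)
  have vi': "integrable m (\<lambda>\<omega>. v n (\<sigma> 1 \<omega>))" for n
    by (rule integrable_bounded[where C = "real n"]) (use flow_measurable_compose[OF vm] in \<open>auto simp: v_def\<close>)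
  have "(\<lambda>n. \<integral>\<omega>. v n (\<sigma> 1 \<omega>) - v n \<omega> \<partial>m) \<longlonglongrightarrow> (\<integral>\<omega>. u (\<sigma> 1 \<omega>) - u \<omega> \<partial>m)"
  proof (rule integral_dominated_convergence[where w = "\<lambda>_. K"])
    show "(\<lambda>\<omega>. u (\<sigma> 1 \<omega>) - u \<omega>) \<in> borel_measurable m"
      using flow_measurable_compose[OF u] um by measurable
    show "(\<lambda>\<omega>. v n (\<sigma> 1 \<omega>) - v n \<omega>) \<in> borel_measurable m" for n
      using flow_measurable_compose[OF vm] vm' by measurable
    show "AE \<omega> in m. (\<lambda>n. v n (\<sigma> 1 \<omega>) - v n \<omega>) \<longlonglongrightarrow> u (\<sigma> 1 \<omega>) - u \<omega>"
    proof (rule AE_I2)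
      fix \<omega>
      have "(\<lambda>n. v n \<omega>') \<longlonglongrightarrow> u \<omega>'" for \<omega>'
      proof -
        obtain N where "\<bar>u \<omega>'\<bar> \<le> real N" using real_arch_simple by blast
        then have "v n \<omega>' = u \<omega>'" if "n \<ge> N" for n
        proof -
          have "real N \<le> real n" using that by simp
          then show ?thesis using \<open>\<bar>u \<omega>'\<bar> \<le> real N\<close> unfolding v_def by linarith
        qed
        then show ?thesis by (intro tendsto_eventually) (auto simp: eventually_sequentially)
      qed
      then show "(\<lambda>n. v n (\<sigma> 1 \<omega>) - v n \<omega>) \<longlonglongrightarrow> u (\<sigma> 1 \<omega>) - u \<omega>" by (intro tendsto_diff)
    qed
    show "AE \<omega> in m. norm (v n (\<sigma> 1 \<omega>) - v n \<omega>) \<le> K" for n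
      using K
    proof eventually_elim
      case (elim \<omega>)
      have "\<bar>v n (\<sigma> 1 \<omega>) - v n \<omega>\<bar> \<le> \<bar>u (\<sigma> 1 \<omega>) - u \<omega>\<bar>"
        unfolding v_def by (auto simp: max_def min_def)
      then show ?case using elim by simp
    qed
  qed auto
  moreover have "(\<integral>\<omega>. v n (\<sigma> 1 \<omega>) - v n \<omega> \<partial>m) = 0" for n
    using vi vi' integral_flow[OF vm] by (simp add: Bochner_Integration.integral_diff)
  ultimately show ?thesis using LIMSEQ_unique[of "\<lambda>_. 0::real"] by simp
qed

text \<open>The difference of \<open>I\<close> and \<open>G\<close> is the increment of
  \<open>u\<close> and is bounded, hence has mean zero; so does \<open>I\<close>, and a nonnegative
  function of mean zero vanishes almost everywhere. It is applied to ln (\<beta> - \<alpha>) and to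
  a supremum of backward integrals.\<close>

lemma AE_zero_of_coboundary:
  fixes u G :: "'a \<Rightarrow> real"
  assumes u: "u \<in> borel_measurable borel" and G: "G \<in> borel_measurable m" "AE \<omega> in m. 0 \<le> G \<omega>"
    and I: "I \<in> borel_measurable m" "\<And>\<omega>. \<bar>I \<omega>\<bar> \<le> C" "(\<integral>\<omega>. I \<omega> \<partial>m) = 0"
    and K: "AE \<omega> in m. G \<omega> \<le> K"
    and eq: "AE \<omega> in m. u (\<sigma> 1 \<omega>) - u \<omega> = I \<omega> - G \<omega>"
  shows "AE \<omega> in m. G \<omega> = 0"
proof -
  have "AE \<omega> in m. \<bar>u (\<sigma> 1 \<omega>) - u \<omega>\<bar> \<le> K + C"
    using eq G(2) K
  proof eventually_elim
    case (elim \<omega>) then show ?case using I(2)[of \<omega>] by linarith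
  qed
  note z = integral_bounded_coboundary[OF u this]
  have Gi: "integrable m G"
    using G K by (intro integrable_const_bound[of _ K]) auto
  have Ii: "integrable m I" using I by (intro integrable_bounded)
  have um: "u \<in> borel_measurable m" using u by (simp add: measurable_m)
  have d: "(\<lambda>\<omega>. u (\<sigma> 1 \<omega>) - u \<omega>) \<in> borel_measurable m"
    using flow_measurable_compose[OF u] um by measurable
  have "(\<integral>\<omega>. u (\<sigma> 1 \<omega>) - u \<omega> \<partial>m) = (\<integral>\<omega>. I \<omega> - G \<omega> \<partial>m)"
    using d I G eq by (intro integral_cong_AE) auto
  then have "(\<integral>\<omega>. G \<omega> \<partial>m) = 0" using z Gi Ii I(3) by simp
  then show ?thesis using integral_nonneg_eq_0_iff_AE[OF Gi G(2)] by simp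
qed

text \<open>Poincare recurrence combined with ergodicity: the sets \<open>W N\<close> of points with
  a visit after time \<open>N\<close> decrease, yet all have the measure of \<open>W 0\<close>
  because they are translates of it. Their intersection therefore has positive measure, and it is
  invariant.\<close>

lemma AE_recurrent:
  fixes X :: "'a \<Rightarrow> 'y::topological_space"
  assumes X: "X \<in> borel_measurable m" and c: "\<And>\<omega>. continuous_on UNIV (\<lambda>t. X (\<sigma> t \<omega>))"
    and U: "open U" "emeasure m {\<omega>. X \<omega> \<in> U} \<noteq> 0"
  shows "{\<omega>. \<forall>N. \<exists>t\<ge>N. X (\<sigma> t \<omega>) \<in> U} \<in> sets borel"
    and "AE \<omega> in m. \<forall>N. \<exists>t\<ge>N. X (\<sigma> t \<omega>) \<in> U"
proof -
  have Um: "{\<omega>. X (\<sigma> t \<omega>) \<in> U} \<in> sets borel" for t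
  proof -
    have "(\<lambda>\<omega>. X (\<sigma> t \<omega>)) \<in> borel_measurable m"
      using flow_measurable_compose[of X borel t] X by (simp add: measurable_m)
    from measurable_sets[OF this, of U] show ?thesis using U(1) by (simp add: sets_m vimage_def)
  qed
  define W where "W N = {\<omega>. \<exists>t\<ge>N. X (\<sigma> t \<omega>) \<in> U}" for N :: real
  have Weq: "W N = (\<Union>q\<in>\<rat> \<inter> {N..}. {\<omega>. X (\<sigma> q \<omega>) \<in> U})" for N
  proof -
    \<comment> \<open>The rational time is taken slightly after \<open>t\<close>, so that the lower
      bound \<open>N\<close> survives.\<close>
    have "\<exists>q\<in>\<rat> \<inter> {N..}. X (\<sigma> q \<omega>) \<in> U" if t: "t \<ge> N" "X (\<sigma> t \<omega>) \<in> U" for t \<omega>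
    proof -
      have "open ((\<lambda>t. X (\<sigma> t \<omega>)) -` U)" using c U by (simp add: continuous_on_open_vimage)
      then obtain e where e: "e > 0" "ball t e \<subseteq> (\<lambda>t. X (\<sigma> t \<omega>)) -` U"
        using t(2) by (meson openE vimageI)
      obtain q where q: "q \<in> \<rat>" "t < q" "q < t + e" using Rats_dense_in_real[of t "t + e"] e by auto
      then have "q \<in> ball t e" by (auto simp: dist_real_def)
      then show ?thesis using e(2) q t(1) by (intro bexI[of _ q]) auto
    qed
    then show ?thesis unfolding W_def by blast
  qed
  have Wm: "W N \<in> sets borel" for N
    unfolding Weq using Um by (intro sets.countable_UN' countable_subset[OF _ countable_rat]) auto
  have Wshift: "W N = {\<omega>. \<sigma> N \<omega> \<in> W 0}" for N
  proof -
    have "(\<exists>t\<ge>N. X (\<sigma> t \<omega>) \<in> U) \<longleftrightarrow> (\<exists>t\<ge>0. X (\<sigma> (t + N) \<omega>) \<in> U)" for \<omega>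
    proof
      assume "\<exists>t\<ge>N. X (\<sigma> t \<omega>) \<in> U"
      then obtain t where "t \<ge> N" "X (\<sigma> t \<omega>) \<in> U" by blast
      then show "\<exists>t\<ge>0. X (\<sigma> (t + N) \<omega>) \<in> U" by (intro exI[of _ "t - N"]) simp
    next
      assume "\<exists>t\<ge>0. X (\<sigma> (t + N) \<omega>) \<in> U"
      then obtain t where "t \<ge> 0" "X (\<sigma> (t + N) \<omega>) \<in> U" by blast
      then show "\<exists>t\<ge>N. X (\<sigma> t \<omega>) \<in> U" by (intro exI[of _ "t + N"]) simp
    qed
    then show ?thesis by (simp add: W_def flow_add)
  qed
  have We: "emeasure m (W N) = emeasure m (W 0)" for N
    using emeasure_flow[OF Wm] by (subst Wshift) simp
  define E where "E = (\<Inter>n::nat. W (real n))"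
  have Em: "E \<in> sets borel" unfolding E_def by (intro sets.countable_INT) (auto simp: Wm)
  have Eeq: "E = {\<omega>. \<forall>N. \<exists>t\<ge>N. X (\<sigma> t \<omega>) \<in> U}"
  proof -
    have "(\<forall>N. \<exists>t\<ge>N. X (\<sigma> t \<omega>) \<in> U) \<longleftrightarrow> (\<forall>n::nat. \<exists>t\<ge>real n. X (\<sigma> t \<omega>) \<in> U)" for \<omega>
      by (meson order_trans real_arch_simple)
    then show ?thesis unfolding E_def W_def by blast
  qed
  have "(\<lambda>n. emeasure m (W (real n))) \<longlonglongrightarrow> emeasure m E"
    unfolding E_def
  proof (rule Lim_emeasure_decseq)
    show "range (\<lambda>n. W (real n)) \<subseteq> sets m" using Wm by (auto simp: sets_m)
    have "W (real (Suc n)) \<subseteq> W (real n)" for n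
      unfolding W_def by (intro Collect_mono ex_mono impI conj_mono) auto
    then show "decseq (\<lambda>n. W (real n))" by (rule decseq_SucI)
  qed simp
  moreover have "(\<lambda>n. emeasure m (W (real n))) = (\<lambda>_. emeasure m (W 0))" using We by (intro ext)
  ultimately have "emeasure m E = emeasure m (W 0)" using LIMSEQ_unique[OF _ tendsto_const] by auto
  moreover have "emeasure m {\<omega>. X \<omega> \<in> U} \<le> emeasure m (W 0)"
    using Wm[of 0] by (intro emeasure_mono) (auto simp: sets_m W_def intro!: exI[of _ 0])
  ultimately have "emeasure m E \<noteq> 0" using U by auto
  moreover have "\<sigma> s \<omega> \<in> E" if "\<omega> \<in> E" for s \<omega>
    unfolding Eeq
  proof (clarsimp)
    fix N
    obtain t where "t \<ge> N + s" "X (\<sigma> t \<omega>) \<in> U" using \<open>\<omega> \<in> E\<close> unfolding Eeq by blast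
    then show "\<exists>t\<ge>N. X (\<sigma> t (\<sigma> s \<omega>)) \<in> U"
      by (intro exI[of _ "t - s"]) (simp flip: flow_add)
  qed
  ultimately have "AE \<omega> in m. \<omega> \<in> E" using Em by (intro AE_invariant) auto
  then show "AE \<omega> in m. \<forall>N. \<exists>t\<ge>N. X (\<sigma> t \<omega>) \<in> U" unfolding Eeq by simp
  show "{\<omega>. \<forall>N. \<exists>t\<ge>N. X (\<sigma> t \<omega>) \<in> U} \<in> sets borel" using Em unfolding Eeq .
qed

end

section \<open>Continuity of the cocycle on the base, and time reversal\<close>

context base_flow
begin

lemma cocycle_int_continuous_base:
  assumes a: "continuous_on UNIV a"
  shows "continuous_on UNIV (\<lambda>\<omega>. cocycle_int \<sigma> a \<omega> t)"
proof -
  have *: "continuous_on UNIV (\<lambda>\<omega>. cocycle_int \<sigma> a \<omega> t)" if t: "t \<ge> 0" for t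
  proof -
    have c: "continuous_on UNIV (\<lambda>(\<omega>, s). a (\<sigma> s \<omega>))"
      unfolding case_prod_beta
      by (rule continuous_on_compose2[OF a]) (auto intro!: continuous_on_flow continuous_intros)
    have "cocycle_int \<sigma> a \<omega> t = integral {0..t} (\<lambda>s. a (\<sigma> s \<omega>))" for \<omega>
    proof -
      have "continuous_on {0..t} (\<lambda>s. a (\<sigma> s \<omega>))"
        using orbit_continuousI[OF a] by (auto simp: orbit_continuous_def intro: continuous_on_subset)
      then show ?thesis unfolding cocycle_int_def zero_ereal_def
        by (intro interval_integral_eq_integral t borel_integrable_atLeastAtMost') 
    qed
    moreover have "continuous_on UNIV (\<lambda>\<omega>. integral (cbox 0 t) (\<lambda>s. a (\<sigma> s \<omega>)))"
      by (rule integral_continuous_on_param) (use c in \<open>auto intro: continuous_on_subset\<close>)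
    ultimately show ?thesis by simp
  qed
  show ?thesis
  proof (cases "t \<ge> 0")
    case False
    have "cocycle_int \<sigma> a \<omega> t = - cocycle_int \<sigma> a (\<sigma> t \<omega>) (- t)" for \<omega>
      using cocycle_int_add[OF orbit_continuousI[OF a], of \<omega> t "- t"] by simp
    moreover have "continuous_on UNIV (\<lambda>\<omega>. cocycle_int \<sigma> a (\<sigma> t \<omega>) (- t))"
      by (rule continuous_on_compose2[OF *[of "- t"]])
        (use False in \<open>auto intro!: continuous_on_flow continuous_intros\<close>)
    ultimately show ?thesis by (simp add: continuous_on_minus)
  qed (rule *)
qed

lemma reverse_flow: "base_flow (\<lambda>t. \<sigma> (- t))"
proof
  have "continuous_on UNIV (\<lambda>(t, y). \<sigma> (- t) y)"
    unfolding case_prod_beta by (intro continuous_on_flow continuous_intros)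
  moreover have "\<sigma> (- (s + t)) y = \<sigma> (- s) (\<sigma> (- t) y)" for s t y
    using flow_add[of "- s" "- t" y] by simp
  ultimately show "continuous_flow_on UNIV (\<lambda>t. \<sigma> (- t))" by (simp add: continuous_flow_on_def)
qed

lemma cocycle_int_reverse:
  assumes F: "orbit_continuous F"
  shows "cocycle_int (\<lambda>t. \<sigma> (- t)) F \<omega> t = - cocycle_int \<sigma> F \<omega> (- t)"
proof -
  interpret R: base_flow "\<lambda>t. \<sigma> (- t)" by (rule reverse_flow)
  have "continuous_on UNIV (\<lambda>t. F (\<sigma> (- t) \<omega>))" for \<omega>
    using F continuous_on_compose2[of UNIV "\<lambda>t. F (\<sigma> t \<omega>)" UNIV uminus]
      continuous_on_minus[OF continuous_on_id, of UNIV]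
    by (auto simp: orbit_continuous_def)
  then have F': "R.orbit_continuous F" by (simp add: R.orbit_continuous_def)
  let ?d = "\<lambda>t. cocycle_int (\<lambda>t. \<sigma> (- t)) F \<omega> t + cocycle_int \<sigma> F \<omega> (- t)"
  have "(?d has_real_derivative 0) (at t)" for t
  proof -
    have "((\<lambda>t. cocycle_int \<sigma> F \<omega> (- t)) has_real_derivative F (\<sigma> (- t) \<omega>) * - 1) (at t)"
      by (rule DERIV_chain2[OF cocycle_int_deriv[OF F]]) (auto intro!: derivative_eq_intros)
    from DERIV_add[OF R.cocycle_int_deriv[OF F', of \<omega> t] this] show ?thesis by simp
  qed
  then have "?d t = ?d 0" using DERIV_isconst_all[of ?d] by blast
  then show ?thesis by simp
qed

end

lemma continuous_on_if_rays_closed: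
  fixes f :: "'a::topological_space \<Rightarrow> real"
  assumes "\<And>c. closed {x. f x \<le> c}" "\<And>c. closed {x. f x \<ge> c}"
  shows "continuous_on UNIV f"
proof -
  have "(f \<longlongrightarrow> f x) (at x)" for x
  proof (rule order_tendstoI)
    fix c assume "c < f x"
    moreover have "open (- {x. f x \<le> c})" using assms by blast
    ultimately have "\<forall>\<^sub>F y in nhds x. y \<in> - {x. f x \<le> c}" by (intro eventually_nhds_in_open) auto
    then show "\<forall>\<^sub>F y in at x. c < f y" by (simp add: eventually_at_filter eventually_mono)
  next
    fix c assume "f x < c"
    moreover have "open (- {x. f x \<ge> c})" using assms by blast
    ultimately have "\<forall>\<^sub>F y in nhds x. y \<in> - {x. f x \<ge> c}" by (intro eventually_nhds_in_open) auto
    then show "\<forall>\<^sub>F y in at x. f y < c" by (simp add: eventually_at_filter eventually_mono)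
  qed
  then show ?thesis by (simp add: continuous_on_def)
qed

subsection \<open>Minimal base flows\<close>

locale minimal_flow = base_flow +
  assumes minimal: "minimal_set (\<lambda>_. UNIV) \<sigma> UNIV"
begin

lemma compact_UNIV: "compact (UNIV :: 'a set)"
  using minimal by (simp add: minimal_set_def)

lemma closed_invariant_UNIV:
  assumes "closed K" "K \<noteq> {}" "\<And>t \<omega>. \<omega> \<in> K \<Longrightarrow> \<sigma> t \<omega> \<in> K"
  shows "K = UNIV"
proof -
  have "compact K" using compact_Int_closed[OF compact_UNIV assms(1)] by simp
  moreover have "invariant_set (\<lambda>_. UNIV) \<sigma> K"
    using flow_invariant_imageI[OF assms(3)] by (simp add: invariant_set_def)
  ultimately show ?thesis using minimal assms(2) by (simp add: minimal_set_def)
qed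

text \<open>The omega limit set, here the intersection of the closed tails \<open>F n\<close>, is
  nonempty by compactness and invariant under all real times, so minimality makes it the whole
  space.\<close>

lemma forward_orbit_dense:
  assumes U: "open U" "U \<noteq> {}"
  shows "\<exists>t\<ge>N. \<sigma> t \<omega> \<in> U"
proof -
  define F where "F n = closure {\<sigma> t \<omega> | t. t \<ge> real n}" for n :: nat
  define K where "K = (\<Inter>n. F n)"
  have "UNIV \<inter> \<Inter>(range F) \<noteq> {}"
  proof (rule compact_imp_fip[OF compact_UNIV])
    show "closed T" if "T \<in> range F" for T using that by (auto simp: F_def)
    fix F' assume "finite F'" "F' \<subseteq> range F"
    then obtain N where N: "finite N" "F' = F ` N" using finite_subset_image by metis
    have "\<sigma> (real (Max N)) \<omega> \<in> F n" if "n \<in> N" for n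
      unfolding F_def using N(1) that by (intro closure_subset[THEN subsetD]) auto
    then show "UNIV \<inter> \<Inter>F' \<noteq> {}" using N(2) by auto
  qed
  then have "K \<noteq> {}" by (simp add: K_def)
  moreover have "closed K" unfolding K_def F_def by auto
  moreover have "\<sigma> s x \<in> K" if x: "x \<in> K" for s x
    unfolding K_def
  proof (rule INT_I)
    fix n
    \<comment> \<open>Moving by a negative \<open>s\<close> loses time; a tail that starts at
      \<open>k \<ge> n - s\<close> is still beyond \<open>n\<close> after the move.\<close>
    obtain k :: nat where k: "real n - s \<le> real k" using real_arch_simple by blast
    have "\<sigma> s ` closure {\<sigma> t \<omega> | t. t \<ge> real k} \<subseteq> closure (\<sigma> s ` {\<sigma> t \<omega> | t. t \<ge> real k})"
      by (rule image_closure_subset)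
         (auto intro!: continuous_on_flow continuous_intros closure_subset[THEN subsetD])
    also have "\<dots> \<subseteq> F n" unfolding F_def
    proof (rule closure_mono, clarsimp)
      fix t assume "real k \<le> t"
      then show "\<exists>t'. \<sigma> s (\<sigma> t \<omega>) = \<sigma> t' \<omega> \<and> real n \<le> t'"
        using k by (intro exI[of _ "s + t"]) (auto simp: flow_add)
    qed
    finally show "\<sigma> s x \<in> F n" using x unfolding K_def F_def by blast
  qed
  ultimately have "K = UNIV" by (intro closed_invariant_UNIV)
  obtain n :: nat where n: "N \<le> real n" using real_arch_simple by blast
  obtain y where "y \<in> U" using U by auto
  moreover have "y \<in> F n" using \<open>K = UNIV\<close> by (auto simp: K_def)
  ultimately have "U \<inter> {\<sigma> t \<omega> | t. t \<ge> real n} \<noteq> {}"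
    using open_Int_closure_eq_empty[OF U(1)] unfolding F_def by blast
  then show ?thesis using n by (auto intro: order_trans)
qed

lemma reverse_minimal: "minimal_flow (\<lambda>t. \<sigma> (- t))"
proof (intro minimal_flow.intro reverse_flow minimal_flow_axioms.intro)
  have "invariant_set (\<lambda>_. UNIV) (\<lambda>t. \<sigma> (- t)) K \<longleftrightarrow> invariant_set (\<lambda>_. UNIV) \<sigma> K" for K
    unfolding invariant_set_def by (metis minus_minus)
  then show "minimal_set (\<lambda>_. UNIV) (\<lambda>t. \<sigma> (- t)) UNIV"
    using minimal by (simp add: minimal_set_def)
qed

lemma backward_orbit_dense:
  assumes "open U" "U \<noteq> {}"
  shows "\<exists>t\<le>0. \<sigma> t \<omega> \<in> U"
proof -
  interpret R: minimal_flow "\<lambda>t. \<sigma> (- t)" by (rule reverse_minimal)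
  obtain t where "t \<ge> 0" "\<sigma> (- t) \<omega> \<in> U" using R.forward_orbit_dense[OF assms] by blast
  then show ?thesis by (intro exI[of _ "- t"]) auto
qed

text \<open>Gottschalk--Hedlund. The supremum and the infimum of \<open>- \<integral>\<^sub>0\<^sup>t a\<close> over all times are
  a lower and an upper semicontinuous primitive; their difference is an invariant lower
  semicontinuous function, hence constant by minimality.\<close>

lemma continuous_primitive_of_forward_bounded:
  assumes a: "continuous_on UNIV a"
    and C: "\<And>t. t \<ge> 0 \<Longrightarrow> \<bar>cocycle_int \<sigma> a \<omega>0 t\<bar> \<le> C"
  shows "continuous_primitive \<sigma> a"
proof -
  let ?I = "cocycle_int \<sigma> a"
  note oc = orbit_continuousI[OF a]
  have cI: "continuous_on UNIV (\<lambda>\<omega>. ?I \<omega> t)" for t by (rule cocycle_int_continuous_base[OF a])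
  \<comment> \<open>A violation is an open condition on the base point, so the orbit of
    \<open>\<omega>0\<close> meets it at some time \<open>s \<ge> \<bar>t\<bar>\<close>. Then
    \<open>s\<close> and \<open>s + t\<close> are both nonnegative, and the two forward bounds add
    up to \<open>2 * C\<close>.\<close>
  have B: "\<bar>?I \<omega> t\<bar> \<le> 2 * C" for \<omega> t
  proof (rule ccontr)
    assume n: "\<not> \<bar>?I \<omega> t\<bar> \<le> 2 * C"
    have "open {\<omega>. 2 * C < \<bar>?I \<omega> t\<bar>}"
      by (intro open_Collect_less continuous_intros cI)
    then have "\<exists>s\<ge>\<bar>t\<bar>. \<sigma> s \<omega>0 \<in> {\<omega>. 2 * C < \<bar>?I \<omega> t\<bar>}"
      by (rule forward_orbit_dense) (use n in \<open>auto simp: not_le\<close>)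
    then obtain s where s: "s \<ge> \<bar>t\<bar>" "2 * C < \<bar>?I (\<sigma> s \<omega>0) t\<bar>" by blast
    have "?I \<omega>0 (s + t) = ?I \<omega>0 s + ?I (\<sigma> s \<omega>0) t" by (rule cocycle_int_add[OF oc])
    moreover have "s + t \<ge> 0" "s \<ge> 0" using s by linarith+
    ultimately show False using C[of "s + t"] C[of s] s(2) by linarith
  qed
  define p where "p \<omega> = (SUP t. - ?I \<omega> t)" for \<omega>
  define q where "q \<omega> = (INF t. - ?I \<omega> t)" for \<omega>
  have ba: "bdd_above (range (\<lambda>t. - ?I \<omega> t))" for \<omega>
    by (rule bdd_aboveI[of _ "2 * C"]) (use B in \<open>auto simp: abs_le_iff\<close>)
  have bb: "bdd_below (range (\<lambda>t. - ?I \<omega> t))" for \<omega>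
    by (rule bdd_belowI[of _ "- (2 * C)"]) (use B in \<open>auto simp: abs_le_iff\<close>)
  have p_le: "p \<omega> \<le> c \<longleftrightarrow> (\<forall>t. - ?I \<omega> t \<le> c)" for \<omega> c
    unfolding p_def using ba by (subst cSUP_le_iff) auto
  have q_ge: "c \<le> q \<omega> \<longleftrightarrow> (\<forall>t. c \<le> - ?I \<omega> t)" for \<omega> c
    unfolding q_def using bb by (subst le_cINF_iff) auto
  have shift: "- ?I (\<sigma> s \<omega>) t = - ?I \<omega> (s + t) + ?I \<omega> s" for s t \<omega>
    using cocycle_int_add[OF oc, of \<omega> s t] by simp
  have allshift: "(\<forall>t. P (s + t)) \<longleftrightarrow> (\<forall>t. P t)" for P :: "real \<Rightarrow> bool" and s
    by (metis add.commute diff_add_cancel)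
  have p_shift: "p (\<sigma> s \<omega>) = p \<omega> + ?I \<omega> s" for s \<omega>
  proof -
    have "p (\<sigma> s \<omega>) \<le> c \<longleftrightarrow> p \<omega> + ?I \<omega> s \<le> c" for c
    proof -
      have "p (\<sigma> s \<omega>) \<le> c \<longleftrightarrow> (\<forall>t. - ?I \<omega> (s + t) \<le> c - ?I \<omega> s)"
        unfolding p_le shift by (simp add: algebra_simps)
      also have "\<dots> \<longleftrightarrow> p \<omega> \<le> c - ?I \<omega> s"
        unfolding p_le using allshift[of "\<lambda>t. - ?I \<omega> t \<le> c - ?I \<omega> s" s] .
      finally show ?thesis by linarith
    qed
    then show ?thesis by (metis order_antisym order_refl)
  qed
  have q_shift: "q (\<sigma> s \<omega>) = q \<omega> + ?I \<omega> s" for s \<omega>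
  proof -
    have "c \<le> q (\<sigma> s \<omega>) \<longleftrightarrow> c \<le> q \<omega> + ?I \<omega> s" for c
    proof -
      have "c \<le> q (\<sigma> s \<omega>) \<longleftrightarrow> (\<forall>t. c - ?I \<omega> s \<le> - ?I \<omega> (s + t))"
        unfolding q_ge shift by (simp add: algebra_simps)
      also have "\<dots> \<longleftrightarrow> c - ?I \<omega> s \<le> q \<omega>"
        unfolding q_ge using allshift[of "\<lambda>t. c - ?I \<omega> s \<le> - ?I \<omega> t" s] .
      finally show ?thesis by linarith
    qed
    then show ?thesis by (metis order_antisym order_refl)
  qed
  have d: "p \<omega> - q \<omega> \<le> c \<longleftrightarrow> (\<forall>t s. - ?I \<omega> t + ?I \<omega> s \<le> c)" for \<omega> c
  proof -
    have "p \<omega> - q \<omega> \<le> c \<longleftrightarrow> p \<omega> \<le> c + q \<omega>" by linarith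
    also have "\<dots> \<longleftrightarrow> (\<forall>t. - ?I \<omega> t - c \<le> q \<omega>)" unfolding p_le by (simp add: algebra_simps)
    also have "\<dots> \<longleftrightarrow> (\<forall>t s. - ?I \<omega> t + ?I \<omega> s \<le> c)" unfolding q_ge by (simp add: algebra_simps)
    finally show ?thesis .
  qed
  have "p \<omega> - q \<omega> \<le> p \<omega>' - q \<omega>'" for \<omega> \<omega>'
  proof -
    let ?K = "{x. p x - q x \<le> p \<omega>' - q \<omega>'}"
    have "?K = UNIV"
    proof (rule closed_invariant_UNIV)
      show "closed ?K" unfolding d
        by (intro closed_Collect_all closed_Collect_le continuous_intros cI)
      show "?K \<noteq> {}" by auto
    qed (simp add: p_shift q_shift)
    then show ?thesis by blast
  qed
  then have eq: "p \<omega> = q \<omega> + (p \<omega>0 - q \<omega>0)" for \<omega> by (smt (verit))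
  have "continuous_on UNIV p"
  \<comment> \<open>Sublevel sets of \<open>p\<close> are closed because it is a supremum of
    continuous functions, superlevel sets because up to a constant it equals the infimum
    \<open>q\<close>.\<close>
  proof (rule continuous_on_if_rays_closed)
    show "closed {\<omega>. p \<omega> \<le> c}" for c
      unfolding p_le by (intro closed_Collect_all closed_Collect_le continuous_intros cI)
    have "{\<omega>. p \<omega> \<ge> c} = {\<omega>. c - (p \<omega>0 - q \<omega>0) \<le> q \<omega>}" for c
      by (subst eq) (auto simp: algebra_simps)
    then show "closed {\<omega>. p \<omega> \<ge> c}" for c
      unfolding q_ge by (simp, intro closed_Collect_all closed_Collect_le continuous_intros cI)
  qed
  then show ?thesis unfolding continuous_primitive_def using p_shift by (intro exI[of _ p]) simp
qed

text \<open>An upper bound together with a lower bound on one half-line bounds the integral there,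
  and Gottschalk-Hedlund, used for the reversed flow in the backward case, would yield a continuous
  primitive. In this form the set is visibly a countable union of closed sets and invariant.\<close>

lemma Omega_sup_eq:
  assumes a: "continuous_on UNIV a" and n: "\<not> continuous_primitive \<sigma> a"
  shows "Omega_sup \<sigma> a = {\<omega>. bdd_above (range (cocycle_int \<sigma> a \<omega>))}"
proof -
  let ?I = "cocycle_int \<sigma> a"
  have "\<not> bdd_below (?I \<omega> ` {..0}) \<and> \<not> bdd_below (?I \<omega> ` {0..})" if b: "bdd_above (range (?I \<omega>))" for \<omega>
  proof (intro conjI notI)
    obtain c where c: "\<And>t. ?I \<omega> t \<le> c" using b by (auto simp: bdd_above_def)
    show False if bb: "bdd_below (?I \<omega> ` {0..})"
    proof -
      obtain l where "\<And>t. t \<ge> 0 \<Longrightarrow> l \<le> ?I \<omega> t" using bb by (auto simp: bdd_below_def)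
      then have "\<bar>?I \<omega> t\<bar> \<le> max \<bar>l\<bar> \<bar>c\<bar>" if "t \<ge> 0" for t using c[of t] that by fastforce
      then show False using n continuous_primitive_of_forward_bounded[OF a] by blast
    qed
    show False if bb: "bdd_below (?I \<omega> ` {..0})"
    proof -
      interpret R: minimal_flow "\<lambda>t. \<sigma> (- t)" by (rule reverse_minimal)
      let ?J = "cocycle_int (\<lambda>t. \<sigma> (- t)) a"
      have J: "?J \<omega> t = - ?I \<omega> (- t)" for \<omega> t
        by (rule cocycle_int_reverse[OF orbit_continuousI[OF a]])
      obtain l where l: "\<And>t. t \<le> 0 \<Longrightarrow> l \<le> ?I \<omega> t" using bb by (auto simp: bdd_below_def)
      have "\<bar>?J \<omega> t\<bar> \<le> max \<bar>l\<bar> \<bar>c\<bar>" if "t \<ge> 0" for t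
        using c[of "- t"] l[of "- t"] that unfolding J by linarith
      then have "continuous_primitive (\<lambda>t. \<sigma> (- t)) a"
        using R.continuous_primitive_of_forward_bounded[OF a] by blast
      then obtain h where h: "continuous_on UNIV h" "\<And>\<omega> t. h (\<sigma> (- t) \<omega>) - h \<omega> = - ?I \<omega> (- t)"
        unfolding continuous_primitive_def J by blast
      \<comment> \<open>Reversing time changes the sign of the integral, so a primitive for the
        reversed flow must be negated.\<close>
      have "continuous_primitive \<sigma> a" unfolding continuous_primitive_def
      proof (intro exI[of _ "\<lambda>\<omega>. - h \<omega>"] conjI allI)
        show "continuous_on UNIV (\<lambda>\<omega>. - h \<omega>)" using h(1) by (intro continuous_intros)
        show "- h (\<sigma> t \<omega>) - - h \<omega> = ?I \<omega> t" for \<omega> t using h(2)[of "- t" \<omega>] by simp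
      qed
      then show False using n by blast
    qed
  qed
  then show ?thesis unfolding Omega_sup_def by (intro Collect_cong iffI) simp_all
qed

lemma Omega_sup_borel:
  assumes a: "continuous_on UNIV a" and n: "\<not> continuous_primitive \<sigma> a"
  shows "Omega_sup \<sigma> a \<in> sets borel"
proof -
  have "bdd_above (range (cocycle_int \<sigma> a \<omega>)) \<longleftrightarrow> (\<exists>k::nat. \<forall>t. cocycle_int \<sigma> a \<omega> t \<le> real k)" for \<omega>
    unfolding bdd_above_def by (auto intro: order_trans dest: ) (meson order_trans real_arch_simple)
  then have "Omega_sup \<sigma> a = (\<Union>k::nat. {\<omega>. \<forall>t. cocycle_int \<sigma> a \<omega> t \<le> real k})"
    unfolding Omega_sup_eq[OF assms] by auto
  also have "\<dots> \<in> sets borel"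
  proof -
    have "closed {\<omega>. \<forall>t. cocycle_int \<sigma> a \<omega> t \<le> real k}" for k
      by (intro closed_Collect_all closed_Collect_le continuous_intros cocycle_int_continuous_base[OF a])
    then show ?thesis by (intro sets.countable_UN' ballI) auto
  qed
  finally show ?thesis .
qed

lemma Omega_sup_invariant:
  assumes a: "continuous_on UNIV a" and n: "\<not> continuous_primitive \<sigma> a" and \<omega>: "\<omega> \<in> Omega_sup \<sigma> a"
  shows "\<sigma> s \<omega> \<in> Omega_sup \<sigma> a"
proof -
  obtain c where "\<And>t. cocycle_int \<sigma> a \<omega> t \<le> c"
    using \<omega> by (auto simp: Omega_sup_eq[OF a n] bdd_above_def)
  then have "cocycle_int \<sigma> a (\<sigma> s \<omega>) t \<le> c - cocycle_int \<sigma> a \<omega> s" for t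
    using cocycle_int_add[OF orbit_continuousI[OF a], of \<omega> s t] by (metis add_diff_cancel_left' diff_right_mono)
  then show ?thesis unfolding Omega_sup_eq[OF a n] by (auto simp: bdd_above_def)
qed

end

section \<open>Almost sure boundedness of the cocycle, and Birkhoff's theorem\<close>

context ergodic_flow
begin

text \<open>\<open>H\<close> is the supremum of the integrals over past integer times. The quantity
  \<open>G\<close> by which a new time step breaks this record is nonnegative and bounded, and it
  has mean zero, so records are almost never broken. Hence \<open>H\<close> minus the integral up to
  an integer time \<open>k\<close> is the value of \<open>H\<close> there, which is nonnegative;
  this bounds the integrals in the future.\<close>

lemma AE_bdd_above_cocycle:
  assumes a: "continuous_on UNIV a" and C: "\<And>\<omega>. \<bar>a \<omega>\<bar> \<le> C" and z: "(\<integral>\<omega>. a \<omega> \<partial>m) = 0"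
    and b: "AE \<omega> in m. bdd_above (cocycle_int \<sigma> a \<omega> ` {..0})"
  shows "AE \<omega> in m. bdd_above (range (cocycle_int \<sigma> a \<omega>))"
proof -
  let ?I = "cocycle_int \<sigma> a"
  note oc = orbit_continuousI[OF a]
  have am: "a \<in> borel_measurable borel" using a by (rule borel_measurable_continuous_onI)
  have C0: "C \<ge> 0" using C abs_ge_zero order_trans by blast
  \<comment> \<open>Integer times keep the supremum countable and thus measurable;
    \<open>real_of_ereal\<close> supplies a value also on the null set where the supremum is
    infinite.\<close>
  define H where "H \<omega> = real_of_ereal (SUP n::nat. ereal (?I \<omega> (- real n)))" for \<omega>
  have Hm: "H \<in> borel_measurable borel"
    using cocycle_int_measurable[OF am oc] unfolding H_def by (simp add: measurable_m)
  have H1: "?I \<omega> (- real n) \<le> H \<omega>" and H2: "(\<And>n. ?I \<omega> (- real n) \<le> y) \<Longrightarrow> H \<omega> \<le> y"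
    if bd: "bdd_above (?I \<omega> ` {..0})" for \<omega> n y
  proof -
    obtain c where c: "\<And>t. t \<le> 0 \<Longrightarrow> ?I \<omega> t \<le> c" using bd by (auto simp: bdd_above_def)
    let ?S = "SUP n::nat. ereal (?I \<omega> (- real n))"
    have up: "ereal (?I \<omega> (- real n)) \<le> ?S" for n :: nat by (intro SUP_upper) auto
    have "?S \<le> ereal c" using c by (intro SUP_least) auto
    moreover have "ereal 0 \<le> ?S" using up[of 0] by simp
    ultimately have fin: "ereal (H \<omega>) = ?S" unfolding H_def
      by (intro ereal_real') auto
    show "?I \<omega> (- real n) \<le> H \<omega>" using up[of n] by (simp flip: fin)
    show "H \<omega> \<le> y" if "\<And>n. ?I \<omega> (- real n) \<le> y"
    proof -
      have "?S \<le> ereal y" using that by (intro SUP_least) auto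
      then show ?thesis by (simp flip: fin)
    qed
  qed
  define G where "G \<omega> = H (\<sigma> 1 \<omega>) - H \<omega> + ?I \<omega> 1" for \<omega>
  have b1: "AE \<omega> in m. bdd_above (?I (\<sigma> 1 \<omega>) ` {..0})" using AE_flow[OF b] .
  have I1: "\<bar>?I \<omega> 1\<bar> \<le> C" for \<omega> using cocycle_int_bound[OF oc C, of \<omega> 1] by simp
  have Im: "(\<lambda>\<omega>. ?I \<omega> 1) \<in> borel_measurable m" by (rule cocycle_int_measurable[OF am oc])
  have G: "AE \<omega> in m. 0 \<le> G \<omega> \<and> G \<omega> \<le> C"
    using b b1
  proof eventually_elim
    case (elim \<omega>)
    \<comment> \<open>Seen from \<open>\<sigma> 1 \<omega>\<close>, the past integer times are those
      of \<omega> and the new time 1, up to subtracting the integral over one unit. The new time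
      raises the supremum by at most \<open>C\<close>, as \<open>H\<close> is nonnegative.\<close>
    have sh: "?I (\<sigma> 1 \<omega>) (- real n) = ?I \<omega> (1 - real n) - ?I \<omega> 1" for n
      using cocycle_int_add[OF oc, of \<omega> 1 "- real n"] by simp
    have "H \<omega> \<le> H (\<sigma> 1 \<omega>) + ?I \<omega> 1"
    proof (rule H2[OF elim(1)])
      fix n
      show "?I \<omega> (- real n) \<le> H (\<sigma> 1 \<omega>) + ?I \<omega> 1"
        using H1[OF elim(2), of "Suc n"] sh[of "Suc n"] by simp
    qed
    moreover have "H (\<sigma> 1 \<omega>) \<le> H \<omega> + C - ?I \<omega> 1"
    proof (rule H2[OF elim(2)])
      fix n
      show "?I (\<sigma> 1 \<omega>) (- real n) \<le> H \<omega> + C - ?I \<omega> 1"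
      proof (cases n)
        case 0
        then show ?thesis using sh[of 0] H1[OF elim(1), of 0] I1[of \<omega>] by simp
      next
        case (Suc k)
        then show ?thesis using sh[of n] H1[OF elim(1), of k] C0 by simp
      qed
    qed
    ultimately show ?case unfolding G_def by linarith
  qed
  have Hm': "H \<in> borel_measurable m" using Hm by (simp add: measurable_m)
  have Hs: "(\<lambda>\<omega>. H (\<sigma> 1 \<omega>)) \<in> borel_measurable m" by (rule flow_measurable_compose[OF Hm])
  have "AE \<omega> in m. G \<omega> = 0"
  proof (rule AE_zero_of_coboundary[where u = "\<lambda>\<omega>. - H \<omega>" and I = "\<lambda>\<omega>. ?I \<omega> 1" and C = C and K = C])
    show "(\<lambda>\<omega>. - H \<omega>) \<in> borel_measurable borel" using Hm by measurable
    show "G \<in> borel_measurable m" unfolding G_def using Hm' Hs Im by measurable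
    show "(\<integral>\<omega>. ?I \<omega> 1 \<partial>m) = 0" using integral_cocycle_int[OF am oc C] z by simp
  qed (use G I1 Im in \<open>auto simp: G_def\<close>)
  then have "AE \<omega> in m. \<forall>k::nat. G (\<sigma> (real k) \<omega>) = 0"
    by (intro AE_all_countable[THEN iffD2] allI AE_flow)
  moreover have "AE \<omega> in m. \<forall>k::nat. bdd_above (?I (\<sigma> (real k) \<omega>) ` {..0})"
    by (intro AE_all_countable[THEN iffD2] allI AE_flow b)
  ultimately show ?thesis
  proof eventually_elim
    case (elim \<omega>)
    have k: "?I \<omega> (real k) \<le> H \<omega>" for k
    proof -
      have "H (\<sigma> (real k) \<omega>) = H \<omega> - ?I \<omega> (real k)"
      proof (induction k)
        case (Suc k)
        have "H (\<sigma> (real (Suc k)) \<omega>) = H (\<sigma> 1 (\<sigma> (real k) \<omega>))" by (simp flip: flow_add)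
        also have "\<dots> = H (\<sigma> (real k) \<omega>) - ?I (\<sigma> (real k) \<omega>) 1"
          using elim(1)[rule_format, of k] unfolding G_def by simp
        also have "\<dots> = H \<omega> - ?I \<omega> (real (Suc k))"
          using Suc cocycle_int_add[OF oc, of \<omega> "real k" 1] by (simp add: add.commute)
        finally show ?case .
      qed simp
      moreover have "0 \<le> H (\<sigma> (real k) \<omega>)" using H1[of "\<sigma> (real k) \<omega>" 0] elim(2) by auto
      ultimately show ?thesis by simp
    qed
    obtain c where c: "\<And>t. t \<le> 0 \<Longrightarrow> ?I \<omega> t \<le> c" using elim(2)[rule_format, of 0] by (auto simp: bdd_above_def)
    have "?I \<omega> t \<le> max c (H \<omega> + C)" for t
    proof (cases "t \<le> 0")
      case True then show ?thesis using c by (simp add: le_max_iff_disj)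
    next
      case False
      define n where "n = nat \<lfloor>t\<rfloor>"
      have n: "real n \<le> t" "t \<le> real n + 1" using False unfolding n_def by linarith+
      have "\<bar>?I \<omega> t - ?I \<omega> (real n)\<bar> \<le> C * \<bar>t - real n\<bar>" by (rule cocycle_int_lipschitz[OF oc C])
      also have "\<dots> \<le> C * 1" using n C0 by (intro mult_left_mono) auto
      finally show ?thesis using k[of n] by linarith
    qed
    then show ?case by (auto simp: bdd_above_def)
  qed
qed

text \<open>Garsia's proof of the maximal ergodic theorem: \<open>M n\<close> is the maximum of 0
  and the first \<open>n\<close> sums. Where \<open>M (Suc n)\<close> is positive, \<open>f\<close>
  dominates the difference of \<open>M (Suc n)\<close> and its translate by the flow, which has
  integral zero. By assumption these sets exhaust the space up to a null set.\<close>

lemma maximal_ergodic: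
  fixes f :: "'a \<Rightarrow> real"
  assumes f: "f \<in> borel_measurable borel" and C: "\<And>\<omega>. \<bar>f \<omega>\<bar> \<le> C"
    and S: "\<And>\<omega>. S \<omega> 0 = 0" "\<And>\<omega> n. S \<omega> (Suc n) = f \<omega> + S (\<sigma> 1 \<omega>) n"
    and pos: "AE \<omega> in m. \<exists>n. S \<omega> n > 0"
  shows "(\<integral>\<omega>. f \<omega> \<partial>m) \<ge> 0"
proof -
  define M where "M = rec_nat (\<lambda>_. 0::real) (\<lambda>_ h \<omega>. max 0 (f \<omega> + h (\<sigma> 1 \<omega>)))"
  have M0: "M 0 = (\<lambda>_. 0)" and MS: "M (Suc n) \<omega> = max 0 (f \<omega> + M n (\<sigma> 1 \<omega>))" for n \<omega>
    by (auto simp: M_def)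
  have C0: "C \<ge> 0" using C abs_ge_zero order_trans by blast
  have M_nn: "0 \<le> M n \<omega>" for n \<omega> by (cases n) (auto simp: M0 MS)
  have M_mono: "M n \<omega> \<le> M (Suc n) \<omega>" for n \<omega>
  proof (induction n arbitrary: \<omega>)
    case 0 show ?case by (simp add: M0 M_nn)
  next
    case (Suc n)
    show ?case using Suc[of "\<sigma> 1 \<omega>"] by (simp add: MS[of n] MS[of "Suc n"] max.mono)
  qed
  have M_le: "M n \<omega> \<le> real n * C" for n \<omega>
  proof (induction n arbitrary: \<omega>)
    case (Suc n)
    have "M n (\<sigma> 1 \<omega>) \<le> real n * C" by (rule Suc)
    moreover have "f \<omega> \<le> C" using C[of \<omega>] by linarith
    moreover have "real (Suc n) * C = C + real n * C" by (simp add: algebra_simps)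
    moreover have "0 \<le> real n * C" using C0 by simp
    ultimately show ?case using C0 unfolding MS by linarith
  qed (simp add: M0)
  have SM: "S \<omega> n \<le> M n \<omega>" for n \<omega>
  proof (induction n arbitrary: \<omega>)
    case (Suc n)
    show ?case using Suc[of "\<sigma> 1 \<omega>"] by (simp add: MS S le_max_iff_disj)
  qed (simp add: M0 S)
  have Mm: "M n \<in> borel_measurable borel" for n
  proof (induction n)
    case (Suc n)
    have "(\<lambda>\<omega>. M n (\<sigma> 1 \<omega>)) \<in> borel_measurable borel"
      using flow_measurable_compose[OF Suc] by (simp add: measurable_m)
    then have "(\<lambda>\<omega>. max 0 (f \<omega> + M n (\<sigma> 1 \<omega>))) \<in> borel_measurable borel"
      using f by (intro borel_measurable_max borel_measurable_add borel_measurable_const)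
    then show ?case unfolding MS[abs_def] .
  qed (simp add: M0)
  have Mm': "M n \<in> borel_measurable m" for n using Mm by (simp add: measurable_m)
  have fm: "f \<in> borel_measurable m" using f by (simp add: measurable_m)
  let ?E = "\<lambda>n. {\<omega>. M (Suc n) \<omega> > 0}"
  have Em: "?E n \<in> sets m" for n
    using borel_measurable_less[OF borel_measurable_const Mm', of 0 "Suc n"] by simp
  have nonneg: "(\<integral>\<omega>. indicator (?E n) \<omega> * f \<omega> \<partial>m) \<ge> 0" for n
  proof -
    have i1: "integrable m (\<lambda>\<omega>. M (Suc n) \<omega>)"
      by (rule integrable_bounded[where C = "real (Suc n) * C"]) (use Mm' M_nn M_le in \<open>auto simp: abs_of_nonneg simp del: of_nat_Suc\<close>)
    have i2: "integrable m (\<lambda>\<omega>. M (Suc n) (\<sigma> 1 \<omega>))"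
      by (rule integrable_bounded[where C = "real (Suc n) * C"])
        (use flow_measurable_compose[OF Mm] M_nn M_le in \<open>auto simp: abs_of_nonneg simp del: of_nat_Suc\<close>)
    have i3: "integrable m (\<lambda>\<omega>. indicator (?E n) \<omega> * f \<omega>)"
    proof (rule integrable_bounded[where C = C])
      show "(\<lambda>\<omega>. indicator (?E n) \<omega> * f \<omega>) \<in> borel_measurable m"
        using fm Em by (intro borel_measurable_times borel_measurable_indicator)
    qed (use C C0 in \<open>auto simp: indicator_def\<close>)
    have "0 = (\<integral>\<omega>. M (Suc n) \<omega> - M (Suc n) (\<sigma> 1 \<omega>) \<partial>m)"
      using i1 i2 integral_flow[OF Mm] by simp
    also have "\<dots> \<le> (\<integral>\<omega>. indicator (?E n) \<omega> * f \<omega> \<partial>m)"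
    proof (rule integral_mono[OF _ i3])
      show "integrable m (\<lambda>\<omega>. M (Suc n) \<omega> - M (Suc n) (\<sigma> 1 \<omega>))" using i1 i2 by simp
      show "M (Suc n) \<omega> - M (Suc n) (\<sigma> 1 \<omega>) \<le> indicator (?E n) \<omega> * f \<omega>" for \<omega>
        using M_mono[of n "\<sigma> 1 \<omega>"] M_nn[of "Suc n" "\<sigma> 1 \<omega>"] M_nn[of "Suc n" \<omega>] MS[of n \<omega>]
        by (auto simp: indicator_def)
    qed
    finally show ?thesis .
  qed
  have "(\<lambda>n. \<integral>\<omega>. indicator (?E n) \<omega> * f \<omega> \<partial>m) \<longlonglongrightarrow> (\<integral>\<omega>. f \<omega> \<partial>m)"
  proof (rule integral_dominated_convergence[where w = "\<lambda>_. C"])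
    show "AE \<omega> in m. (\<lambda>n. indicator (?E n) \<omega> * f \<omega>) \<longlonglongrightarrow> f \<omega>"
      using pos
    proof eventually_elim
      case (elim \<omega>)
      then obtain N where N: "M N \<omega> > 0" using SM less_le_trans by blast
      have "M n \<omega> > 0" if "n \<ge> N" for n
        using lift_Suc_mono_le[of "\<lambda>n. M n \<omega>", OF M_mono that] N by linarith
      then have "indicator (?E n) \<omega> * f \<omega> = f \<omega>" if "n \<ge> N" for n
        using that by (auto simp: indicator_def)
      then show ?case by (intro tendsto_eventually) (auto simp: eventually_sequentially)
    qed
    show "(\<lambda>\<omega>. indicator (?E n) \<omega> * f \<omega>) \<in> borel_measurable m" for n
      using fm Em by (intro borel_measurable_times borel_measurable_indicator)
    show "AE \<omega> in m. norm (indicator (?E n) \<omega> * f \<omega>) \<le> C" for n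
      using C C0 by (auto simp: indicator_def)
  qed (use fm in auto)
  then show ?thesis using nonneg by (intro LIMSEQ_le_const) auto
qed

text \<open>The upper limit is invariant, so if it exceeded \<open>c\<close> with positive
  probability it would do so almost everywhere. The maximal ergodic theorem for
  \<open>?P \<omega> 1 - c\<close> would then give a nonnegative integral, whereas its value is
  \<open>- e\<close>.\<close>

lemma birkhoff_limsup:
  assumes F: "F \<in> borel_measurable borel" "orbit_continuous F" and C: "\<And>\<omega>. \<bar>F \<omega>\<bar> \<le> C"
    and e: "e > 0"
  shows "AE \<omega> in m. limsup (\<lambda>n. ereal (cocycle_int \<sigma> F \<omega> (real n) / real n)) \<le> (\<integral>\<omega>. F \<omega> \<partial>m) + e"
proof -
  let ?P = "cocycle_int \<sigma> F"
  define c where "c = (\<integral>\<omega>. F \<omega> \<partial>m) + e"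
  define l where "l \<omega> = limsup (\<lambda>n. ereal (?P \<omega> (real n) / real n))" for \<omega>
  have Pm: "(\<lambda>\<omega>. ?P \<omega> t) \<in> borel_measurable borel" for t
    using cocycle_int_measurable[OF F] by (simp add: measurable_m)
  have lm: "l \<in> borel_measurable borel" unfolding l_def[abs_def] using Pm by measurable
  have l_inv: "l (\<sigma> s \<omega>) = l \<omega>" for s \<omega>
  proof -
    let ?v = "\<lambda>n. ?P \<omega> (real n) / real n"
    let ?u = "\<lambda>n. ?P (\<sigma> s \<omega>) (real n) / real n - ?v n"
    have "\<bar>?P (\<sigma> s \<omega>) (real n) - ?P \<omega> (real n)\<bar> \<le> 2 * C * \<bar>s\<bar>" for n
    proof -
      have "?P (\<sigma> s \<omega>) (real n) = ?P \<omega> (s + real n) - ?P \<omega> s"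
        using cocycle_int_add[OF F(2), of \<omega> s "real n"] by simp
      moreover have "\<bar>?P \<omega> (s + real n) - ?P \<omega> (real n)\<bar> \<le> C * \<bar>s\<bar>"
        using cocycle_int_lipschitz[OF F(2) C, of \<omega> "s + real n" "real n"] by simp
      moreover have "\<bar>?P \<omega> s\<bar> \<le> C * \<bar>s\<bar>" by (rule cocycle_int_bound[OF F(2) C])
      ultimately show ?thesis by linarith
    qed
    then have "\<bar>?u n\<bar> \<le> 2 * C * \<bar>s\<bar> / real n" for n
      unfolding diff_divide_distrib[symmetric] abs_divide
      by (simp add: divide_right_mono)
    moreover have "(\<lambda>n. 2 * C * \<bar>s\<bar> / real n) \<longlonglongrightarrow> 0" by (rule lim_const_over_n)
    ultimately have "?u \<longlonglongrightarrow> 0" by (intro Lim_null_comparison[of ?u]) auto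
    then have "(\<lambda>n. ereal (?u n)) \<longlonglongrightarrow> ereal 0" by simp
    from ereal_limsup_lim_add[OF this, of "\<lambda>n. ereal (?v n)"]
    show ?thesis by (simp add: l_def)
  qed
  define E where "E = {\<omega>. l \<omega> > ereal c}"
  have Em: "E \<in> sets borel" unfolding E_def using lm by measurable
  have "emeasure m E = 0"
  proof (rule ccontr)
    assume "emeasure m E \<noteq> 0"
    then have E: "AE \<omega> in m. \<omega> \<in> E" using Em l_inv by (intro AE_invariant) (auto simp: E_def)
    define f where "f \<omega> = ?P \<omega> 1 - c" for \<omega>
    have P1: "\<bar>?P \<omega> 1\<bar> \<le> C" for \<omega> using cocycle_int_bound[OF F(2) C, of \<omega> 1] by simp
    have "(\<integral>\<omega>. f \<omega> \<partial>m) \<ge> 0"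
    proof (rule maximal_ergodic[where S = "\<lambda>\<omega> n. ?P \<omega> (real n) - real n * c" and C = "C + \<bar>c\<bar>"])
      show "f \<in> borel_measurable borel" unfolding f_def using Pm by measurable
      show "\<bar>f \<omega>\<bar> \<le> C + \<bar>c\<bar>" for \<omega> unfolding f_def using P1[of \<omega>] by linarith
      show "?P \<omega> (real (Suc n)) - real (Suc n) * c = f \<omega> + (?P (\<sigma> 1 \<omega>) (real n) - real n * c)" for \<omega> n
        using cocycle_int_add[OF F(2), of \<omega> 1 "real n"] by (simp add: f_def algebra_simps)
      show "AE \<omega> in m. \<exists>n. 0 < ?P \<omega> (real n) - real n * c"
        using E
      proof eventually_elim
        case (elim \<omega>)
        show ?case
        proof (rule ccontr)
          assume "\<nexists>n. 0 < ?P \<omega> (real n) - real n * c"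
          then have "?P \<omega> (real n) \<le> c * real n" for n by (simp add: not_less mult.commute)
          then have "\<forall>\<^sub>F n in sequentially. ereal (?P \<omega> (real n) / real n) \<le> ereal c"
            by (intro eventually_sequentiallyI[of 1]) (simp add: divide_le_eq)
          then have "l \<omega> \<le> ereal c" unfolding l_def by (rule Limsup_bounded)
          then show False using elim by (simp add: E_def)
        qed
      qed
    qed simp
    moreover have "(\<integral>\<omega>. f \<omega> \<partial>m) = - e"
    proof -
      have "integrable m (\<lambda>\<omega>. ?P \<omega> 1)"
        by (rule integrable_bounded[OF _ P1]) (use Pm in \<open>simp add: measurable_m\<close>)
      then show ?thesis unfolding f_def
        using integral_cocycle_int[OF F C] using prob_space by (simp add: c_def)
    qed
    ultimately show False using e by simp
  qed
  then have "AE \<omega> in m. \<omega> \<notin> E" using Em by (intro AE_not_in) (auto simp: null_sets_def sets_m)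
  then show ?thesis unfolding E_def l_def c_def by (simp add: not_less)
qed

text \<open>Upper bounds for \<open>F\<close> and for its negative give convergence along the
  integers; boundedness of \<open>F\<close> controls the fractional part of the time.\<close>

theorem birkhoff:
  assumes F: "F \<in> borel_measurable borel" "orbit_continuous F" and C: "\<And>\<omega>. \<bar>F \<omega>\<bar> \<le> C"
  shows "AE \<omega> in m. ((\<lambda>t. 1 / t * cocycle_int \<sigma> F \<omega> t) \<longlongrightarrow> (\<integral>\<omega>. F \<omega> \<partial>m)) at_top"
proof -
  define c where "c = (\<integral>\<omega>. F \<omega> \<partial>m)"
  let ?P = "cocycle_int \<sigma> F"
  have C0: "C \<ge> 0" using C abs_ge_zero order_trans by blast
  have F': "(\<lambda>\<omega>. - F \<omega>) \<in> borel_measurable borel" "orbit_continuous (\<lambda>\<omega>. - F \<omega>)"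
    using F by (auto simp: orbit_continuous_def intro: continuous_on_minus)
  have "AE \<omega> in m. \<forall>k::nat. limsup (\<lambda>n. ereal (?P \<omega> (real n) / real n)) \<le> c + inverse (real (Suc k))"
    unfolding AE_all_countable c_def using birkhoff_limsup[OF F C] by simp
  moreover have "AE \<omega> in m. \<forall>k::nat. limsup (\<lambda>n. ereal (- ?P \<omega> (real n) / real n)) \<le> - c + inverse (real (Suc k))"
  proof -
    have "AE \<omega> in m. limsup (\<lambda>n. ereal (- ?P \<omega> (real n) / real n)) \<le> - c + inverse (real (Suc k))" for k
      using birkhoff_limsup[OF F', of C "inverse (real (Suc k))"] C
      by (simp add: cocycle_int_minus c_def)
    then show ?thesis unfolding AE_all_countable by blast
  qed
  ultimately show ?thesis
  proof eventually_elim
    case (elim \<omega>)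
    have upper: "\<forall>\<^sub>F n in sequentially. x n < b + e"
      if h: "\<forall>k::nat. limsup (\<lambda>n. ereal (x n)) \<le> b + inverse (real (Suc k))" and e: "e > 0" for x b e
    proof -
      obtain k where "inverse (real (Suc k)) < e" using reals_Archimedean[OF e] by blast
      then have "limsup (\<lambda>n. ereal (x n)) < ereal (b + e)" using h[rule_format, of k]
        by (metis add_less_cancel_left ereal_less_eq(3) less_ereal.simps(1) order_le_less_trans)
      then have "\<forall>\<^sub>F n in sequentially. ereal (x n) < ereal (b + e)" by (rule Limsup_lessD)
      then show ?thesis by simp
    qed
    have lim: "(\<lambda>n. ?P \<omega> (real n) / real n) \<longlonglongrightarrow> c"
    proof (rule tendstoI)
      fix e :: real assume "e > 0"
      from upper[OF elim(1) this] upper[OF elim(2) this]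
      show "\<forall>\<^sub>F n in sequentially. dist (?P \<omega> (real n) / real n) c < e"
        by eventually_elim (auto simp: dist_real_def abs_less_iff)
    qed
    have fl: "filterlim (\<lambda>t::real. nat \<lfloor>t\<rfloor>) at_top at_top"
      by (rule filterlim_compose[OF filterlim_nat_sequentially filterlim_floor_sequentially])
    have lim': "((\<lambda>t::real. \<bar>?P \<omega> (real (nat \<lfloor>t\<rfloor>)) / real (nat \<lfloor>t\<rfloor>) - c\<bar>) \<longlongrightarrow> \<bar>c - c\<bar>) at_top"
      by (intro tendsto_intros) (rule filterlim_compose[OF lim fl])
    \<comment> \<open>Between \<open>t\<close> and its integer part the integral changes by at most
      \<open>C\<close> and \<open>c * t\<close> by at most \<open>\<bar>c\<bar>\<close>.\<close>
    have bound: "\<bar>1 / t * ?P \<omega> t - c\<bar> \<le> \<bar>?P \<omega> (real (nat \<lfloor>t\<rfloor>)) / real (nat \<lfloor>t\<rfloor>) - c\<bar> + (C + \<bar>c\<bar>) / t"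
      if t: "t \<ge> 1" for t
    proof -
      define n where "n = nat \<lfloor>t\<rfloor>"
      have "n \<ge> 1" unfolding n_def using t by (simp add: le_nat_iff)
      then have n: "real n \<le> t" "t \<le> real n + 1" "real n \<ge> 1" using t unfolding n_def by linarith+
      have "\<bar>?P \<omega> t - ?P \<omega> (real n)\<bar> \<le> C * \<bar>t - real n\<bar>" by (rule cocycle_int_lipschitz[OF F(2) C])
      also have "\<dots> \<le> C * 1" using n C0 by (intro mult_left_mono) auto
      finally have 1: "\<bar>?P \<omega> t - ?P \<omega> (real n)\<bar> \<le> C" by simp
      have 2: "\<bar>c * real n - c * t\<bar> \<le> \<bar>c\<bar>"
      proof -
        have "\<bar>c * real n - c * t\<bar> = \<bar>c\<bar> * \<bar>real n - t\<bar>" by (simp add: abs_mult flip: right_diff_distrib)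
        also have "\<dots> \<le> \<bar>c\<bar> * 1" using n by (intro mult_left_mono) auto
        finally show ?thesis by simp
      qed
      have 3: "\<bar>?P \<omega> (real n) - c * real n\<bar> \<le> \<bar>?P \<omega> (real n) / real n - c\<bar> * t"
      proof -
        have "\<bar>?P \<omega> (real n) - c * real n\<bar> = \<bar>?P \<omega> (real n) / real n - c\<bar> * real n"
          using n by (simp add: abs_mult[symmetric, of _ "real n", simplified] left_diff_distrib)
        also have "\<dots> \<le> \<bar>?P \<omega> (real n) / real n - c\<bar> * t" using n by (intro mult_left_mono) auto
        finally show ?thesis .
      qed
      have "\<bar>1 / t * ?P \<omega> t - c\<bar> = \<bar>?P \<omega> t - c * t\<bar> / t"
        using t by (simp add: field_simps abs_if)
      also have "\<dots> \<le> (\<bar>?P \<omega> (real n) / real n - c\<bar> * t + (C + \<bar>c\<bar>)) / t"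
        using 1 2 3 t by (intro divide_right_mono) linarith+
      also have "\<dots> = \<bar>?P \<omega> (real n) / real n - c\<bar> + (C + \<bar>c\<bar>) / t"
        using t by (simp add: add_divide_distrib)
      finally show ?thesis by (simp add: n_def)
    qed
    have "((\<lambda>t. (C + \<bar>c\<bar>) / t) \<longlongrightarrow> 0) at_top"
      by (intro tendsto_divide_0[OF tendsto_const] filterlim_at_top_imp_at_infinity filterlim_ident)
    with lim' have "((\<lambda>t. \<bar>?P \<omega> (real (nat \<lfloor>t\<rfloor>)) / real (nat \<lfloor>t\<rfloor>) - c\<bar> + (C + \<bar>c\<bar>) / t) \<longlongrightarrow> 0 + 0) at_top"
      by (intro tendsto_add) simp_all
    then have z: "((\<lambda>t. \<bar>?P \<omega> (real (nat \<lfloor>t\<rfloor>)) / real (nat \<lfloor>t\<rfloor>) - c\<bar> + (C + \<bar>c\<bar>) / t) \<longlongrightarrow> 0) at_top"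
      by simp
    have "((\<lambda>t. 1 / t * ?P \<omega> t - c) \<longlongrightarrow> 0) at_top"
      by (rule Lim_null_comparison[OF _ z])
        (use bound in \<open>auto intro!: eventually_at_top_linorderI[of 1]\<close>)
    then have "((\<lambda>t. 1 / t * ?P \<omega> t) \<longlongrightarrow> c) at_top" by (simp add: LIM_zero_iff)
    then show ?case by (simp add: c_def)
  qed
qed

end

subsection \<open>Topological dynamics\<close>

text \<open>This replaces the monotone sequences of the definition by late visits to each ball.
  Conversely, dependent choice picks visits at increasing times with the n-th one at least
  \<open>n\<close>.\<close>

lemma omega_limit_iff:
  fixes z :: "'y::metric_space"
  shows "z \<in> omega_limit \<phi> y \<longleftrightarrow> (\<forall>e>0. \<forall>N. \<exists>t\<ge>N. dist (\<phi> t y) z < e)"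
proof
  assume "z \<in> omega_limit \<phi> y"
  then obtain t where t: "filterlim t at_top sequentially" "(\<lambda>n. \<phi> (t n) y) \<longlonglongrightarrow> z"
    by (auto simp: omega_limit_def)
  show "\<forall>e>0. \<forall>N. \<exists>t\<ge>N. dist (\<phi> t y) z < e"
  proof (intro allI impI)
    fix e N :: real assume "e > 0"
    then have "\<forall>\<^sub>F n in sequentially. dist (\<phi> (t n) y) z < e" using t(2) by (simp add: tendsto_iff)
    moreover have "\<forall>\<^sub>F n in sequentially. t n \<ge> N" using t(1) by (simp add: filterlim_at_top)
    ultimately have "\<forall>\<^sub>F n in sequentially. t n \<ge> N \<and> dist (\<phi> (t n) y) z < e" by eventually_elim auto
    from eventually_happens'[OF _ this] show "\<exists>t\<ge>N. dist (\<phi> t y) z < e" by auto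
  qed
next
  assume h: "\<forall>e>0. \<forall>N. \<exists>t\<ge>N. dist (\<phi> t y) z < e"
  have "\<exists>t. \<forall>n. (t n \<ge> real n \<and> dist (\<phi> (t n) y) z < inverse (real (Suc n))) \<and> t n \<le> t (Suc n)"
  proof (rule dependent_nat_choice)
    show "\<exists>t. t \<ge> real 0 \<and> dist (\<phi> t y) z < inverse (real (Suc 0))"
      using h[rule_format, of 1 0] by auto
    show "\<exists>s. (s \<ge> real (Suc n) \<and> dist (\<phi> s y) z < inverse (real (Suc (Suc n)))) \<and> t \<le> s" for t n
      using h[rule_format, of "inverse (real (Suc (Suc n)))" "max t (real (Suc n))"] by auto
  qed
  then obtain t where t: "\<And>n. t n \<ge> real n" "\<And>n. dist (\<phi> (t n) y) z < inverse (real (Suc n))"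
    "\<And>n. t n \<le> t (Suc n)" by blast
  have "filterlim t at_top sequentially"
    by (rule filterlim_at_top_mono[OF filterlim_real_sequentially]) (use t(1) in auto)
  moreover have "(\<lambda>n. \<phi> (t n) y) \<longlonglongrightarrow> z"
    by (subst tendsto_dist_iff, rule Lim_null_comparison[OF _ LIMSEQ_inverse_real_of_nat]) (use t(2) in \<open>auto intro!: always_eventually less_imp_le\<close>)
  ultimately show "z \<in> omega_limit \<phi> y"
    using t(3) by (auto simp: omega_limit_def incseq_Suc_iff)
qed

text \<open>Sensitivity and chains are measured by \<open>sum_dist\<close>, while the topological
  arguments use the product metric; this bound and the next one allow the passage at the cost of a
  factor 2.\<close>

lemma dist_le_sum_dist: "dist y z \<le> sum_dist y z"
  unfolding sum_dist_def dist_prod_def dist_real_def[symmetric] by (rule sqrt_sum_squares_le_sum) auto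

lemma sum_dist_le: "sum_dist y z \<le> 2 * dist y z"
  using dist_fst_le[of y z] dist_snd_le[of y z] by (simp add: sum_dist_def dist_real_def)

lemma not_sensitive_onD:
  assumes "\<not> sensitive_on sum_dist Y \<phi>" "e > 0"
  obtains y d where "y \<in> Y" "d > 0"
    "\<And>y' t. y' \<in> Y \<Longrightarrow> dist y y' < d \<Longrightarrow> t \<ge> 0 \<Longrightarrow> dist (\<phi> t y) (\<phi> t y') \<le> e"
proof -
  obtain y where y: "y \<in> Y" "\<not> eps_sensitive_point sum_dist Y \<phi> e y"
    using assms unfolding sensitive_on_def by blast
  then obtain d where d: "d > 0" "\<And>y'. y' \<in> Y \<Longrightarrow> sum_dist y y' \<le> d \<Longrightarrow>
      (SUP t\<in>{0..}. ereal (sum_dist (\<phi> t y) (\<phi> t y'))) \<le> ereal e"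
    unfolding eps_sensitive_point_def by (meson not_less)
  have "dist (\<phi> t y) (\<phi> t y') \<le> e" if "y' \<in> Y" "dist y y' < d / 2" "t \<ge> 0" for y' t
  proof -
    have "sum_dist y y' \<le> d" using that(2) sum_dist_le[of y y'] by simp
    then have "(SUP t\<in>{0..}. ereal (sum_dist (\<phi> t y) (\<phi> t y'))) \<le> ereal e" using d that by blast
    then have "ereal (sum_dist (\<phi> t y) (\<phi> t y')) \<le> ereal e" using that(3) by (auto simp: SUP_le_iff)
    then show ?thesis using dist_le_sum_dist[of "\<phi> t y" "\<phi> t y'"] by simp
  qed
  then show thesis using that[of y "d / 2"] y(1) d(1) by auto
qed

subsection \<open>Transitive flows on compact sets\<close>

text \<open>The dense orbit is required to fill \<open>Y\<close> as an omega limit set, so that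
  every open set is visited at arbitrarily late times.\<close>

locale compact_transitive_flow =
  fixes Y :: "'y::metric_space set" and \<phi> z0
  assumes cf: "continuous_flow_on Y \<phi>" and compact_Y: "compact Y" and z0: "z0 \<in> Y"
    and trans: "Y = omega_limit \<phi> z0"
begin

lemma closed_Y: "y \<in> Y \<Longrightarrow> \<phi> t y \<in> Y"
  and phi_0: "y \<in> Y \<Longrightarrow> \<phi> 0 y = y"
  and phi_add: "y \<in> Y \<Longrightarrow> \<phi> (s + t) y = \<phi> s (\<phi> t y)"
  using cf by (auto simp: continuous_flow_on_def)

lemma visits: "y \<in> Y \<Longrightarrow> e > 0 \<Longrightarrow> \<exists>t\<ge>N. dist (\<phi> t z0) y < e"
  using trans omega_limit_iff by blast

lemma transitive: "transitive_on Y \<phi>"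
  unfolding transitive_on_def
proof (intro allI impI, elim conjE)
  fix U V assume UV: "openin (top_of_set Y) U" "openin (top_of_set Y) V" "U \<noteq> {}" "V \<noteq> {}"
  have hit: "\<exists>t\<ge>N. \<phi> t z0 \<in> U" if U: "openin (top_of_set Y) U" "U \<noteq> {}" for U N
  proof -
    obtain u e where u: "u \<in> U" "e > 0" "ball u e \<inter> Y \<subseteq> U" using U openin_contains_ball[of Y U] by blast
    then have "u \<in> Y" using U openin_imp_subset by blast
    then obtain t where "t \<ge> N" "dist (\<phi> t z0) u < e" using visits u by blast
    then show ?thesis using u closed_Y[OF z0, of t] by (auto simp: dist_commute intro!: exI[of _ t])
  qed
  obtain t where t: "\<phi> t z0 \<in> U" using hit UV by blast
  obtain s where s: "s \<ge> t + 1" "\<phi> s z0 \<in> V" using hit UV by blast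
  have "\<phi> (s - t) (\<phi> t z0) = \<phi> s z0" using phi_add[OF z0, of "s - t" t] by simp
  then show "\<exists>t>0. \<phi> t ` U \<inter> V \<noteq> {}" using s t by (intro exI[of _ "s - t"]) force
qed

text \<open>One jump leads from the orbit of \<open>y\<close> onto the dense orbit, which is then
  followed for at least \<open>T\<close> until it comes close to \<open>p\<close>.\<close>

lemma two_step_chain:
  assumes "y \<in> Y" "p \<in> Y" "e > 0"
  shows "\<exists>z\<in>Y. \<exists>s\<ge>T. dist (\<phi> T y) z < e \<and> dist (\<phi> s z) p < e"
proof -
  obtain r where r: "dist (\<phi> r z0) (\<phi> T y) < e" using visits[OF closed_Y[OF assms(1)] assms(3)] by blast
  obtain s where s: "s \<ge> r + T" "dist (\<phi> s z0) p < e" using visits[OF assms(2,3)] by blast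
  have "\<phi> (s - r) (\<phi> r z0) = \<phi> s z0" using phi_add[OF z0, of "s - r" r] by simp
  then show ?thesis using r s closed_Y[OF z0]
    by (intro bexI[of _ "\<phi> r z0"] exI[of _ "s - r"]) (auto simp: dist_commute)
qed

lemma uniform_on_segment:
  assumes "p \<in> Y" "e > 0"
  shows "\<exists>d>0. \<forall>q\<in>Y. dist q p < d \<longrightarrow> (\<forall>l\<in>{0..L}. dist (\<phi> l q) (\<phi> l p) < e)"
proof -
  have "continuous_on ({0..L} \<times> Y) (\<lambda>(t, y). \<phi> t y)"
    using cf unfolding continuous_flow_on_def by (elim conjE continuous_on_subset) auto
  then have "uniformly_continuous_on ({0..L} \<times> Y) (\<lambda>(t, y). \<phi> t y)"
    using compact_Y by (intro compact_uniformly_continuous compact_Times) auto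
  then obtain d where d: "d > 0" "\<And>x x'. x \<in> {0..L} \<times> Y \<Longrightarrow> x' \<in> {0..L} \<times> Y \<Longrightarrow> dist x' x < d \<Longrightarrow>
      dist (case x' of (t, y) \<Rightarrow> \<phi> t y) (case x of (t, y) \<Rightarrow> \<phi> t y) < e"
    using assms(2) unfolding uniformly_continuous_on_def by metis
  have "dist (\<phi> l q) (\<phi> l p) < e" if "q \<in> Y" "dist q p < d" "l \<in> {0..L}" for q l
    using d(2)[of "(l, p)" "(l, q)"] that assms(1) by (simp add: dist_Pair_Pair)
  then show ?thesis using d(1) by blast
qed

text \<open>If the open set \<open>U\<close> has a forward orbit of small diameter, then an orbit through \<open>U\<close> is almost
  periodic up to small error along the return times of \<open>U\<close>. These are syndetic, but the orbit
  stays close to the closed invariant set \<open>M\<close> for arbitrarily long times.\<close>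

lemma nonsensitive_subset:
  assumes non: "\<And>e. e > 0 \<Longrightarrow> \<exists>y\<in>Y. \<exists>d>0. \<forall>y'\<in>Y. dist y y' < d \<longrightarrow> (\<forall>t\<ge>0. dist (\<phi> t y) (\<phi> t y') \<le> e)"
    and M: "M \<subseteq> Y" "M \<noteq> {}" "closed M" "\<And>t y. y \<in> M \<Longrightarrow> \<phi> t y \<in> M"
    and ret: "\<And>U. open U \<Longrightarrow> U \<inter> Y \<noteq> {} \<Longrightarrow> \<exists>L\<ge>0. \<forall>T\<ge>0. \<exists>s\<in>{T..T + L}. \<exists>u\<in>U \<inter> Y. \<phi> s u \<in> U"
  shows "Y \<subseteq> M"
proof
  fix y1 assume y1: "y1 \<in> Y"
  show "y1 \<in> M"
  proof (rule ccontr)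
    assume "y1 \<notin> M"
    then have "infdist y1 M > 0"
      using in_closed_iff_infdist_zero[OF M(3,2), of y1] infdist_nonneg[of y1 M] by linarith
    \<comment> \<open>Below, \<open>y1\<close> turns out to be within \<open>6 * e\<close> of
      \<open>M\<close>: one \<open>e\<close> to reach the orbit of \<open>z\<close>, four for a near
      return, one for shadowing a point of \<open>M\<close>. The seventh gives the
      contradiction.\<close>
    define e where "e = infdist y1 M / 7"
    have e: "e > 0" "infdist y1 M = 7 * e" using \<open>infdist y1 M > 0\<close> by (auto simp: e_def)
    obtain y d where y: "y \<in> Y" "d > 0"
      and yd: "\<And>y' t. y' \<in> Y \<Longrightarrow> dist y y' < d \<Longrightarrow> t \<ge> 0 \<Longrightarrow> dist (\<phi> t y) (\<phi> t y') \<le> e"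
      using non[OF e(1)] by blast
    obtain L where L: "L \<ge> 0" "\<And>T. T \<ge> 0 \<Longrightarrow> \<exists>s\<in>{T..T + L}. \<exists>u\<in>ball y d \<inter> Y. \<phi> s u \<in> ball y d"
      using ret[of "ball y d"] y by (metis IntI centre_in_ball empty_iff open_ball)
    obtain t0 where t0: "dist (\<phi> t0 z0) y < d" using visits[OF y] by blast
    define z where "z = \<phi> t0 z0"
    have z: "z \<in> Y" "dist y z < d" using t0 closed_Y[OF z0] by (auto simp: z_def dist_commute)
    have zv: "\<exists>t\<ge>N. dist (\<phi> t z) q < r" if q: "q \<in> Y" "r > 0" for q r N
    proof -
      obtain t where t: "t \<ge> N + t0" "dist (\<phi> t z0) q < r" using visits[OF q] by blast
      have "\<phi> (t - t0) z = \<phi> t z0" unfolding z_def using phi_add[OF z0, of "t - t0" t0] by simp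
      then show ?thesis using t by (intro exI[of _ "t - t0"]) auto
    qed
    \<comment> \<open>The orbits of \<open>z\<close>, of \<open>u\<close> and of the returned point
      \<open>\<phi> s u\<close> all follow that of \<open>y\<close>, each within \<open>e\<close>
      for all later times. Shifting the orbit of \<open>z\<close> by the return time
      \<open>s\<close> therefore costs four errors.\<close>
    have rec: "dist (\<phi> (s + t) z) (\<phi> t z) \<le> 4 * e"
      if "s \<ge> 0" "t \<ge> 0" and u: "u \<in> ball y d \<inter> Y" "\<phi> s u \<in> ball y d" for s t u
    proof -
      have "dist (\<phi> (s + t) y) (\<phi> (s + t) z) \<le> e" using yd z that by simp
      moreover have "dist (\<phi> (s + t) y) (\<phi> (s + t) u) \<le> e" using yd u that by simp
      moreover have "dist (\<phi> t y) (\<phi> t z) \<le> e" using yd z that by simp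
      moreover have "dist (\<phi> t y) (\<phi> t (\<phi> s u)) \<le> e" using yd[OF closed_Y[of u s]] u that by simp
      moreover have "\<phi> t (\<phi> s u) = \<phi> (s + t) u" using phi_add[of u t s] u by (simp add: add.commute)
      ultimately show ?thesis
        using dist_triangle[of "\<phi> (s + t) z" "\<phi> t z" "\<phi> (s + t) y"]
          dist_triangle[of "\<phi> (s + t) y" "\<phi> t z" "\<phi> (s + t) u"]
          dist_triangle[of "\<phi> (s + t) u" "\<phi> t z" "\<phi> t y"]
        by (simp add: dist_commute)
    qed
    obtain t where t: "t \<ge> 0" "dist (\<phi> t z) y1 < e" using zv[OF y1 e(1), of 0] by blast
    obtain p where p: "p \<in> M" using M(2) by blast
    then have pY: "p \<in> Y" using M(1) by blast
    obtain r where r: "r > 0" "\<And>q l. q \<in> Y \<Longrightarrow> dist q p < r \<Longrightarrow> l \<in> {0..L} \<Longrightarrow> dist (\<phi> l q) (\<phi> l p) < e"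
      using uniform_on_segment[OF pY e(1), of L] by blast
    obtain T where T: "T \<ge> t" "dist (\<phi> T z) p < r" using zv[OF pY r(1)] by blast
    \<comment> \<open>The return time is chosen so that \<open>s + t\<close> falls into the interval
      of length \<open>L\<close> after \<open>T\<close>, during which the orbit of \<open>z\<close>
      still shadows that of \<open>p\<close>.\<close>
    obtain s u where su: "s \<in> {T - t..T - t + L}" "u \<in> ball y d \<inter> Y" "\<phi> s u \<in> ball y d"
      using L(2)[of "T - t"] T(1) by auto
    define l where "l = s + t - T"
    have l: "l \<in> {0..L}" using su(1) by (simp add: l_def)
    have "\<phi> (s + t) z = \<phi> l (\<phi> T z)" using phi_add[OF z(1), of l T] by (simp add: l_def)
    then have "dist (\<phi> (s + t) z) (\<phi> l p) < e" using r(2)[OF closed_Y[OF z(1)] T(2) l] by simp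
    moreover have "dist (\<phi> (s + t) z) (\<phi> t z) \<le> 4 * e" using rec[OF _ t(1) su(2,3)] su(1) T(1) by simp
    ultimately have "dist y1 (\<phi> l p) \<le> 6 * e"
      using t(2) dist_triangle[of y1 "\<phi> l p" "\<phi> t z"] dist_triangle[of "\<phi> t z" "\<phi> l p" "\<phi> (s + t) z"]
      by (simp add: dist_commute)
    moreover have "infdist y1 M \<le> dist y1 (\<phi> l p)" using M(4)[OF p] by (rule infdist_le)
    ultimately show False using e by linarith
  qed
qed

end

text \<open>The dense orbit through the singleton fibre enters the ball of insensitivity, and then
  whole fibres over nearby base points lie in this ball. Every orbit reaches such a fibre when
  followed backwards; returning forwards, any two points of its fibre stay close to the same
  reference orbit.\<close>

lemma (in minimal_flow) nonsensitive_fibers_trivial: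
  fixes \<phi> :: "real \<Rightarrow> 'a \<times> real \<Rightarrow> 'a \<times> real"
  assumes tr: "compact_transitive_flow Y \<phi> (\<omega>0, x0)"
    and fphi: "\<And>t y. y \<in> Y \<Longrightarrow> fst (\<phi> t y) = \<sigma> t (fst y)"
    and fib: "fiber Y \<omega>0 = {x0}"
    and non: "\<And>e. e > 0 \<Longrightarrow> \<exists>y\<in>Y. \<exists>d>0. \<forall>y'\<in>Y. dist y y' < d \<longrightarrow> (\<forall>t\<ge>0. dist (\<phi> t y) (\<phi> t y') \<le> e)"
    and x: "(\<omega>, x1) \<in> Y" "(\<omega>, x2) \<in> Y"
  shows "x1 = x2"
proof -
  interpret compact_transitive_flow Y \<phi> "(\<omega>0, x0)" by fact
  have "\<bar>x1 - x2\<bar> \<le> 0 + e" if "e > 0" for e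
  proof -
    obtain y d where y: "y \<in> Y" "d > 0"
      and yd: "\<And>y' t. y' \<in> Y \<Longrightarrow> dist y y' < d \<Longrightarrow> t \<ge> 0 \<Longrightarrow> dist (\<phi> t y) (\<phi> t y') \<le> e / 2"
      using non[of "e / 2"] \<open>e > 0\<close> by auto
    obtain t0 where t0: "dist (\<phi> t0 (\<omega>0, x0)) y < d" using visits[OF y] by blast
    let ?\<omega>' = "\<sigma> t0 \<omega>0"
    have single: "q = \<phi> t0 (\<omega>0, x0)" if q: "q \<in> Y" "fst q = ?\<omega>'" for q
    proof -
      have "fst (\<phi> (- t0) q) = \<omega>0" using fphi[OF q(1), of "- t0"] q(2) by simp
      moreover have "\<phi> (- t0) q \<in> Y" using closed_Y[OF q(1)] .
      ultimately have "\<phi> (- t0) q = (\<omega>0, x0)" using fib by (cases "\<phi> (- t0) q") (auto simp: fiber_def)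
      then show ?thesis using phi_add[OF q(1), of t0 "- t0"] phi_0[OF q(1)] by simp
    qed
    \<comment> \<open>The part of \<open>Y\<close> outside the ball projects onto a closed set that
      misses \<open>?\<omega>'\<close>, because the fibre there is a single point of the ball. So
      all fibres over a neighbourhood lie in the ball.\<close>
    have "compact (fst ` (Y - ball y d))"
      using compact_Y by (intro compact_continuous_image continuous_intros compact_diff) auto
    then have "open (- fst ` (Y - ball y d))" by (intro open_Compl compact_imp_closed)
    moreover have "?\<omega>' \<in> - fst ` (Y - ball y d)"
    proof
      assume "?\<omega>' \<in> fst ` (Y - ball y d)"
      then obtain q where "q \<in> Y" "fst q = ?\<omega>'" "q \<notin> ball y d" by force
      then show False using single[of q] t0 by (simp add: dist_commute)
    qed
    ultimately obtain t where t: "t \<le> 0" "\<sigma> t \<omega> \<in> - fst ` (Y - ball y d)"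
      using backward_orbit_dense[of "- fst ` (Y - ball y d)" \<omega>] by blast
    have near: "dist y (\<phi> t (\<omega>, x)) < d" if "(\<omega>, x) \<in> Y" for x
    proof -
      have "fst (\<phi> t (\<omega>, x)) = \<sigma> t \<omega>" "\<phi> t (\<omega>, x) \<in> Y" using fphi[OF that, of t] closed_Y[OF that] by auto
      then show ?thesis using t(2) by (metis ComplD DiffI imageI mem_ball)
    qed
    have bk: "\<phi> (- t) (\<phi> t (\<omega>, x)) = (\<omega>, x)" if "(\<omega>, x) \<in> Y" for x
      using phi_add[OF that, of "- t" t] phi_0[OF that] by simp
    have "dist (\<phi> (- t) y) (\<omega>, x) \<le> e / 2" if "(\<omega>, x) \<in> Y" for x
      using yd[OF closed_Y[OF that] near[OF that], of "- t"] bk[OF that] t(1) by simp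
    from this[OF x(1)] this[OF x(2)] have "dist (\<omega>, x1) (\<omega>, x2) \<le> e"
      using dist_triangle[of "(\<omega>, x1)" "(\<omega>, x2)" "\<phi> (- t) y"] by (simp add: dist_commute)
    then show ?thesis by (simp add: dist_Pair_Pair dist_real_def)
  qed
  then have "\<bar>x1 - x2\<bar> \<le> 0" by (rule field_le_epsilon)
  then show ?thesis by simp
qed

text \<open>Translates of \<open>W\<close> all have the same positive measure, so the size of a
  disjoint family of them is bounded. Any further translate meets a member of a largest such family,
  and the difference of the two times is a return time.\<close>

lemma (in ergodic_flow) syndetic_returns:
  assumes W: "W \<in> sets borel" "emeasure m W \<noteq> 0"
  shows "\<exists>L\<ge>0. \<forall>T\<ge>0. \<exists>s\<in>{T..T + L}. \<exists>\<omega>\<in>W. \<sigma> s \<omega> \<in> W"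
proof -
  define Q where "Q k \<longleftrightarrow> (\<exists>F. finite F \<and> card F = k \<and> disjoint_family_on (\<lambda>s. \<sigma> s ` W) F)" for k
  have p: "prob W > 0" using W(2) by (simp add: emeasure_eq_measure zero_less_measure_iff)
  have im: "\<sigma> s ` W \<in> sets borel" for s
    using measurable_sets[OF flow_measurable[of "- s"] W(1)] by (simp add: flow_image sets_m)
  have pim: "prob (\<sigma> s ` W) = prob W" for s
    using emeasure_flow[OF W(1), of "- s"] by (simp add: flow_image vimage_def measure_def)
  have bound: "real k \<le> 1 / prob W" if Qk: "Q k" for k
  proof -
    obtain F where F: "finite F" "card F = k" "disjoint_family_on (\<lambda>s. \<sigma> s ` W) F" using Qk unfolding Q_def by blast
    have sub: "(\<lambda>s. \<sigma> s ` W) ` F \<subseteq> events" using im by (simp add: sets_m image_subset_iff)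
    have "real k * prob W = (\<Sum>s\<in>F. prob (\<sigma> s ` W))" using F(2) by (simp only: pim sum_constant)
    also have "\<dots> = prob (\<Union>s\<in>F. \<sigma> s ` W)"
      by (rule finite_measure_finite_Union[OF F(1) sub F(3), symmetric])
    also have "\<dots> \<le> 1" by simp
    finally show ?thesis using p by (simp add: field_simps)
  qed
  have Q1: "Q 1" unfolding Q_def by (intro exI[of _ "{0}"]) (auto simp: disjoint_family_on_def)
  obtain B :: nat where "1 / prob W \<le> real B" using real_arch_simple by blast
  then have B: "k \<le> B" if "Q k" for k using bound[OF that] by linarith
  define k where "k = (GREATEST k. Q k)"
  have k: "Q k" unfolding k_def using GreatestI_nat[of Q 1 B] Q1 B by blast
  have kmax: "j \<le> k" if "Q j" for j unfolding k_def using Greatest_le_nat[of Q j B] that B by blast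
  obtain F where F: "finite F" "card F = k" "disjoint_family_on (\<lambda>s. \<sigma> s ` W) F" using k unfolding Q_def by blast
  have Fne: "F \<noteq> {}" using F kmax[OF Q1] by auto
  obtain w where w: "w \<in> W" using W(2) by (metis emeasure_empty ex_in_conv)
  show ?thesis
  proof (intro exI[of _ "Max F - Min F"] conjI allI impI)
    show "0 \<le> Max F - Min F" using F Fne by simp
    fix T :: real assume T: "T \<ge> 0"
    show "\<exists>s\<in>{T..T + (Max F - Min F)}. \<exists>\<omega>\<in>W. \<sigma> s \<omega> \<in> W"
    proof (cases "T = 0")
      case True
      then show ?thesis using w F Fne by (intro bexI[of _ 0] bexI[of _ w]) auto
    next
      case False
      \<comment> \<open>With this new time the difference \<open>?s - i\<close> to a member
        \<open>i\<close> of \<open>F\<close> lies in the required window. As \<open>T\<close> is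
        positive, \<open>?s\<close> exceeds every member of \<open>F\<close>; for
        \<open>T = 0\<close> the trivial return at time 0 was used.\<close>
      let ?s = "T + Max F"
      have nF: "?s \<notin> F" using F False T Max_ge[OF F(1), of ?s] by auto
      have "\<not> Q (Suc k)" using kmax[of "Suc k"] by auto
      then have "\<not> disjoint_family_on (\<lambda>s. \<sigma> s ` W) (insert ?s F)"
        using F(1,2) nF unfolding Q_def by (metis card_insert_disjoint finite_insert)
      then obtain i where i: "i \<in> F" "\<sigma> ?s ` W \<inter> \<sigma> i ` W \<noteq> {}"
        using F(3) nF by (auto simp: disjoint_family_on_insert)
      then obtain u v where uv: "u \<in> W" "v \<in> W" "\<sigma> ?s u = \<sigma> i v" by blast
      have "\<sigma> (?s - i) u = \<sigma> (- i) (\<sigma> ?s u)" by (simp flip: flow_add)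
      then have "\<sigma> (?s - i) u = v" using uv by simp
      moreover have "Min F \<le> i" "i \<le> Max F" using F i by auto
      ultimately show ?thesis using uv by (intro bexI[of _ "?s - i"] bexI[of _ u]) auto
    qed
  qed
qed

subsection \<open>Scalar differential equations\<close>

text \<open>Squaring avoids differentiating the absolute value of \<open>u\<close>. The extra 1 in
  the rate comes from splitting the mixed term, twice \<open>\<bar>u s\<bar> * d\<close>, into the
  sum of the two squares.\<close>

lemma gronwall_sq:
  fixes u u' :: "real \<Rightarrow> real"
  assumes T: "0 \<le> T" and L: "0 \<le> L"
    and u: "\<And>s. 0 \<le> s \<Longrightarrow> s \<le> T \<Longrightarrow> (u has_real_derivative u' s) (at s)"
    and b: "\<And>s. 0 \<le> s \<Longrightarrow> s \<le> T \<Longrightarrow> \<bar>u' s\<bar> \<le> L * \<bar>u s\<bar> + d"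
  shows "(u T)\<^sup>2 \<le> exp ((2 * L + 1) * T) * ((u 0)\<^sup>2 + d\<^sup>2 * T)"
proof -
  define K where "K = 2 * L + 1"
  define w where "w s = (u s)\<^sup>2 * exp (- K * s) - d\<^sup>2 * s" for s
  have "w T \<le> w 0"
  proof (rule DERIV_nonpos_imp_nonincreasing[OF T])
    fix s assume s: "0 \<le> s" "s \<le> T"
    let ?D = "(2 * u s * u' s - K * (u s)\<^sup>2) * exp (- K * s) - d\<^sup>2"
    have "(w has_real_derivative ?D) (at s)"
      unfolding w_def by (auto intro!: derivative_eq_intros u[OF s] simp: algebra_simps power2_eq_square)
    moreover have "?D \<le> 0"
    proof -
      have "2 * u s * u' s \<le> 2 * (\<bar>u s\<bar> * \<bar>u' s\<bar>)"
        using abs_ge_self[of "u s * u' s"] by (simp add: abs_mult)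
      also have "\<dots> \<le> 2 * (\<bar>u s\<bar> * (L * \<bar>u s\<bar> + d))" using b[OF s] by (intro mult_left_mono) auto
      also have "\<dots> = 2 * L * (u s)\<^sup>2 + 2 * \<bar>u s\<bar> * d"
        by (simp add: algebra_simps power2_eq_square)
      also have "\<dots> \<le> K * (u s)\<^sup>2 + d\<^sup>2"
        using sum_squares_bound[of "\<bar>u s\<bar>" d] by (simp add: K_def algebra_simps)
      finally have 1: "2 * u s * u' s - K * (u s)\<^sup>2 \<le> d\<^sup>2" by simp
      have "0 \<le> K * s" using L s by (simp add: K_def)
      then have "exp (- K * s) \<le> 1" by simp
      then have "d\<^sup>2 * exp (- K * s) \<le> d\<^sup>2" by (simp add: mult_left_le)
      moreover have "(2 * u s * u' s - K * (u s)\<^sup>2) * exp (- K * s) \<le> d\<^sup>2 * exp (- K * s)"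
        using 1 by (intro mult_right_mono) auto
      ultimately show ?thesis by linarith
    qed
    ultimately show "\<exists>y. (w has_real_derivative y) (at s) \<and> y \<le> 0" by blast
  qed
  then have "(u T)\<^sup>2 * exp (- K * T) \<le> (u 0)\<^sup>2 + d\<^sup>2 * T" by (simp add: w_def)
  then have "exp (K * T) * ((u T)\<^sup>2 * exp (- K * T)) \<le> exp (K * T) * ((u 0)\<^sup>2 + d\<^sup>2 * T)"
    by (intro mult_left_mono) auto
  moreover have "exp (K * T) * ((u T)\<^sup>2 * exp (- K * T)) = (u T)\<^sup>2"
    by (simp add: exp_minus field_simps)
  ultimately show ?thesis unfolding K_def[symmetric] by linarith
qed

lemma gronwall_two_sided:
  fixes u u' :: "real \<Rightarrow> real"
  assumes L: "0 \<le> L"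
    and u: "\<And>s. s \<in> closed_segment 0 t \<Longrightarrow> (u has_real_derivative u' s) (at s)"
    and b: "\<And>s. s \<in> closed_segment 0 t \<Longrightarrow> \<bar>u' s\<bar> \<le> L * \<bar>u s\<bar> + d"
  shows "(u t)\<^sup>2 \<le> exp ((2 * L + 1) * \<bar>t\<bar>) * ((u 0)\<^sup>2 + d\<^sup>2 * \<bar>t\<bar>)"
proof (cases "t \<ge> 0")
  case True
  then show ?thesis using gronwall_sq[OF True L, of u u' d] u b by (simp add: closed_segment_eq_real_ivl)
next
  case False
  have "(u (- (- t)))\<^sup>2 \<le> exp ((2 * L + 1) * (- t)) * ((u (- 0))\<^sup>2 + d\<^sup>2 * (- t))"
  proof (rule gronwall_sq[OF _ L, where u' = "\<lambda>s. - u' (- s)"])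
    fix s assume s: "0 \<le> s" "s \<le> - t"
    then have m: "- s \<in> closed_segment 0 t" using False by (auto simp: closed_segment_eq_real_ivl)
    have "((\<lambda>s. u (- s)) has_real_derivative u' (- s) * - 1) (at s)"
      by (rule DERIV_chain2[where f = u and g = "\<lambda>s. - s", OF u[OF m]]) (auto intro!: derivative_eq_intros)
    then show "((\<lambda>s. u (- s)) has_real_derivative - u' (- s)) (at s)" by simp
    show "\<bar>- u' (- s)\<bar> \<le> L * \<bar>u (- s)\<bar> + d" using b[OF m] by simp
  qed (use False in simp)
  then show ?thesis using False by simp
qed

locale scalar_family = base_flow +
  fixes f :: "'a \<Rightarrow> real \<Rightarrow> real"
  assumes cont_f: "continuous_on UNIV (\<lambda>(\<omega>, x). f \<omega> x)"
    and lip_f: "\<And>R. \<exists>L\<ge>0. \<forall>\<omega> x y. \<bar>x\<bar> \<le> R \<longrightarrow> \<bar>y\<bar> \<le> R \<longrightarrow> \<bar>f \<omega> x - f \<omega> y\<bar> \<le> L * \<bar>x - y\<bar>"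
    and cpt: "compact (UNIV :: 'a set)"
begin

lemma local_solution_unique:
  assumes x: "local_solution \<sigma> f \<omega> x0 J x" and y: "local_solution \<sigma> f \<omega> x0 J' y"
    and t: "t \<in> J" "t \<in> J'"
  shows "x t = y t"
proof -
  have seg: "closed_segment 0 t \<subseteq> J" "closed_segment 0 t \<subseteq> J'"
    using x y t by (auto simp: local_solution_def is_interval_convex_1 intro: closed_segment_subset[THEN subsetD])
  have dx: "(x has_real_derivative f (\<sigma> s \<omega>) (x s)) (at s)" if "s \<in> closed_segment 0 t" for s
    using x seg that by (auto simp: local_solution_def)
  have dy: "(y has_real_derivative f (\<sigma> s \<omega>) (y s)) (at s)" if "s \<in> closed_segment 0 t" for s
    using y seg that by (auto simp: local_solution_def)
  have cx: "continuous_on (closed_segment 0 t) x" "continuous_on (closed_segment 0 t) y"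
    using dx dy by (meson DERIV_isCont continuous_at_imp_continuous_on)+
  obtain R1 where R1: "\<And>s. s \<in> closed_segment 0 t \<Longrightarrow> \<bar>x s\<bar> \<le> R1"
    using compact_continuous_bounded[OF compact_segment cx(1)] by blast
  obtain R2 where R2: "\<And>s. s \<in> closed_segment 0 t \<Longrightarrow> \<bar>y s\<bar> \<le> R2"
    using compact_continuous_bounded[OF compact_segment cx(2)] by blast
  obtain L where L: "L \<ge> 0" "\<And>\<omega> x y. \<bar>x\<bar> \<le> max R1 R2 \<Longrightarrow> \<bar>y\<bar> \<le> max R1 R2 \<Longrightarrow> \<bar>f \<omega> x - f \<omega> y\<bar> \<le> L * \<bar>x - y\<bar>"
    using lip_f[of "max R1 R2"] by blast
  have "(x t - y t)\<^sup>2 \<le> exp ((2 * L + 1) * \<bar>t\<bar>) * ((x 0 - y 0)\<^sup>2 + 0\<^sup>2 * \<bar>t\<bar>)"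
  proof (rule gronwall_two_sided[OF L(1), where u' = "\<lambda>s. f (\<sigma> s \<omega>) (x s) - f (\<sigma> s \<omega>) (y s)"])
    fix s assume s: "s \<in> closed_segment 0 t"
    show "((\<lambda>s. x s - y s) has_real_derivative f (\<sigma> s \<omega>) (x s) - f (\<sigma> s \<omega>) (y s)) (at s)"
      using dx[OF s] dy[OF s] by (rule DERIV_diff)
    show "\<bar>f (\<sigma> s \<omega>) (x s) - f (\<sigma> s \<omega>) (y s)\<bar> \<le> L * \<bar>x s - y s\<bar> + 0"
      using L(2)[of "x s" "y s" "\<sigma> s \<omega>"] R1[OF s] R2[OF s] by simp
  qed
  moreover have "x 0 = y 0" using x y by (simp add: local_solution_def)
  ultimately show ?thesis by simp
qed

lemma sol_eq:
  assumes "local_solution \<sigma> f \<omega> x0 J x" "t \<in> J"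
  shows "sol \<sigma> f t \<omega> x0 = x t"
  unfolding sol_def
proof (rule the_equality)
  show "\<exists>J x'. local_solution \<sigma> f \<omega> x0 J x' \<and> t \<in> J \<and> x' t = x t" using assms by blast
  show "v = x t" if "\<exists>J x. local_solution \<sigma> f \<omega> x0 J x \<and> t \<in> J \<and> x t = v" for v
    using that local_solution_unique[OF _ assms(1) _ assms(2)] by blast
qed

text \<open>Solutions on the whole line avoid the maximal domains inside \<open>sol\<close>; every
  orbit in an invariant set is of this kind.\<close>

definition gsol :: "'a \<Rightarrow> (real \<Rightarrow> real) \<Rightarrow> bool" where
  "gsol \<omega> x \<longleftrightarrow> (\<forall>t. (x has_real_derivative f (\<sigma> t \<omega>) (x t)) (at t))"

lemma gsol_local: "gsol \<omega> x \<longleftrightarrow> local_solution \<sigma> f \<omega> (x 0) UNIV x"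
  by (auto simp: gsol_def local_solution_def is_interval_univ)

lemma gsol_sol: "gsol \<omega> x \<Longrightarrow> sol \<sigma> f t \<omega> (x 0) = x t"
  using sol_eq[of \<omega> "x 0" UNIV x t] by (simp add: gsol_local)

lemma sol_gsol:
  assumes "sol_dom \<sigma> f \<omega> x0 = UNIV"
  shows "gsol \<omega> (\<lambda>t. sol \<sigma> f t \<omega> x0)" "sol \<sigma> f 0 \<omega> x0 = x0"
proof -
  have ex: "\<exists>J x. local_solution \<sigma> f \<omega> x0 J x \<and> t \<in> J" for t
    using assms unfolding sol_dom_def by blast
  show "gsol \<omega> (\<lambda>t. sol \<sigma> f t \<omega> x0)"
    unfolding gsol_def
  proof
    fix t
    obtain J x where J: "local_solution \<sigma> f \<omega> x0 J x" "t \<in> J" using ex by blast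
    then have o: "open J" and dx: "(x has_real_derivative f (\<sigma> t \<omega>) (x t)) (at t)" by (auto simp: local_solution_def)
    have "((\<lambda>t. sol \<sigma> f t \<omega> x0) has_real_derivative f (\<sigma> t \<omega>) (x t)) (at t)"
      by (rule has_field_derivative_transform_within_open[OF dx o J(2)]) (rule sol_eq[OF J(1), symmetric])
    then show "((\<lambda>t. sol \<sigma> f t \<omega> x0) has_real_derivative f (\<sigma> t \<omega>) (sol \<sigma> f t \<omega> x0)) (at t)"
      using sol_eq[OF J] by simp
  qed
  obtain J x where J: "local_solution \<sigma> f \<omega> x0 J x" "0 \<in> J" using ex by blast
  then show "sol \<sigma> f 0 \<omega> x0 = x0" using sol_eq[OF J] by (simp add: local_solution_def)
qed

lemma gsol_shift:
  assumes "gsol \<omega> x"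
  shows "gsol (\<sigma> s \<omega>) (\<lambda>t. x (t + s))"
  unfolding gsol_def
proof
  fix t
  have "(x has_real_derivative f (\<sigma> (t + s) \<omega>) (x (t + s))) (at (t + s))"
    using assms by (simp add: gsol_def)
  then show "((\<lambda>t. x (t + s)) has_real_derivative f (\<sigma> t (\<sigma> s \<omega>)) (x (t + s))) (at t)"
    by (simp add: DERIV_shift flow_add)
qed

lemma gsol_unique:
  assumes "gsol \<omega> x" "gsol \<omega> y" "x s = y s"
  shows "x t = y t"
proof -
  have "sol \<sigma> f (t - s) (\<sigma> s \<omega>) (x (0 + s)) = x (t - s + s)" by (rule gsol_sol[OF gsol_shift[OF assms(1)]])
  moreover have "sol \<sigma> f (t - s) (\<sigma> s \<omega>) (y (0 + s)) = y (t - s + s)" by (rule gsol_sol[OF gsol_shift[OF assms(2)]])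
  ultimately show ?thesis using assms(3) by simp
qed

lemma gsol_continuous: "gsol \<omega> x \<Longrightarrow> continuous_on UNIV x"
  unfolding gsol_def by (meson DERIV_isCont continuous_at_imp_continuous_on)

text \<open>If the order changed, the two solutions would agree at some time by the intermediate
  value theorem, and then at all times by uniqueness.\<close>

lemma gsol_less:
  assumes x: "gsol \<omega> x" and y: "gsol \<omega> y" and s: "x s < y s"
  shows "x t < y t"
proof (rule ccontr)
  assume "\<not> x t < y t"
  have "connected ((\<lambda>r. y r - x r) ` UNIV)"
    by (intro connected_continuous_image continuous_intros gsol_continuous[OF x] gsol_continuous[OF y]) auto
  moreover have "y s - x s \<in> range (\<lambda>r. y r - x r)" "y t - x t \<in> range (\<lambda>r. y r - x r)" by auto
  ultimately have "0 \<in> range (\<lambda>r. y r - x r)"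
    using s \<open>\<not> x t < y t\<close> connectedD_interval[of "range (\<lambda>r. y r - x r)" "y t - x t" "y s - x s" 0] by simp
  then obtain r where "0 = y r - x r" by blast
  then have "x r = y r" by simp
  then have "x s = y s" by (rule gsol_unique[OF x y])
  then show False using s by simp
qed

text \<open>Continuous dependence on base point and initial value. Restriction to solutions bounded
  by \<open>R\<close> provides one Lipschitz constant for all of them.\<close>

lemma gsol_close:
  assumes x: "gsol \<omega>0 x" and N: "N \<ge> 0" and R: "\<And>t. \<bar>x t\<bar> \<le> R" and e: "e > 0"
  shows "\<exists>d>0. \<forall>\<omega> y. dist \<omega> \<omega>0 < d \<longrightarrow> gsol \<omega> y \<longrightarrow> (\<forall>t. \<bar>y t\<bar> \<le> R) \<longrightarrow> \<bar>y 0 - x 0\<bar> < d \<longrightarrow>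
    (\<forall>t. \<bar>t\<bar> \<le> N \<longrightarrow> \<bar>y t - x t\<bar> < e)"
proof -
  obtain L where L: "L \<ge> 0" "\<And>\<omega> x y. \<bar>x\<bar> \<le> R \<Longrightarrow> \<bar>y\<bar> \<le> R \<Longrightarrow> \<bar>f \<omega> x - f \<omega> y\<bar> \<le> L * \<bar>x - y\<bar>"
    using lip_f[of R] by blast
  \<comment> \<open>Gronwall will bound the squared distance by \<open>C * d\<^sup>2\<close>;
    dividing \<open>e\<close> by \<open>C + 1\<close> makes this smaller than
    \<open>e\<^sup>2\<close>.\<close>
  define C where "C = exp ((2 * L + 1) * N) * (1 + N)"
  have C: "C \<ge> 0" using N by (simp add: C_def)
  define d where "d = e / (C + 1)"
  have d: "d > 0" using C e by (simp add: d_def)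
  have Cd: "C * d\<^sup>2 < e\<^sup>2"
  proof -
    have "(C + 1)\<^sup>2 = C\<^sup>2 + 2 * C + 1" by (simp add: power2_sum)
    then have "C < (C + 1)\<^sup>2" using C zero_le_power2[of C] by linarith
    moreover have "C * d\<^sup>2 = C / (C + 1)\<^sup>2 * e\<^sup>2" by (simp add: d_def power_divide)
    ultimately show ?thesis using e C by (simp add: divide_less_eq)
  qed
  let ?S = "{- N..N} \<times> (UNIV :: 'a set) \<times> {- R..R}"
  have "continuous_on ?S (\<lambda>z. (\<lambda>(\<omega>, x). f \<omega> x) (\<sigma> (fst z) (fst (snd z)), snd (snd z)))"
    by (rule continuous_on_compose2[OF cont_f]) (auto intro!: continuous_on_flow continuous_intros)
  moreover have "compact ?S" by (intro compact_Times cpt compact_Icc)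
  ultimately have uc: "uniformly_continuous_on ?S (\<lambda>z. f (\<sigma> (fst z) (fst (snd z))) (snd (snd z)))"
    by (intro compact_uniformly_continuous) simp_all
  obtain r where r: "r > 0" "\<And>z z'. z \<in> ?S \<Longrightarrow> z' \<in> ?S \<Longrightarrow> dist z' z < r \<Longrightarrow>
      dist (f (\<sigma> (fst z') (fst (snd z'))) (snd (snd z'))) (f (\<sigma> (fst z) (fst (snd z))) (snd (snd z))) < d"
    using uc[unfolded uniformly_continuous_on_def, rule_format, OF d] by blast
  show ?thesis
  proof (intro exI[of _ "min r d"] conjI allI impI)
    show "0 < min r d" using r d by simp
    fix \<omega> y t
    assume h: "dist \<omega> \<omega>0 < min r d" "gsol \<omega> y" "\<forall>t. \<bar>y t\<bar> \<le> R" "\<bar>y 0 - x 0\<bar> < min r d" "\<bar>t\<bar> \<le> N"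
    have "(y t - x t)\<^sup>2 \<le> exp ((2 * L + 1) * \<bar>t\<bar>) * ((y 0 - x 0)\<^sup>2 + d\<^sup>2 * \<bar>t\<bar>)"
    proof (rule gronwall_two_sided[OF L(1), where u' = "\<lambda>s. f (\<sigma> s \<omega>) (y s) - f (\<sigma> s \<omega>0) (x s)"])
      fix s assume s: "s \<in> closed_segment 0 t"
      then have sN: "s \<in> {- N..N}" using h(5) by (auto simp: closed_segment_eq_real_ivl split: if_splits)
      show "((\<lambda>s. y s - x s) has_real_derivative f (\<sigma> s \<omega>) (y s) - f (\<sigma> s \<omega>0) (x s)) (at s)"
        using h(2) x by (intro DERIV_diff) (auto simp: gsol_def)
      have xs: "- R \<le> x s" "x s \<le> R" using R[of s] by (auto simp: abs_le_iff)
      have "\<bar>f (\<sigma> s \<omega>) (x s) - f (\<sigma> s \<omega>0) (x s)\<bar> < d"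
        using r(2)[of "(s, \<omega>0, x s)" "(s, \<omega>, x s)"] sN xs h(1) by (simp add: dist_Pair_Pair dist_real_def)
      moreover have "\<bar>f (\<sigma> s \<omega>) (y s) - f (\<sigma> s \<omega>) (x s)\<bar> \<le> L * \<bar>y s - x s\<bar>" using L(2) h(3) R by simp
      ultimately show "\<bar>f (\<sigma> s \<omega>) (y s) - f (\<sigma> s \<omega>0) (x s)\<bar> \<le> L * \<bar>y s - x s\<bar> + d" by linarith
    qed
    also have "\<dots> \<le> exp ((2 * L + 1) * N) * (d\<^sup>2 + d\<^sup>2 * N)"
    proof (intro mult_mono add_mono)
      show "(y 0 - x 0)\<^sup>2 \<le> d\<^sup>2" using h(4) d abs_le_square_iff[of "y 0 - x 0" d] by linarith
      show "exp ((2 * L + 1) * \<bar>t\<bar>) \<le> exp ((2 * L + 1) * N)" using h(5) L(1) by (simp add: mult_left_mono)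
    qed (use h(5) in auto)
    also have "\<dots> = C * d\<^sup>2" by (simp add: C_def algebra_simps)
    finally have "(y t - x t)\<^sup>2 < e\<^sup>2" using Cd by linarith
    then show "\<bar>y t - x t\<bar> < e" using e abs_le_square_iff[of e "y t - x t"] by linarith
  qed
qed

end

subsection \<open>The attractor of a scalar family\<close>

locale scalar_attractor = scalar_family +
  fixes A :: "('a \<times> real) set" and \<alpha> \<beta> :: "'a \<Rightarrow> real"
  assumes attr: "global_attractor (skew_dom \<sigma> f) (skew_flow \<sigma> f) A"
    and \<alpha>_le_\<beta>: "\<And>\<omega>. \<alpha> \<omega> \<le> \<beta> \<omega>"
    and A_eq: "A = (\<Union>\<omega>. {\<omega>} \<times> {\<alpha> \<omega>..\<beta> \<omega>})"
begin

abbreviation "\<tau> \<equiv> skew_flow \<sigma> f"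
abbreviation "D \<equiv> skew_dom \<sigma> f"

lemma A_iff: "(\<omega>, x) \<in> A \<longleftrightarrow> \<alpha> \<omega> \<le> x \<and> x \<le> \<beta> \<omega>"
  by (auto simp: A_eq)

lemma \<tau>_Pair: "\<tau> t (\<omega>, x) = (\<sigma> t \<omega>, sol \<sigma> f t \<omega> x)"
  by (simp add: skew_flow_def)

lemma fst_\<tau>: "fst (\<tau> t y) = \<sigma> t (fst y)"
  by (cases y) (simp add: \<tau>_Pair)

lemma compact_A: "compact A"
  using attr by (simp add: global_attractor_def)

lemma invariant_A: "invariant_set D \<tau> A"
  using attr by (simp add: global_attractor_def)

lemma invariant_setD:
  assumes K: "invariant_set D \<tau> K" and x: "(\<omega>, x) \<in> K"
  shows "gsol \<omega> (\<lambda>t. sol \<sigma> f t \<omega> x)" "sol \<sigma> f 0 \<omega> x = x" "(\<sigma> t \<omega>, sol \<sigma> f t \<omega> x) \<in> K"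
proof -
  have "D (\<omega>, x) = UNIV" using K x unfolding invariant_set_def by blast
  then have d: "sol_dom \<sigma> f \<omega> x = UNIV" by (simp add: skew_dom_def)
  show "gsol \<omega> (\<lambda>t. sol \<sigma> f t \<omega> x)" "sol \<sigma> f 0 \<omega> x = x" using sol_gsol[OF d] by auto
  have "\<tau> t (\<omega>, x) \<in> \<tau> t ` K" using x by blast
  then show "(\<sigma> t \<omega>, sol \<sigma> f t \<omega> x) \<in> K" using K unfolding invariant_set_def \<tau>_Pair by simp
qed

lemmas A_sol = invariant_setD[OF invariant_A]

lemma \<tau>_gsol:
  assumes "gsol \<omega> x"
  shows "\<tau> t (\<sigma> s \<omega>, x s) = (\<sigma> (t + s) \<omega>, x (t + s))"
  using gsol_sol[OF gsol_shift[OF assms, of s], of t] by (simp add: \<tau>_Pair flow_add)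

text \<open>The trajectory is a bounded set that the flow maps onto itself, so its semidistance to
  the attractor is constant in time while tending to 0. Since \<open>A\<close> is closed, the
  trajectory lies in it. This is how points of the attractor are produced.\<close>

lemma bounded_gsol_in_A:
  assumes x: "gsol \<omega> x" and R: "\<And>t. \<bar>x t\<bar> \<le> R"
  shows "(\<omega>, x 0) \<in> A"
proof -
  define C where "C = range (\<lambda>s. (\<sigma> s \<omega>, x s))"
  have "bounded (UNIV \<times> {- R..R} :: ('a \<times> real) set)"
    by (intro compact_imp_bounded compact_Times cpt compact_Icc)
  moreover have "C \<subseteq> UNIV \<times> {- R..R}" using R by (auto simp: C_def abs_le_iff minus_le_iff)
  ultimately have "bounded C" by (rule bounded_subset)
  then have lim: "((\<lambda>t. semidist sum_dist (\<tau> t ` C) A) \<longlongrightarrow> 0) at_top"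
    using attr by (simp add: global_attractor_def)
  have "\<tau> t ` C = C" for t
  proof -
    have "\<tau> t ` C = range (\<lambda>s. (\<sigma> (t + s) \<omega>, x (t + s)))"
      unfolding C_def image_image by (simp add: \<tau>_gsol[OF x])
    also have "\<dots> = C" unfolding C_def
      by (auto simp: image_iff) (metis add_diff_cancel_left' diff_add_cancel add.commute)
    finally show ?thesis .
  qed
  then have "semidist sum_dist C A = 0" using lim by (simp add: tendsto_const_iff)
  moreover have "(\<omega>, x 0) \<in> C" unfolding C_def by (rule range_eqI[of _ _ 0]) simp
  ultimately have inf0: "(INF z\<in>A. ennreal (sum_dist (\<omega>, x 0) z)) = 0"
    unfolding semidist_def by (metis SUP_upper le_zero_eq)
  have Ane: "A \<noteq> {}" using A_iff[of \<omega> "\<alpha> \<omega>"] \<alpha>_le_\<beta>[of \<omega>] by auto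
  show ?thesis
  proof (rule ccontr)
    assume n: "(\<omega>, x 0) \<notin> A"
    then have "infdist (\<omega>, x 0) A > 0"
      using in_closed_iff_infdist_zero[OF compact_imp_closed[OF compact_A] Ane, of "(\<omega>, x 0)"]
        infdist_nonneg[of "(\<omega>, x 0)" A] by linarith
    moreover have "ennreal (infdist (\<omega>, x 0) A) \<le> (INF z\<in>A. ennreal (sum_dist (\<omega>, x 0) z))"
    proof (rule INF_greatest)
      fix z assume "z \<in> A"
      then have "infdist (\<omega>, x 0) A \<le> sum_dist (\<omega>, x 0) z"
        using infdist_le[of z A "(\<omega>, x 0)"] dist_le_sum_dist[of "(\<omega>, x 0)" z] by linarith
      then show "ennreal (infdist (\<omega>, x 0) A) \<le> ennreal (sum_dist (\<omega>, x 0) z)" by (rule ennreal_leI)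
    qed
    ultimately show False unfolding inf0 by simp
  qed
qed

lemma A_bound: "\<exists>R\<ge>0. \<forall>\<omega> x. (\<omega>, x) \<in> A \<longrightarrow> \<bar>x\<bar> \<le> R"
proof -
  obtain R where "R \<ge> 0" "\<And>y. y \<in> A \<Longrightarrow> \<bar>snd y\<bar> \<le> R"
    using compact_continuous_bounded[OF compact_A continuous_on_snd[OF continuous_on_id]] by blast
  then show ?thesis by (intro exI[of _ R]) force
qed

lemma invariant_subset_A:
  assumes K: "compact K" "invariant_set D \<tau> K"
  shows "K \<subseteq> A"
proof
  fix y assume y: "y \<in> K"
  obtain \<omega> x where yx: "y = (\<omega>, x)" by (cases y)
  obtain R where R: "R \<ge> 0" "\<And>y. y \<in> K \<Longrightarrow> \<bar>snd y\<bar> \<le> R"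
    using compact_continuous_bounded[OF K(1) continuous_on_snd[OF continuous_on_id]] by blast
  note s = invariant_setD[OF K(2), of \<omega> x]
  have "(\<omega>, sol \<sigma> f 0 \<omega> x) \<in> A"
    by (rule bounded_gsol_in_A[OF s(1), where R = R]) (use y yx s(3) R(2) in force)+
  then show "y \<in> A" using s(2) y yx by simp
qed

text \<open>All solutions in the attractor obey a common bound, so \<open>gsol_close\<close>
  applies; continuity of the reference solution in time handles the first argument.\<close>

lemma \<tau>_continuous_A: "continuous_on (UNIV \<times> A) (\<lambda>(t, y). \<tau> t y)"
proof -
  obtain R where R: "R \<ge> 0" "\<And>\<omega> x. (\<omega>, x) \<in> A \<Longrightarrow> \<bar>x\<bar> \<le> R" using A_bound by blast
  have "continuous_on (UNIV \<times> A) (\<lambda>z. sol \<sigma> f (fst z) (fst (snd z)) (snd (snd z)))"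
    unfolding continuous_on_iff
  proof (intro ballI allI impI)
    fix z :: "real \<times> 'a \<times> real" and e :: real
    assume z: "z \<in> UNIV \<times> A" and e: "e > 0"
    obtain t0 \<omega>0 x0 where zz: "z = (t0, \<omega>0, x0)" by (cases z)
    have zA: "(\<omega>0, x0) \<in> A" using z zz by simp
    define X where "X t = sol \<sigma> f t \<omega>0 x0" for t
    have X1: "gsol \<omega>0 X" and X2: "X 0 = x0"
      using A_sol(1,2)[OF zA] by (simp_all add: X_def[abs_def])
    have X3: "\<bar>X t\<bar> \<le> R" for t using R(2)[OF A_sol(3)[OF zA, of t]] by (simp add: X_def)
    note X = X1 X2 X3
    have "\<exists>d>0. \<forall>\<omega> y. dist \<omega> \<omega>0 < d \<longrightarrow> gsol \<omega> y \<longrightarrow> (\<forall>t. \<bar>y t\<bar> \<le> R) \<longrightarrow> \<bar>y 0 - X 0\<bar> < d \<longrightarrow>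
        (\<forall>t. \<bar>t\<bar> \<le> \<bar>t0\<bar> + 1 \<longrightarrow> \<bar>y t - X t\<bar> < e / 2)"
      by (rule gsol_close[OF X1 _ X3]) (use e in auto)
    then obtain d where d0: "d > 0" "\<forall>\<omega> y. dist \<omega> \<omega>0 < d \<longrightarrow> gsol \<omega> y \<longrightarrow> (\<forall>t. \<bar>y t\<bar> \<le> R) \<longrightarrow>
        \<bar>y 0 - X 0\<bar> < d \<longrightarrow> (\<forall>t. \<bar>t\<bar> \<le> \<bar>t0\<bar> + 1 \<longrightarrow> \<bar>y t - X t\<bar> < e / 2)" by (elim exE conjE)
    note d = d0(1) d0(2)[rule_format]
    have "isCont X t0" using gsol_continuous[OF X(1)] by (simp add: continuous_on_eq_continuous_at)
    then obtain r where r: "r > 0" "\<And>t. dist t t0 < r \<Longrightarrow> dist (X t) (X t0) < e / 2"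
      using e half_gt_zero[OF e] unfolding continuous_at_eps_delta by blast
    show "\<exists>\<delta>>0. \<forall>z'\<in>UNIV \<times> A. dist z' z < \<delta> \<longrightarrow>
       dist (sol \<sigma> f (fst z') (fst (snd z')) (snd (snd z'))) (sol \<sigma> f (fst z) (fst (snd z)) (snd (snd z))) < e"
    proof (intro exI[of _ "min (min d r) 1"] conjI ballI impI)
      show "0 < min (min d r) 1" using d r by simp
      fix z' assume z': "z' \<in> UNIV \<times> A" "dist z' z < min (min d r) 1"
      obtain t \<omega> x where zz': "z' = (t, \<omega>, x)" by (cases z')
      have A': "(\<omega>, x) \<in> A" using z' zz' by simp
      have "dist t t0 \<le> dist z' z" "dist (\<omega>, x) (\<omega>0, x0) \<le> dist z' z"
        using dist_fst_le[of z' z] dist_snd_le[of z' z] zz zz' by auto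
      moreover have "dist \<omega> \<omega>0 \<le> dist (\<omega>, x) (\<omega>0, x0)" "dist x x0 \<le> dist (\<omega>, x) (\<omega>0, x0)"
        using dist_fst_le[of "(\<omega>, x)" "(\<omega>0, x0)"] dist_snd_le[of "(\<omega>, x)" "(\<omega>0, x0)"] by auto
      ultimately have b: "dist t t0 < min (min d r) 1" "dist \<omega> \<omega>0 < min (min d r) 1" "\<bar>x - x0\<bar> < min (min d r) 1"
        using z'(2) by (auto simp: dist_real_def)
      have "\<bar>sol \<sigma> f t \<omega> x - X t\<bar> < e / 2"
      proof (rule d(2)[of \<omega> "\<lambda>t. sol \<sigma> f t \<omega> x"])
        show "\<bar>t\<bar> \<le> \<bar>t0\<bar> + 1" using b(1) by (auto simp: dist_real_def)
        show "\<bar>sol \<sigma> f t \<omega> x\<bar> \<le> R" for t by (rule R(2)[OF A_sol(3)[OF A']])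
        show "\<bar>sol \<sigma> f 0 \<omega> x - X 0\<bar> < d" using A_sol(2)[OF A'] X(2) b(3) by simp
        show "dist \<omega> \<omega>0 < d" using b(2) by simp
        show "gsol \<omega> (\<lambda>t. sol \<sigma> f t \<omega> x)" by (rule A_sol(1)[OF A'])
      qed
      moreover have "\<bar>X t - X t0\<bar> < e / 2" using r(2)[of t] b(1) by (simp add: dist_real_def)
      ultimately have "\<bar>sol \<sigma> f t \<omega> x - X t0\<bar> < e" by linarith
      then show "dist (sol \<sigma> f (fst z') (fst (snd z')) (snd (snd z'))) (sol \<sigma> f (fst z) (fst (snd z)) (snd (snd z))) < e"
        by (simp add: zz zz' dist_real_def X_def[symmetric])
    qed
  qed
  moreover have "continuous_on (UNIV \<times> A) (\<lambda>z. \<sigma> (fst z) (fst (snd z)))"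
    by (intro continuous_on_flow continuous_intros)
  ultimately have "continuous_on (UNIV \<times> A) (\<lambda>z. (\<sigma> (fst z) (fst (snd z)), sol \<sigma> f (fst z) (fst (snd z)) (snd (snd z))))"
    by (intro continuous_on_Pair)
  then show ?thesis by (simp add: skew_flow_def case_prod_beta)
qed

lemma \<tau>_A_0: "y \<in> A \<Longrightarrow> \<tau> 0 y = y"
  by (cases y) (simp add: \<tau>_Pair A_sol(2))

lemma \<tau>_A_closed: "y \<in> A \<Longrightarrow> \<tau> t y \<in> A"
  by (cases y) (simp add: \<tau>_Pair A_sol(3))

lemma \<tau>_A_add: "y \<in> A \<Longrightarrow> \<tau> (s + t) y = \<tau> s (\<tau> t y)"
proof (cases y)
  case (Pair \<omega> x)
  assume "y \<in> A"
  then have "(\<omega>, x) \<in> A" using Pair by simp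
  from \<tau>_gsol[OF A_sol(1)[OF this], of s t] show ?thesis using Pair by (simp add: \<tau>_Pair)
qed

lemma continuous_flow_on_subset_A:
  assumes "K \<subseteq> A" "\<And>t y. y \<in> K \<Longrightarrow> \<tau> t y \<in> K"
  shows "continuous_flow_on K \<tau>"
  unfolding continuous_flow_on_def
  using assms \<tau>_A_0 \<tau>_A_add
  by (auto intro!: continuous_on_subset[OF \<tau>_continuous_A])

lemma D_A: "y \<in> A \<Longrightarrow> D y = UNIV"
  using invariant_A by (auto simp: invariant_set_def)

lemma invariant_set_subset_A:
  assumes "K \<subseteq> A" "\<And>t y. y \<in> K \<Longrightarrow> \<tau> t y \<in> K"
  shows "invariant_set D \<tau> K"
  unfolding invariant_set_def
proof (intro conjI ballI allI)
  show "D y = UNIV" if "y \<in> K" for y using that assms(1) D_A by blast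
  fix t
  show "\<tau> t ` K = K"
  proof
    show "\<tau> t ` K \<subseteq> K" using assms(2) by blast
    show "K \<subseteq> \<tau> t ` K"
    proof
      fix y assume y: "y \<in> K"
      then have "y = \<tau> t (\<tau> (- t) y)" using \<tau>_A_add[of y t "- t"] \<tau>_A_0[of y] assms(1) by auto
      then show "y \<in> \<tau> t ` K" using assms(2)[OF y] by blast
    qed
  qed
qed

lemma \<alpha>_A: "(\<omega>, \<alpha> \<omega>) \<in> A" and \<beta>_A: "(\<omega>, \<beta> \<omega>) \<in> A"
  using \<alpha>_le_\<beta> by (auto simp: A_iff)

lemma sol_inverse:
  assumes "(\<omega>, x) \<in> A"
  shows "sol \<sigma> f t (\<sigma> (- t) \<omega>) (sol \<sigma> f (- t) \<omega> x) = x"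
  using \<tau>_A_add[OF assms, of t "- t"] \<tau>_A_0[OF assms] by (simp add: \<tau>_Pair)

lemma sol_less:
  assumes "(\<omega>, x) \<in> A" "(\<omega>, y) \<in> A" "x < y"
  shows "sol \<sigma> f t \<omega> x < sol \<sigma> f t \<omega> y"
  by (rule gsol_less[OF A_sol(1)[OF assms(1)] A_sol(1)[OF assms(2)], of 0])
    (simp add: A_sol(2)[OF assms(1)] A_sol(2)[OF assms(2)] assms(3))

text \<open>Order preservation: if the image of the lowest point of a fibre lay above the lowest
  point of the next one, the preimage of the latter would lie below the original fibre.\<close>

lemma sol_\<alpha>: "sol \<sigma> f t \<omega> (\<alpha> \<omega>) = \<alpha> (\<sigma> t \<omega>)"
proof (rule antisym)
  show "\<alpha> (\<sigma> t \<omega>) \<le> sol \<sigma> f t \<omega> (\<alpha> \<omega>)" using A_sol(3)[OF \<alpha>_A, of t \<omega>] by (simp add: A_iff)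
  show "sol \<sigma> f t \<omega> (\<alpha> \<omega>) \<le> \<alpha> (\<sigma> t \<omega>)"
  proof (rule ccontr)
    assume "\<not> ?thesis"
    then have "sol \<sigma> f (- t) (\<sigma> t \<omega>) (\<alpha> (\<sigma> t \<omega>)) < sol \<sigma> f (- t) (\<sigma> t \<omega>) (sol \<sigma> f t \<omega> (\<alpha> \<omega>))"
      using \<alpha>_A A_sol(3)[OF \<alpha>_A] by (intro sol_less) auto
    also have "\<dots> = \<alpha> \<omega>" using sol_inverse[OF \<alpha>_A, of "- t" \<omega>] by simp
    also have "\<dots> \<le> sol \<sigma> f (- t) (\<sigma> t \<omega>) (\<alpha> (\<sigma> t \<omega>))"
      using A_sol(3)[OF \<alpha>_A, of "- t" "\<sigma> t \<omega>"] by (simp add: A_iff)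
    finally show False by simp
  qed
qed

lemma sol_\<beta>: "sol \<sigma> f t \<omega> (\<beta> \<omega>) = \<beta> (\<sigma> t \<omega>)"
proof (rule antisym)
  show "sol \<sigma> f t \<omega> (\<beta> \<omega>) \<le> \<beta> (\<sigma> t \<omega>)" using A_sol(3)[OF \<beta>_A, of t \<omega>] by (simp add: A_iff)
  show "\<beta> (\<sigma> t \<omega>) \<le> sol \<sigma> f t \<omega> (\<beta> \<omega>)"
  proof (rule ccontr)
    assume "\<not> ?thesis"
    then have "sol \<sigma> f (- t) (\<sigma> t \<omega>) (sol \<sigma> f t \<omega> (\<beta> \<omega>)) < sol \<sigma> f (- t) (\<sigma> t \<omega>) (\<beta> (\<sigma> t \<omega>))"
      using \<beta>_A A_sol(3)[OF \<beta>_A] by (intro sol_less) auto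
    also have "\<dots> \<le> \<beta> \<omega>"
      using A_sol(3)[OF \<beta>_A, of "- t" "\<sigma> t \<omega>"] by (simp add: A_iff)
    also have "\<beta> \<omega> = sol \<sigma> f (- t) (\<sigma> t \<omega>) (sol \<sigma> f t \<omega> (\<beta> \<omega>))" using sol_inverse[OF \<beta>_A, of "- t" \<omega>] by simp
    finally show False by simp
  qed
qed

lemma gsol_\<alpha>: "gsol \<omega> (\<lambda>t. \<alpha> (\<sigma> t \<omega>))" and gsol_\<beta>: "gsol \<omega> (\<lambda>t. \<beta> (\<sigma> t \<omega>))"
  using A_sol(1)[OF \<alpha>_A, of \<omega>] A_sol(1)[OF \<beta>_A, of \<omega>] by (simp_all add: sol_\<alpha> sol_\<beta>)

text \<open>Semicontinuity of the bounds comes from projecting closed parts of the compact set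
  \<open>A\<close> onto the base.\<close>

lemma closed_\<beta>_ge: "closed {\<omega>. \<beta> \<omega> \<ge> c}"
proof -
  have "compact (A \<inter> UNIV \<times> {c..})" by (intro compact_Int_closed compact_A closed_Times) auto
  then have "closed (fst ` (A \<inter> UNIV \<times> {c..}))"
    by (intro compact_imp_closed compact_continuous_image continuous_intros)
  also have "fst ` (A \<inter> UNIV \<times> {c..}) = {\<omega>. \<beta> \<omega> \<ge> c}"
  proof (intro set_eqI iffI)
    fix \<omega> assume "\<omega> \<in> {\<omega>. \<beta> \<omega> \<ge> c}"
    then show "\<omega> \<in> fst ` (A \<inter> UNIV \<times> {c..})" using \<beta>_A[of \<omega>] by (intro image_eqI[of _ _ "(\<omega>, \<beta> \<omega>)"]) auto
  qed (auto simp: A_iff)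
  finally show ?thesis .
qed

lemma closed_\<alpha>_le: "closed {\<omega>. \<alpha> \<omega> \<le> c}"
proof -
  have "compact (A \<inter> UNIV \<times> {..c})" by (intro compact_Int_closed compact_A closed_Times) auto
  then have "closed (fst ` (A \<inter> UNIV \<times> {..c}))"
    by (intro compact_imp_closed compact_continuous_image continuous_intros)
  also have "fst ` (A \<inter> UNIV \<times> {..c}) = {\<omega>. \<alpha> \<omega> \<le> c}"
  proof (intro set_eqI iffI)
    fix \<omega> assume "\<omega> \<in> {\<omega>. \<alpha> \<omega> \<le> c}"
    then show "\<omega> \<in> fst ` (A \<inter> UNIV \<times> {..c})" using \<alpha>_A[of \<omega>] by (intro image_eqI[of _ _ "(\<omega>, \<alpha> \<omega>)"]) auto
  qed (auto simp: A_iff)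
  finally show ?thesis .
qed

lemma \<alpha>_borel [measurable]: "\<alpha> \<in> borel_measurable borel" 
  unfolding borel_measurable_iff_le using closed_\<alpha>_le by simp

lemma \<beta>_borel [measurable]: "\<beta> \<in> borel_measurable borel"
  unfolding borel_measurable_iff_ge using closed_\<beta>_ge by simp

end

subsection \<open>The dissipative family with a linear zone\<close>

text \<open>This turns conditions along whole orbits into countable ones, both for measurability and
  for statements that hold almost everywhere.\<close>

lemma all_iff_all_Rats:
  fixes h :: "real \<Rightarrow> 'y::topological_space"
  assumes h: "continuous_on UNIV h" and C: "closed C"
  shows "(\<forall>t. h t \<in> C) \<longleftrightarrow> (\<forall>q\<in>\<rat>. h q \<in> C)"
proof (intro iffI allI)
  fix t assume r: "\<forall>q\<in>\<rat>. h q \<in> C"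
  show "h t \<in> C"
  proof (rule ccontr)
    assume "h t \<notin> C"
    moreover have "open (h -` (- C))" using h C by (simp add: continuous_on_open_vimage open_Compl)
    ultimately obtain e where e: "e > 0" "ball t e \<subseteq> h -` (- C)" by (meson ComplI openE vimageI2)
    obtain q where q: "q \<in> \<rat>" "t < q" "q < t + e" using Rats_dense_in_real[of t "t + e"] e(1) by auto
    then have "q \<in> ball t e" by (auto simp: dist_real_def)
    then show False using e(2) r q(1) by blast
  qed
qed auto

locale linear_zone_family =
  ergodic_flow \<sigma> m + minimal_flow \<sigma>
  for \<sigma> :: "real \<Rightarrow> 'w::metric_space \<Rightarrow> 'w" and m +
  fixes a b :: "'w \<Rightarrow> real" and g g_x :: "'w \<Rightarrow> real \<Rightarrow> real" and r1 r2 :: real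
    and A M :: "('w \<times> real) set" and \<alpha> \<beta> :: "'w \<Rightarrow> real"
  assumes cont_a: "continuous_on UNIV a"
    and cont_b: "continuous_on UNIV b"
    and r12: "r1 < r2"
    and g_deriv: "\<And>\<omega> x. (g \<omega> has_real_derivative g_x \<omega> x) (at x)"
    and cont_g: "continuous_on UNIV (\<lambda>(\<omega>, x). g \<omega> x)"
    and cont_g_x: "continuous_on UNIV (\<lambda>(\<omega>, x). g_x \<omega> x)"
    and g_zero: "\<And>\<omega> x. r1 \<le> x \<Longrightarrow> x \<le> r2 \<Longrightarrow> g \<omega> x = 0"
    and g_pos: "\<And>\<omega> x. x < r1 \<Longrightarrow> g \<omega> x > 0"
    and g_neg: "\<And>\<omega> x. x > r2 \<Longrightarrow> g \<omega> x < 0"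
    and g_x_neg: "\<And>\<omega> x. x \<notin> {r1..r2} \<Longrightarrow> g_x \<omega> x < 0"
    and attr: "global_attractor (skew_dom \<sigma> (\<lambda>\<omega> x. a \<omega> * x + b \<omega> + g \<omega> x))
      (skew_flow \<sigma> (\<lambda>\<omega> x. a \<omega> * x + b \<omega> + g \<omega> x)) A"
    and \<alpha>_le_\<beta>: "\<And>\<omega>. \<alpha> \<omega> \<le> \<beta> \<omega>"
    and A_eq: "A = (\<Union>\<omega>. {\<omega>} \<times> {\<alpha> \<omega>..\<beta> \<omega>})"
    and M_minimal: "minimal_set (skew_dom \<sigma> (\<lambda>\<omega> x. a \<omega> * x + b \<omega> + g \<omega> x))
      (skew_flow \<sigma> (\<lambda>\<omega> x. a \<omega> * x + b \<omega> + g \<omega> x)) M"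
    and M_in: "M \<subseteq> UNIV \<times> {r1..<r2} \<or> M \<subseteq> UNIV \<times> {r1<..r2}"
    and a_R: "a \<in> R_class \<sigma> m"
begin

lemma a_bound: "\<exists>C\<ge>0. \<forall>\<omega>. \<bar>a \<omega>\<bar> \<le> C"
  using compact_continuous_bounded[OF compact_UNIV cont_a] by (metis UNIV_I)

lemma g_lipschitz: "\<exists>L\<ge>0. \<forall>\<omega> x y. \<bar>x\<bar> \<le> R \<longrightarrow> \<bar>y\<bar> \<le> R \<longrightarrow> \<bar>g \<omega> x - g \<omega> y\<bar> \<le> L * \<bar>x - y\<bar>"
proof -
  have "compact ((UNIV :: 'w set) \<times> {- R..R})" by (intro compact_Times compact_UNIV compact_Icc)
  then obtain L where L: "L \<ge> 0" "\<And>y. y \<in> UNIV \<times> {- R..R} \<Longrightarrow> \<bar>case y of (\<omega>, x) \<Rightarrow> g_x \<omega> x\<bar> \<le> L"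
    using compact_continuous_bounded[OF _ continuous_on_subset[OF cont_g_x]] by (metis subset_UNIV)
  have *: "\<bar>g \<omega> x - g \<omega> y\<bar> \<le> L * \<bar>x - y\<bar>" if "\<bar>x\<bar> \<le> R" "\<bar>y\<bar> \<le> R" "x < y" for \<omega> x y
  proof -
    have "\<exists>z>x. z < y \<and> g \<omega> y - g \<omega> x = (y - x) * g_x \<omega> z"
      by (rule MVT2[OF that(3)]) (rule g_deriv)
    then obtain z where z: "x < z" "z < y" "g \<omega> y - g \<omega> x = (y - x) * g_x \<omega> z" by blast
    have "- R \<le> z" "z \<le> R" using z that by linarith+
    then have "\<bar>g_x \<omega> z\<bar> \<le> L" using L(2)[of "(\<omega>, z)"] by simp
    then have "\<bar>y - x\<bar> * \<bar>g_x \<omega> z\<bar> \<le> \<bar>y - x\<bar> * L" by (intro mult_left_mono) auto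
    then have "\<bar>g \<omega> y - g \<omega> x\<bar> \<le> \<bar>y - x\<bar> * L" unfolding z(3) abs_mult .
    then show ?thesis by (simp add: abs_minus_commute mult.commute)
  qed
  have "\<bar>g \<omega> x - g \<omega> y\<bar> \<le> L * \<bar>x - y\<bar>" if "\<bar>x\<bar> \<le> R" "\<bar>y\<bar> \<le> R" for \<omega> x y
    using *[of x y \<omega>] *[of y x \<omega>] that by (cases x y rule: linorder_cases) (auto simp: abs_minus_commute)
  then show ?thesis using L(1) by blast
qed

sublocale scalar_attractor \<sigma> "\<lambda>\<omega> x. a \<omega> * x + b \<omega> + g \<omega> x" A \<alpha> \<beta>
proof
  show "continuous_on UNIV (\<lambda>(\<omega>, x). a \<omega> * x + b \<omega> + g \<omega> x)"
  proof -
    have "continuous_on UNIV (\<lambda>z. g (fst z) (snd z))" using cont_g by (simp add: case_prod_beta)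
    moreover have "continuous_on UNIV (\<lambda>z::'w \<times> real. a (fst z))" "continuous_on UNIV (\<lambda>z::'w \<times> real. b (fst z))"
      by (rule continuous_on_compose2[OF cont_a], auto intro!: continuous_intros,
          rule continuous_on_compose2[OF cont_b], auto intro!: continuous_intros)
    ultimately show ?thesis unfolding case_prod_beta by (intro continuous_intros)
  qed
  show "\<exists>L\<ge>0. \<forall>\<omega> x y. \<bar>x\<bar> \<le> R \<longrightarrow> \<bar>y\<bar> \<le> R \<longrightarrow>
      \<bar>a \<omega> * x + b \<omega> + g \<omega> x - (a \<omega> * y + b \<omega> + g \<omega> y)\<bar> \<le> L * \<bar>x - y\<bar>" for R
  proof -
    obtain C where C: "C \<ge> 0" "\<And>\<omega>. \<bar>a \<omega>\<bar> \<le> C" using a_bound by blast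
    obtain L where L: "L \<ge> 0" "\<And>\<omega> x y. \<bar>x\<bar> \<le> R \<Longrightarrow> \<bar>y\<bar> \<le> R \<Longrightarrow> \<bar>g \<omega> x - g \<omega> y\<bar> \<le> L * \<bar>x - y\<bar>"
      using g_lipschitz by blast
    have "\<bar>a \<omega> * x + b \<omega> + g \<omega> x - (a \<omega> * y + b \<omega> + g \<omega> y)\<bar> \<le> (C + L) * \<bar>x - y\<bar>"
      if "\<bar>x\<bar> \<le> R" "\<bar>y\<bar> \<le> R" for \<omega> x y
    proof -
      have "a \<omega> * x + b \<omega> + g \<omega> x - (a \<omega> * y + b \<omega> + g \<omega> y) = a \<omega> * (x - y) + (g \<omega> x - g \<omega> y)"
        by (simp add: algebra_simps)
      moreover have "\<bar>a \<omega> * (x - y)\<bar> \<le> C * \<bar>x - y\<bar>" using C by (simp add: abs_mult mult_right_mono)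
      ultimately show ?thesis using L(2)[OF that, of \<omega>] by (simp add: distrib_right)
    qed
    then show ?thesis using C L by (intro exI[of _ "C + L"]) auto
  qed
qed (fact compact_UNIV attr \<alpha>_le_\<beta> A_eq)+

abbreviation "I \<equiv> cocycle_int \<sigma> a"

lemma oc_a: "orbit_continuous a"
  by (rule orbit_continuousI[OF cont_a])

lemma no_primitive: "\<not> continuous_primitive \<sigma> a"
  using a_R by (simp add: R_class_def)

text \<open>Outside the zone the derivative decides, across its ends the signs do. As a consequence,
  equal values of \<open>g\<close> at the two bounds of a nondegenerate fibre locate the fibre
  inside the linear zone.\<close>

lemma g_strict_antimono:
  assumes xy: "x < y" and n: "\<not> (r1 \<le> x \<and> y \<le> r2)"
  shows "g \<omega> y < g \<omega> x"
proof -
  have mvt: "g \<omega> y < g \<omega> x" if "x < y" "y \<le> r1 \<or> r2 \<le> x" for x y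
  proof -
    have "\<exists>z>x. z < y \<and> g \<omega> y - g \<omega> x = (y - x) * g_x \<omega> z"
      by (rule MVT2[OF that(1)]) (rule g_deriv)
    then obtain z where z: "x < z" "z < y" "g \<omega> y - g \<omega> x = (y - x) * g_x \<omega> z" by blast
    have "g_x \<omega> z < 0" using z that by (intro g_x_neg) auto
    then have "(y - x) * g_x \<omega> z < 0" using that(1) by (simp add: mult_pos_neg)
    then show ?thesis using z(3) by linarith
  qed
  consider "y \<le> r1" | "r2 \<le> x" | "x < r1" "r1 < y" | "r1 \<le> x" "x < r2" "r2 < y"
    using n xy by linarith
  then show ?thesis
  proof cases
    case 3
    then have "g \<omega> y \<le> 0" using g_zero[of y \<omega>] g_neg[of y \<omega>] by (cases "y \<le> r2") auto
    then show ?thesis using g_pos[OF 3(1), of \<omega>] by simp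
  next
    case 4
    then show ?thesis using g_zero[of x \<omega>] g_neg[of y \<omega>] by simp
  qed (use mvt xy in auto)
qed

lemma g_antimono: "x \<le> y \<Longrightarrow> g \<omega> y \<le> g \<omega> x"
  using g_strict_antimono[of x y \<omega>] g_zero[of x \<omega>] g_zero[of y \<omega>]
  by (cases "x = y"; cases "r1 \<le> x \<and> y \<le> r2") auto

lemma projection_UNIV:
  assumes K: "compact K" "K \<noteq> {}" "invariant_set D \<tau> K"
  shows "fst ` K = UNIV"
proof (rule closed_invariant_UNIV)
  show "closed (fst ` K)" using K(1) by (intro compact_imp_closed compact_continuous_image continuous_intros)
  show "fst ` K \<noteq> {}" using K(2) by simp
  fix t \<omega> assume "\<omega> \<in> fst ` K"
  then obtain x where "(\<omega>, x) \<in> K" by force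
  from imageI[OF invariant_setD(3)[OF K(3) this, of t], of fst] show "\<sigma> t \<omega> \<in> fst ` K" by simp
qed

lemma M_props: "compact M" "M \<noteq> {}" "invariant_set D \<tau> M"
  using M_minimal by (auto simp: minimal_set_def)

lemma M_subset_A: "M \<subseteq> A"
  using invariant_subset_A M_props by blast

text \<open>Over \<open>\<Omega>\<^sup>a\<close> a solution inside \<open>M\<close> stays in the zone where the equation is linear and at a
  positive distance from one of its ends, so it can be perturbed by a small multiple of
  \<open>exp (\<integral>\<^sub>0\<^sup>t a)\<close> without leaving the zone.\<close>

lemma \<alpha>_less_\<beta>:
  assumes \<omega>: "\<omega> \<in> Omega_sup \<sigma> a"
  shows "\<alpha> \<omega> < \<beta> \<omega>"
proof -
  obtain x0 where x0: "(\<omega>, x0) \<in> M" using projection_UNIV[OF M_props] by force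
  define X where "X t = sol \<sigma> (\<lambda>\<omega> x. a \<omega> * x + b \<omega> + g \<omega> x) t \<omega> x0" for t
  have X: "gsol \<omega> X" "X 0 = x0" and XM: "(\<sigma> t \<omega>, X t) \<in> M" for t
    using invariant_setD[OF M_props(3) x0] by (simp_all add: X_def[abs_def])
  have "\<exists>c. \<forall>t. I \<omega> t \<le> c" using \<omega> by (auto simp: Omega_sup_def bdd_above_def)
  then obtain c where "\<forall>t. I \<omega> t \<le> c" ..
  then have c: "I \<omega> t \<le> c" for t ..
  have cM: "compact (snd ` M)" "snd ` M \<noteq> {}"
    using M_props by (auto intro!: compact_continuous_image continuous_intros)
  \<comment> \<open>Inside the zone \<open>g\<close> vanishes at \<open>X t\<close> and at the
    perturbed value, so their difference only has to solve the homogeneous linear equation. The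
    result is an entire bounded solution, hence lies in the attractor.\<close>
  have pert: "(\<omega>, x0 + k) \<in> A" if k: "\<And>t. r1 \<le> X t + k * exp (I \<omega> t) \<and> X t + k * exp (I \<omega> t) \<le> r2" for k
  proof -
    have Xr: "r1 \<le> X t" "X t \<le> r2" for t using XM[of t] M_in by auto
    have "gsol \<omega> (\<lambda>t. X t + k * exp (I \<omega> t))" unfolding gsol_def
    proof
      fix t
      have "((\<lambda>t. X t + k * exp (I \<omega> t)) has_real_derivative
          (a (\<sigma> t \<omega>) * X t + b (\<sigma> t \<omega>) + g (\<sigma> t \<omega>) (X t)) + k * (exp (I \<omega> t) * a (\<sigma> t \<omega>))) (at t)"
        using X(1) cocycle_int_deriv[OF oc_a, of \<omega> t] unfolding gsol_def
        by (auto intro!: derivative_eq_intros)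
      then show "((\<lambda>t. X t + k * exp (I \<omega> t)) has_real_derivative
          a (\<sigma> t \<omega>) * (X t + k * exp (I \<omega> t)) + b (\<sigma> t \<omega>) + g (\<sigma> t \<omega>) (X t + k * exp (I \<omega> t))) (at t)"
        using k[of t] Xr[of t] by (simp add: g_zero algebra_simps)
    qed
    moreover have "\<bar>X t + k * exp (I \<omega> t)\<bar> \<le> max \<bar>r1\<bar> \<bar>r2\<bar>" for t using k[of t] by linarith
    ultimately have "(\<omega>, X 0 + k * exp (I \<omega> 0)) \<in> A" by (rule bounded_gsol_in_A)
    then show ?thesis using X(2) by simp
  qed
  have ee: "0 < exp (I \<omega> t - c)" "exp (I \<omega> t - c) \<le> 1" for t using c[of t] by auto
  have x0A: "(\<omega>, x0) \<in> A" using x0 M_subset_A by blast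
  from M_in show ?thesis
  proof
    assume Mi: "M \<subseteq> UNIV \<times> {r1..<r2}"
    obtain s where s: "s \<in> snd ` M" "\<And>x. x \<in> snd ` M \<Longrightarrow> x \<le> s"
      using compact_attains_sup[OF cM] by blast
    \<comment> \<open>By compactness \<open>M\<close> keeps the positive distance \<open>e\<close>
      from the end \<open>r2\<close>. The factor \<open>exp (- c)\<close> below compensates the
      upper bound of the integral, so the perturbation never exceeds \<open>e\<close>.\<close>
    define e where "e = r2 - s"
    have e: "e > 0" using s(1) Mi by (auto simp: e_def)
    have "(\<omega>, x0 + e * exp (- c)) \<in> A"
    proof (rule pert)
      fix t
      have "X t \<in> snd ` M" using XM[of t] by force
      then have "r1 \<le> X t" "X t \<le> r2 - e" using s(2) Mi by (auto simp: e_def)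
      moreover have "e * exp (- c) * exp (I \<omega> t) = e * exp (I \<omega> t - c)" by (simp flip: exp_add)
      moreover have "0 < e * exp (I \<omega> t - c)" "e * exp (I \<omega> t - c) \<le> e"
        using e ee[of t] by (auto simp: mult_le_cancel_left1)
      ultimately show "r1 \<le> X t + e * exp (- c) * exp (I \<omega> t) \<and> X t + e * exp (- c) * exp (I \<omega> t) \<le> r2"
        by linarith
    qed
    then show ?thesis using x0A e by (simp add: A_iff) (smt (verit) exp_gt_zero mult_pos_pos)
  next
    \<comment> \<open>Now \<open>M\<close> keeps away from \<open>r1\<close>, and the perturbation
      goes downwards.\<close>
    assume Mi: "M \<subseteq> UNIV \<times> {r1<..r2}"
    obtain s where s: "s \<in> snd ` M" "\<And>x. x \<in> snd ` M \<Longrightarrow> s \<le> x"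
      using compact_attains_inf[OF cM] by blast
    define e where "e = s - r1"
    have e: "e > 0" using s(1) Mi by (auto simp: e_def)
    have "(\<omega>, x0 + - e * exp (- c)) \<in> A"
    proof (rule pert)
      fix t
      have "X t \<in> snd ` M" using XM[of t] by force
      then have "X t \<le> r2" "X t \<ge> r1 + e" using s(2) Mi by (auto simp: e_def)
      moreover have "- e * exp (- c) * exp (I \<omega> t) = - (e * exp (I \<omega> t - c))" by (simp flip: exp_add)
      moreover have "0 < e * exp (I \<omega> t - c)" "e * exp (I \<omega> t - c) \<le> e"
        using e ee[of t] by (auto simp: mult_le_cancel_left1)
      ultimately show "r1 \<le> X t + - e * exp (- c) * exp (I \<omega> t) \<and> X t + - e * exp (- c) * exp (I \<omega> t) \<le> r2"
        by linarith
    qed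
    then show ?thesis using x0A e by (simp add: A_iff) (smt (verit) exp_gt_zero mult_pos_pos)
  qed
qed

lemma Omega_sup_AE: "AE \<omega> in m. \<omega> \<in> Omega_sup \<sigma> a"
proof -
  obtain C where "\<And>\<omega>. \<bar>a \<omega>\<bar> \<le> C" using a_bound by blast
  then have "AE \<omega> in m. bdd_above (range (I \<omega>))"
    using a_R by (intro AE_bdd_above_cocycle[OF cont_a]) (auto simp: R_class_def)
  then show ?thesis by (simp add: Omega_sup_eq[OF cont_a no_primitive])
qed

definition Omega_l :: "'w set" where
  "Omega_l = {\<omega> \<in> Omega_sup \<sigma> a.
     \<forall>t. r1 \<le> \<alpha> (\<sigma> t \<omega>) \<and> \<alpha> (\<sigma> t \<omega>) \<le> \<beta> (\<sigma> t \<omega>) \<and> \<beta> (\<sigma> t \<omega>) \<le> r2}"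

lemma orbit_\<alpha>: "continuous_on UNIV (\<lambda>t. \<alpha> (\<sigma> t \<omega>))" and orbit_\<beta>: "continuous_on UNIV (\<lambda>t. \<beta> (\<sigma> t \<omega>))"
  by (rule gsol_continuous[OF gsol_\<alpha>], rule gsol_continuous[OF gsol_\<beta>])

lemma Omega_l_invariant: "\<omega> \<in> Omega_l \<Longrightarrow> \<sigma> s \<omega> \<in> Omega_l"
  using Omega_sup_invariant[OF cont_a no_primitive, of \<omega> s]
  by (auto simp: Omega_l_def simp flip: flow_add)

lemma Omega_l_borel: "Omega_l \<in> sets borel"
proof -
  have "\<omega> \<in> Omega_l \<longleftrightarrow> \<omega> \<in> Omega_sup \<sigma> a \<and> (\<forall>q\<in>\<rat>. (\<alpha> (\<sigma> q \<omega>), \<beta> (\<sigma> q \<omega>)) \<in> {r1..} \<times> {..r2})" for \<omega>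
  proof -
    have "(\<forall>t. (\<alpha> (\<sigma> t \<omega>), \<beta> (\<sigma> t \<omega>)) \<in> {r1..} \<times> {..r2}) \<longleftrightarrow>
        (\<forall>q\<in>\<rat>. (\<alpha> (\<sigma> q \<omega>), \<beta> (\<sigma> q \<omega>)) \<in> {r1..} \<times> {..r2})"
      by (intro all_iff_all_Rats continuous_on_Pair orbit_\<alpha> orbit_\<beta> closed_Times) auto
    then show ?thesis by (simp add: Omega_l_def \<alpha>_le_\<beta>)
  qed
  then have "Omega_l = Omega_sup \<sigma> a \<inter>
      (\<Inter>q\<in>\<rat>. {\<omega>. \<alpha> (\<sigma> q \<omega>) \<ge> r1} \<inter> {\<omega>. \<beta> (\<sigma> q \<omega>) \<le> r2})" by auto
  also have "\<dots> \<in> sets borel"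
  proof -
    have ab: "(\<lambda>\<omega>. \<alpha> (\<sigma> q \<omega>)) \<in> borel_measurable borel" "(\<lambda>\<omega>. \<beta> (\<sigma> q \<omega>)) \<in> borel_measurable borel" for q
      using flow_measurable_compose[OF \<alpha>_borel] flow_measurable_compose[OF \<beta>_borel] by (simp_all add: measurable_m)
    have "{\<omega>. \<alpha> (\<sigma> q \<omega>) \<ge> r1} \<in> sets borel" "{\<omega>. \<beta> (\<sigma> q \<omega>) \<le> r2} \<in> sets borel" for q
      using ab[of q, unfolded borel_measurable_iff_ge] ab[of q, unfolded borel_measurable_iff_le] by auto
    then show ?thesis
      by (intro sets.Int Omega_sup_borel[OF cont_a no_primitive] sets.countable_INT'')
        (auto simp: countable_rat Rats_0 intro: Rats_0)
  qed
  finally show ?thesis .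
qed

text \<open>\<open>ln (\<beta> - \<alpha>)\<close> is a measurable primitive, along the flow, of \<open>a\<close> plus a nonpositive function
  vanishing only where \<open>r1 \<le> \<alpha>\<close> and \<open>\<beta> \<le> r2\<close>. As \<open>a\<close> has zero mean, so has this function.\<close>

lemma Omega_l_AE: "AE \<omega> in m. \<omega> \<in> Omega_l"
proof -
  obtain C where C: "C \<ge> 0" "\<And>\<omega>. \<bar>a \<omega>\<bar> \<le> C" using a_bound by blast
  obtain R where R: "R \<ge> 0" "\<And>\<omega> x. (\<omega>, x) \<in> A \<Longrightarrow> \<bar>x\<bar> \<le> R" using A_bound by blast
  obtain L where L: "L \<ge> 0" "\<And>\<omega> x y. \<bar>x\<bar> \<le> R \<Longrightarrow> \<bar>y\<bar> \<le> R \<Longrightarrow> \<bar>g \<omega> x - g \<omega> y\<bar> \<le> L * \<bar>x - y\<bar>"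
    using g_lipschitz by blast
  define u where "u \<omega> = ln (\<beta> \<omega> - \<alpha> \<omega>)" for \<omega>
  \<comment> \<open>Where the two bounds coincide the quotient is 0 by convention, which agrees with
    the bounds \<open>- L \<le> q\<close> and \<open>q \<le> 0\<close> proved below for all base
    points.\<close>
  define q where "q \<omega> = (g \<omega> (\<beta> \<omega>) - g \<omega> (\<alpha> \<omega>)) / (\<beta> \<omega> - \<alpha> \<omega>)" for \<omega>
  define G where "G \<omega> = I \<omega> 1 - (u (\<sigma> 1 \<omega>) - u \<omega>)" for \<omega>
  have du: "((\<lambda>t. u (\<sigma> t \<omega>) - I \<omega> t) has_real_derivative q (\<sigma> t \<omega>)) (at t)"
    if \<omega>: "\<omega> \<in> Omega_sup \<sigma> a" for \<omega> t
  proof -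
    have pos: "\<beta> (\<sigma> t \<omega>) - \<alpha> (\<sigma> t \<omega>) > 0"
      using \<alpha>_less_\<beta>[OF Omega_sup_invariant[OF cont_a no_primitive \<omega>, of t]] by simp
    let ?d = "\<lambda>x. a (\<sigma> t \<omega>) * x + b (\<sigma> t \<omega>) + g (\<sigma> t \<omega>) x"
    have "((\<lambda>t. u (\<sigma> t \<omega>) - I \<omega> t) has_real_derivative
        (?d (\<beta> (\<sigma> t \<omega>)) - ?d (\<alpha> (\<sigma> t \<omega>))) * inverse (\<beta> (\<sigma> t \<omega>) - \<alpha> (\<sigma> t \<omega>)) - a (\<sigma> t \<omega>)) (at t)"
      unfolding u_def using gsol_\<alpha>[of \<omega>] gsol_\<beta>[of \<omega>] pos unfolding gsol_def
      by (auto intro!: derivative_eq_intros cocycle_int_deriv[OF oc_a] simp: divide_inverse)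
    also have "(?d (\<beta> (\<sigma> t \<omega>)) - ?d (\<alpha> (\<sigma> t \<omega>))) * inverse (\<beta> (\<sigma> t \<omega>) - \<alpha> (\<sigma> t \<omega>)) - a (\<sigma> t \<omega>) = q (\<sigma> t \<omega>)"
      unfolding q_def using pos by (simp add: field_simps)
    finally show ?thesis .
  qed
  have q_le: "q \<omega> \<le> 0" for \<omega>
    unfolding q_def using g_antimono[OF \<alpha>_le_\<beta>, of \<omega> \<omega>] \<alpha>_le_\<beta>[of \<omega>] by (simp add: divide_nonpos_nonneg)
  have q_ge: "- L \<le> q \<omega>" for \<omega>
  proof (cases "\<alpha> \<omega> = \<beta> \<omega>")
    case False
    then have p: "\<beta> \<omega> - \<alpha> \<omega> > 0" using \<alpha>_le_\<beta>[of \<omega>] by simp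
    have "\<bar>g \<omega> (\<beta> \<omega>) - g \<omega> (\<alpha> \<omega>)\<bar> \<le> L * (\<beta> \<omega> - \<alpha> \<omega>)"
      using L(2)[OF R(2)[OF \<beta>_A] R(2)[OF \<alpha>_A], of \<omega> \<omega> \<omega>] p by simp
    then have "- L * (\<beta> \<omega> - \<alpha> \<omega>) \<le> g \<omega> (\<beta> \<omega>) - g \<omega> (\<alpha> \<omega>)" by linarith
    then show ?thesis unfolding q_def using p by (simp only: pos_le_divide_eq)
  qed (simp add: q_def L(1))
  have mvt: "\<exists>z>s. z < t \<and> (u (\<sigma> t \<omega>) - I \<omega> t) - (u (\<sigma> s \<omega>) - I \<omega> s) = (t - s) * q (\<sigma> z \<omega>)"
    if "\<omega> \<in> Omega_sup \<sigma> a" "s < t" for \<omega> s t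
    by (rule MVT2[OF that(2)]) (rule du[OF that(1)])
  have Gz: "\<exists>z>0. z < 1 \<and> G \<omega> = - q (\<sigma> z \<omega>)" if "\<omega> \<in> Omega_sup \<sigma> a" for \<omega>
    using mvt[OF that, of 0 1] by (auto simp: G_def)
  have am: "a \<in> borel_measurable borel" using cont_a by (rule borel_measurable_continuous_onI)
  have um: "u \<in> borel_measurable borel" unfolding u_def by measurable
  have um': "u \<in> borel_measurable m" using um by (simp add: measurable_m)
  have Im: "(\<lambda>\<omega>. I \<omega> 1) \<in> borel_measurable m" by (rule cocycle_int_measurable[OF am oc_a])
  have "AE \<omega> in m. G \<omega> = 0"
  proof (rule AE_zero_of_coboundary[OF um, where I = "\<lambda>\<omega>. I \<omega> 1" and C = C and K = L])
    show "G \<in> borel_measurable m" unfolding G_def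
      using Im um' flow_measurable_compose[OF um] by (intro borel_measurable_diff)
    show "AE \<omega> in m. 0 \<le> G \<omega>" using Omega_sup_AE
      by eventually_elim (use Gz q_le in \<open>metis neg_0_le_iff_le\<close>)
    show "AE \<omega> in m. G \<omega> \<le> L" using Omega_sup_AE
      by eventually_elim (use Gz q_ge in \<open>metis minus_le_iff\<close>)
    show "\<bar>I \<omega> 1\<bar> \<le> C" for \<omega> using cocycle_int_bound[OF oc_a C(2), of \<omega> 1] by simp
    show "(\<integral>\<omega>. I \<omega> 1 \<partial>m) = 0"
      using integral_cocycle_int[OF am oc_a C(2)] a_R by (simp add: R_class_def)
    show "AE \<omega> in m. u (\<sigma> 1 \<omega>) - u \<omega> = I \<omega> 1 - G \<omega>" by (simp add: G_def)
  qed (rule Im)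
  \<comment> \<open>The equation for \<open>G\<close> concerns a whole unit of time. Holding at all
    rational starting times, it covers every time by unit intervals containing it in their
    interior.\<close>
  from AE_flow[OF this] have "AE \<omega> in m. \<forall>r\<in>\<rat>. G (\<sigma> r \<omega>) = 0"
    by (simp add: AE_ball_countable[OF countable_rat])
  with Omega_sup_AE show ?thesis
  proof eventually_elim
    case (elim \<omega>)
    have "r1 \<le> \<alpha> (\<sigma> t \<omega>) \<and> \<beta> (\<sigma> t \<omega>) \<le> r2" for t
    proof -
      obtain r where r: "r \<in> \<rat>" "t - 1 < r" "r < t" using Rats_dense_in_real[of "t - 1" t] by auto
      define w where "w = \<sigma> r \<omega>"
      define s where "s = t - r"
      have s: "0 < s" "s < 1" using r by (auto simp: s_def)
      have w: "w \<in> Omega_sup \<sigma> a" unfolding w_def by (rule Omega_sup_invariant[OF cont_a no_primitive elim(1)])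
      have sw: "\<sigma> s w = \<sigma> t \<omega>" by (simp add: w_def s_def flip: flow_add)
      define h where "h t = u (\<sigma> t w) - I w t" for t
      have h01: "h 1 = h 0" using elim(2) r(1) by (simp add: G_def h_def w_def)
      have h_dec: "h t \<le> h s" if le: "s \<le> t" for s t
      proof (cases "s = t")
        case False
        then obtain z where "h t - h s = (t - s) * q (\<sigma> z w)" using mvt[OF w, of s t] le by (auto simp: h_def)
        moreover have "(t - s) * q (\<sigma> z w) \<le> 0" using q_le that by (simp add: mult_nonneg_nonpos)
        ultimately show ?thesis by simp
      qed simp
      \<comment> \<open>\<open>h\<close> is nonincreasing with equal values at 0 and 1, so it is
        constant between them and a negative derivative is impossible. The conclusion holds at every
        interior time, not only at almost every one.\<close>
      have "q (\<sigma> s w) = 0"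
      proof (rule ccontr)
        assume "q (\<sigma> s w) \<noteq> 0"
        then have "q (\<sigma> s w) < 0" using q_le[of "\<sigma> s w"] by simp
        moreover have "(h has_real_derivative q (\<sigma> s w)) (at s)" unfolding h_def by (rule du[OF w])
        ultimately obtain d where d: "d > 0" "\<And>k. 0 < k \<Longrightarrow> k < d \<Longrightarrow> h (s + k) < h s"
          using DERIV_neg_dec_right by blast
        define k where "k = min (d / 2) (1 - s)"
        have "0 < k" "k < d" "s + k \<le> 1" using d(1) s by (auto simp: k_def)
        then show False using d(2)[of k] h_dec[of "s + k" 1] h_dec[of 0 s] s h01 by simp
      qed
      moreover have ab: "\<alpha> (\<sigma> s w) < \<beta> (\<sigma> s w)"
        by (rule \<alpha>_less_\<beta>[OF Omega_sup_invariant[OF cont_a no_primitive w]])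
      ultimately have "g (\<sigma> s w) (\<beta> (\<sigma> s w)) = g (\<sigma> s w) (\<alpha> (\<sigma> s w))" by (simp add: q_def)
      then show ?thesis using g_strict_antimono[OF ab, of "\<sigma> s w"] unfolding sw by force
    qed
    then show ?case using elim(1) \<alpha>_le_\<beta> by (simp add: Omega_l_def)
  qed
qed

definition eta :: "real \<Rightarrow> 'w \<Rightarrow> real" where
  "eta c \<omega> = c * \<alpha> \<omega> + (1 - c) * \<beta> \<omega>"

lemma eta_A: "c \<in> {0..1} \<Longrightarrow> (\<omega>, eta c \<omega>) \<in> A"
proof -
  assume c: "c \<in> {0..1}"
  have "c * \<alpha> \<omega> \<le> c * \<beta> \<omega>" "(1 - c) * \<alpha> \<omega> \<le> (1 - c) * \<beta> \<omega>"
    using c \<alpha>_le_\<beta>[of \<omega>] by (auto intro: mult_left_mono)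
  then show ?thesis unfolding A_iff eta_def by (auto simp: algebra_simps)
qed

lemma gsol_eta:
  assumes \<omega>: "\<omega> \<in> Omega_l" and c: "c \<in> {0..1}"
  shows "gsol \<omega> (\<lambda>t. eta c (\<sigma> t \<omega>))"
  unfolding gsol_def
proof
  fix t
  let ?w = "\<sigma> t \<omega>"
  have r: "r1 \<le> \<alpha> ?w" "\<alpha> ?w \<le> \<beta> ?w" "\<beta> ?w \<le> r2" using \<omega> by (auto simp: Omega_l_def)
  then have "r1 \<le> eta c ?w" "eta c ?w \<le> r2" using eta_A[OF c, of ?w] by (auto simp: A_iff)
  then have z: "g ?w (\<alpha> ?w) = 0" "g ?w (\<beta> ?w) = 0" "g ?w (eta c ?w) = 0" using r by (auto intro!: g_zero)
  have "((\<lambda>t. eta c (\<sigma> t \<omega>)) has_real_derivative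
      c * (a ?w * \<alpha> ?w + b ?w + g ?w (\<alpha> ?w)) + (1 - c) * (a ?w * \<beta> ?w + b ?w + g ?w (\<beta> ?w))) (at t)"
    unfolding eta_def using gsol_\<alpha>[of \<omega>] gsol_\<beta>[of \<omega>] unfolding gsol_def
    by (intro DERIV_add DERIV_cmult) auto
  then show "((\<lambda>t. eta c (\<sigma> t \<omega>)) has_real_derivative
      a ?w * eta c ?w + b ?w + g ?w (eta c ?w)) (at t)"
    unfolding z by (simp add: eta_def algebra_simps)
qed

lemma \<tau>_eta:
  assumes "\<omega> \<in> Omega_l" "c \<in> {0..1}"
  shows "\<tau> t (\<omega>, eta c \<omega>) = (\<sigma> t \<omega>, eta c (\<sigma> t \<omega>))"
  using \<tau>_gsol[OF gsol_eta[OF assms], of t 0] by simp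

end

section \<open>Omega limit sets inside the attractor\<close>

context scalar_attractor
begin

lemma \<tau>_continuous_on_A: "continuous_on A (\<tau> t)"
  by (rule continuous_on_compose2[OF \<tau>_continuous_A, of A "\<lambda>y. (t, y)", simplified])
     (auto intro!: continuous_intros)

lemma omega_limit_invariant:
  assumes K: "compact K" "K \<subseteq> A" "\<And>t y. y \<in> K \<Longrightarrow> \<tau> t y \<in> K" and z: "z \<in> K"
  shows "omega_limit \<tau> z \<subseteq> K" "omega_limit \<tau> z \<noteq> {}" "closed (omega_limit \<tau> z)"
    "y \<in> omega_limit \<tau> z \<Longrightarrow> \<tau> s y \<in> omega_limit \<tau> z"
proof -
  show sub: "omega_limit \<tau> z \<subseteq> K"
  proof
    fix y assume "y \<in> omega_limit \<tau> z"
    then obtain t where "(\<lambda>n. \<tau> (t n) z) \<longlonglongrightarrow> y" unfolding omega_limit_def by blast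
    from closed_sequentially[OF compact_imp_closed[OF K(1)] K(3)[OF z] this] show "y \<in> K" .
  qed
  obtain l r where "strict_mono (r :: nat \<Rightarrow> nat)" "((\<lambda>n. \<tau> (real n) z) \<circ> r) \<longlonglongrightarrow> l"
    using seq_compactE[OF compact_imp_seq_compact[OF K(1)], of "\<lambda>n. \<tau> (real n) z"] K(3)[OF z] by blast
  then have lr: "strict_mono r" "(\<lambda>n. \<tau> (real (r n)) z) \<longlonglongrightarrow> l" by (simp_all add: comp_def)
  have "l \<in> omega_limit \<tau> z" unfolding omega_limit_def
  proof (intro CollectI exI[of _ "\<lambda>n. real (r n)"] conjI)
    show "incseq (\<lambda>n. real (r n))" using lr(1) by (simp add: incseq_def strict_mono_less_eq)
    show "filterlim (\<lambda>n. real (r n)) at_top sequentially"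
      by (rule filterlim_compose[OF filterlim_real_sequentially filterlim_subseq[OF lr(1)]])
  qed (rule lr(2))
  then show "omega_limit \<tau> z \<noteq> {}" by blast
  show "closed (omega_limit \<tau> z)"
  proof (unfold closed_limpt, intro allI impI)
    fix y assume y: "y islimpt omega_limit \<tau> z"
    show "y \<in> omega_limit \<tau> z" unfolding omega_limit_iff
    proof (intro allI impI)
      fix e N :: real assume e: "e > 0"
      then obtain y' where y': "y' \<in> omega_limit \<tau> z" "dist y' y < e / 2"
        using y unfolding islimpt_approachable by (meson half_gt_zero)
      have "\<exists>t\<ge>N. dist (\<tau> t z) y' < e / 2"
        using y'(1) half_gt_zero[OF e] unfolding omega_limit_iff by blast
      then obtain t where t: "t \<ge> N" "dist (\<tau> t z) y' < e / 2" by blast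
      then have "dist (\<tau> t z) y < e" using y'(2) dist_triangle[of "\<tau> t z" y y'] by linarith
      then show "\<exists>t\<ge>N. dist (\<tau> t z) y < e" using t(1) by blast
    qed
  qed
  show "\<tau> s y \<in> omega_limit \<tau> z" if y: "y \<in> omega_limit \<tau> z"
    unfolding omega_limit_iff
  proof (intro allI impI)
    fix e N :: real assume e: "e > 0"
    have yA: "y \<in> A" using y sub K(2) by blast
    have "\<exists>d>0. \<forall>x'\<in>A. dist x' y < d \<longrightarrow> dist (\<tau> s x') (\<tau> s y) < e"
      using \<tau>_continuous_on_A[of s] yA e unfolding continuous_on_iff by blast
    then obtain d where d: "d > 0" "\<forall>x'\<in>A. dist x' y < d \<longrightarrow> dist (\<tau> s x') (\<tau> s y) < e" by blast
    have "\<exists>t\<ge>N - s. dist (\<tau> t z) y < d" using y d(1) unfolding omega_limit_iff by blast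
    then obtain t where t: "t \<ge> N - s" "dist (\<tau> t z) y < d" by blast
    have "\<tau> (s + t) z = \<tau> s (\<tau> t z)" using z K(2) by (intro \<tau>_A_add) auto
    moreover have "dist (\<tau> s (\<tau> t z)) (\<tau> s y) < e" using d(2) t(2) K z by blast
    ultimately show "\<exists>t\<ge>N. dist (\<tau> t z) (\<tau> s y) < e" using t(1) by (intro exI[of _ "s + t"]) auto
  qed
qed

lemma minimal_set_omega_limit:
  assumes M: "minimal_set D \<tau> M" and z: "z \<in> M"
  shows "omega_limit \<tau> z = M"
proof -
  have Mp: "compact M" "invariant_set D \<tau> M" using M by (auto simp: minimal_set_def)
  have MA: "M \<subseteq> A" by (rule invariant_subset_A[OF Mp])
  have cl: "\<tau> t y \<in> M" if "y \<in> M" for t y using Mp(2) that unfolding invariant_set_def by blast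
  note o = omega_limit_invariant[OF Mp(1) MA cl z]
  have "compact (omega_limit \<tau> z)" using o(1,3) Mp(1) by (metis compact_Int_closed inf.absorb2)
  moreover have "invariant_set D \<tau> (omega_limit \<tau> z)"
    by (rule invariant_set_subset_A) (use o MA in auto)
  ultimately show ?thesis using M o(1,2) unfolding minimal_set_def by blast
qed

end

locale pinched_linear_zone_family = linear_zone_family +
  assumes pinch: "\<exists>\<omega> x. fiber A \<omega> = {x}"
begin

subsection \<open>The joint distribution of the two bounds of the attractor\<close>

text \<open>All measures of the theorem are images of the distribution of
  \<open>\<omega> \<mapsto> (\<omega>, \<alpha> \<omega>, \<beta> \<omega>)\<close>, which makes it possible to treat all \<open>c\<close> at once.\<close>

definition J :: "'a \<Rightarrow> 'a \<times> real \<times> real" where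
  "J \<omega> = (\<omega>, \<alpha> \<omega>, \<beta> \<omega>)"

definition proj :: "real \<Rightarrow> 'a \<times> real \<times> real \<Rightarrow> 'a \<times> real" where
  "proj c z = (fst z, c * fst (snd z) + (1 - c) * snd (snd z))"

definition nu :: "('a \<times> real \<times> real) measure" where
  "nu = distr m borel J"

definition Sig :: "('a \<times> real \<times> real) set" where
  "Sig = Supp nu"

definition mu :: "real \<Rightarrow> ('a \<times> real) measure" where
  "mu c = distr m borel (\<lambda>\<omega>. (\<omega>, eta c \<omega>))"

lemma proj_J: "proj c (J \<omega>) = (\<omega>, eta c \<omega>)"
  by (simp add: proj_def J_def eta_def)

lemma continuous_proj2: "continuous_on UNIV (\<lambda>(c, z). proj c z)"
  unfolding proj_def case_prod_beta by (intro continuous_intros)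

lemma continuous_proj: "continuous_on UNIV (proj c)"
  unfolding proj_def[abs_def] by (intro continuous_intros)

lemma J_measurable: "J \<in> borel_measurable m"
proof -
  have 1: "\<alpha> \<in> borel_measurable m" "\<beta> \<in> borel_measurable m" using \<alpha>_borel \<beta>_borel by (simp_all add: measurable_m)
  have 2: "(\<lambda>\<omega>. \<omega>) \<in> borel_measurable m" by (simp add: measurable_m)
  show ?thesis unfolding J_def[abs_def]
    by (rule borel_measurable_Pair_second_countable[OF 2 borel_measurable_Pair[OF 1]])
qed

lemma J_orbit: "continuous_on UNIV (\<lambda>t. J (\<sigma> t \<omega>))"
  unfolding J_def by (intro continuous_intros continuous_on_flow orbit_\<alpha> orbit_\<beta>)

lemma eta_measurable: "(\<lambda>\<omega>. (\<omega>, eta c \<omega>)) \<in> borel_measurable m"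
proof -
  have "proj c \<in> borel_measurable borel" by (rule borel_measurable_continuous_onI[OF continuous_proj])
  from measurable_compose[OF J_measurable this] show ?thesis by (simp add: proj_J)
qed

lemma sets_nu: "sets nu = sets borel"
  by (simp add: nu_def)

lemma prob_mu: "prob_space (mu c)" and sets_mu: "sets (mu c) = sets borel"
  unfolding mu_def by (auto intro: prob_space_distr eta_measurable)

lemma emeasure_nu: "B \<in> sets borel \<Longrightarrow> emeasure nu B = emeasure m {\<omega>. J \<omega> \<in> B}"
  unfolding nu_def by (simp add: emeasure_distr J_measurable vimage_def)

lemma emeasure_mu: "B \<in> sets borel \<Longrightarrow> emeasure (mu c) B = emeasure m {\<omega>. (\<omega>, eta c \<omega>) \<in> B}"
  unfolding mu_def by (simp add: emeasure_distr eta_measurable vimage_def)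

lemma mu_nu: "mu c = distr nu borel (proj c)"
proof -
  have "proj c \<in> borel_measurable borel" by (rule borel_measurable_continuous_onI[OF continuous_proj])
  from distr_distr[OF this J_measurable] show ?thesis
    by (simp add: mu_def nu_def proj_J comp_def)
qed

lemma nu_compact: "\<exists>K. compact K \<and> emeasure nu (- K) = 0"
proof -
  obtain R where R: "\<And>\<omega> x. (\<omega>, x) \<in> A \<Longrightarrow> \<bar>x\<bar> \<le> R" using A_bound by blast
  let ?K = "(UNIV :: 'a set) \<times> {- R..R} \<times> {- R..R}"
  have c: "compact ?K" by (intro compact_Times compact_UNIV compact_Icc)
  have "J \<omega> \<in> ?K" for \<omega> using R[OF \<alpha>_A, of \<omega>] R[OF \<beta>_A, of \<omega>] by (auto simp: J_def abs_le_iff)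
  then have "{\<omega>. J \<omega> \<in> - ?K} = {}" by blast
  moreover have "- ?K \<in> sets borel" using compact_imp_closed[OF c] by (intro borel_open open_Compl)
  ultimately have "emeasure nu (- ?K) = 0" by (simp only: emeasure_nu emeasure_empty)
  then show ?thesis using c by blast
qed

lemma Sig_null: "emeasure nu (- Sig) = 0"
  using nu_compact emeasure_Compl_Supp[OF sets_nu] unfolding Sig_def by blast

lemma closed_Sig: "closed Sig"
  unfolding Sig_def by (rule closed_Supp)

lemma compact_Sig: "compact Sig"
proof -
  obtain K where K: "compact K" "emeasure nu (- K) = 0" using nu_compact by blast
  then have "Sig \<subseteq> K" unfolding Sig_def by (intro Supp_subset_closed compact_imp_closed)
  then show ?thesis using K(1) closed_Sig by (metis compact_Int_closed inf.absorb2)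
qed

lemma AE_J_Sig: "AE \<omega> in m. J \<omega> \<in> Sig"
proof -
  have b: "- Sig \<in> sets borel" using closed_Sig by auto
  then have "{\<omega>. J \<omega> \<in> - Sig} \<in> sets m"
    using measurable_sets[OF J_measurable b] by (simp add: vimage_def)
  moreover have "emeasure m {\<omega>. J \<omega> \<in> - Sig} = 0" using Sig_null emeasure_nu[OF b] by simp
  ultimately have "AE \<omega> in m. \<omega> \<notin> {\<omega>. J \<omega> \<in> - Sig}" by (intro AE_not_in) (simp add: null_sets_def)
  then show ?thesis by simp
qed

text \<open>All supports are images of one compact set that does not depend on \<open>c\<close>,
  under a map jointly continuous in \<open>c\<close>. Density in \<open>Sig\<close> thus descends to
  all of them simultaneously.\<close>

lemma Supp_mu: "Supp (mu c) = proj c ` Sig"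
  unfolding mu_nu Sig_def using nu_compact Supp_distr[OF sets_nu _ _ continuous_proj] by blast

lemma emeasure_J_pos:
  assumes "z \<in> Sig" "open U" "z \<in> U"
  shows "emeasure m {\<omega>. J \<omega> \<in> U} \<noteq> 0"
  using assms emeasure_nu[of U] by (auto simp: Sig_def Supp_def)

text \<open>Finite nets of \<open>Sig\<close> of mesh \<open>inverse (real (Suc n))\<close>. Only
  countably many balls occur, so almost every base point can be asked to visit all of them.\<close>

definition net :: "nat \<Rightarrow> ('a \<times> real \<times> real) set" where
  "net n = (SOME F. finite F \<and> F \<subseteq> Sig \<and> Sig \<subseteq> (\<Union>y\<in>F. ball y (inverse (real (Suc n)))))"

lemma net: "finite (net n)" "net n \<subseteq> Sig" "Sig \<subseteq> (\<Union>y\<in>net n. ball y (inverse (real (Suc n))))"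
proof -
  have "\<exists>F. finite F \<and> F \<subseteq> Sig \<and> Sig \<subseteq> (\<Union>y\<in>F. ball y (inverse (real (Suc n))))"
  proof -
    have "Sig \<subseteq> (\<Union>y\<in>Sig. ball y (inverse (real (Suc n))))" by force
    from compactE_image[OF compact_Sig _ this] show ?thesis by (metis open_ball)
  qed
  from someI_ex[OF this] show "finite (net n)" "net n \<subseteq> Sig" "Sig \<subseteq> (\<Union>y\<in>net n. ball y (inverse (real (Suc n))))"
    unfolding net_def by blast+
qed

definition rec_set :: "('a \<times> real \<times> real) \<Rightarrow> nat \<Rightarrow> 'a set" where
  "rec_set y n = {\<omega>. \<forall>N. \<exists>t\<ge>N. J (\<sigma> t \<omega>) \<in> ball y (inverse (real (Suc n)))}"

text \<open>The orbit under \<open>J\<close> stays in \<open>Sig\<close> and visits every net ball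
  at arbitrarily late times; no condition refers to \<open>c\<close>.\<close>

definition Omega_AY :: "'a set" where
  "Omega_AY = {\<omega> \<in> Omega_l. \<forall>t. J (\<sigma> t \<omega>) \<in> Sig} \<inter> (\<Inter>n. \<Inter>y\<in>net n. rec_set y n)"

lemma Omega_AY_subset: "Omega_AY \<subseteq> Omega_l"
  by (auto simp: Omega_AY_def)

lemma rec_set:
  assumes "y \<in> net n"
  shows "rec_set y n \<in> sets borel" "AE \<omega> in m. \<omega> \<in> rec_set y n"
proof -
  have "y \<in> Sig" using assms net(2) by blast
  then have p: "emeasure m {\<omega>. J \<omega> \<in> ball y (inverse (real (Suc n)))} \<noteq> 0"
    by (rule emeasure_J_pos) auto
  note r = AE_recurrent[OF J_measurable J_orbit open_ball p]
  show "rec_set y n \<in> sets borel" unfolding rec_set_def by (rule r(1))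
  show "AE \<omega> in m. \<omega> \<in> rec_set y n" unfolding rec_set_def using r(2) by simp
qed

lemma J_flow_borel: "closed C \<Longrightarrow> {\<omega>. J (\<sigma> t \<omega>) \<in> C} \<in> sets borel"
proof -
  assume C: "closed C"
  have "J \<in> borel_measurable borel" using J_measurable by (simp add: measurable_m)
  from measurable_sets[OF flow_measurable_compose[OF this, of t], of C] C show ?thesis
    by (simp add: vimage_def sets_m)
qed

lemma J_Sig_eq: "{\<omega>. \<forall>t. J (\<sigma> t \<omega>) \<in> Sig} = (\<Inter>q\<in>\<rat>. {\<omega>. J (\<sigma> q \<omega>) \<in> Sig})"
  using all_iff_all_Rats[OF J_orbit closed_Sig] by auto

lemma AE_orbit_Sig: "AE \<omega> in m. \<forall>t. J (\<sigma> t \<omega>) \<in> Sig"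
proof -
  from AE_flow[OF AE_J_Sig] have "AE \<omega> in m. \<forall>q\<in>\<rat>. J (\<sigma> q \<omega>) \<in> Sig"
    by (simp add: AE_ball_countable[OF countable_rat])
  then show ?thesis using all_iff_all_Rats[OF J_orbit closed_Sig] by simp
qed

lemma Omega_AY_borel: "Omega_AY \<in> sets borel"
proof -
  have 1: "{\<omega>. \<forall>t. J (\<sigma> t \<omega>) \<in> Sig} \<in> sets borel"
  proof -
    have "Rats \<noteq> ({} :: real set)" using Rats_0 by blast
    then show ?thesis unfolding J_Sig_eq
      using J_flow_borel[OF closed_Sig] by (intro sets.countable_INT' countable_rat) auto
  qed
  have 2: "(\<Inter>y\<in>net n. rec_set y n) \<in> sets borel" for n
  proof (cases "net n = {}")
    case False
    then show ?thesis using net(1)[of n] rec_set(1)[of _ n] by (intro sets.finite_INT) auto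
  qed simp
  have "(\<Inter>n. \<Inter>y\<in>net n. rec_set y n) \<in> sets borel"
    using 2 by (intro sets.countable_INT) auto
  moreover have "Omega_AY = Omega_l \<inter> {\<omega>. \<forall>t. J (\<sigma> t \<omega>) \<in> Sig} \<inter> (\<Inter>n. \<Inter>y\<in>net n. rec_set y n)"
    by (auto simp: Omega_AY_def)
  ultimately show ?thesis using 1 Omega_l_borel by simp
qed

lemma Omega_AY_AE: "AE \<omega> in m. \<omega> \<in> Omega_AY"
proof -
  have "AE \<omega> in m. \<forall>y\<in>net n. \<omega> \<in> rec_set y n" for n
    by (subst AE_ball_countable[OF countable_finite[OF net(1)]]) (use rec_set(2) in blast)
  then have "AE \<omega> in m. \<forall>n. \<forall>y\<in>net n. \<omega> \<in> rec_set y n" by (simp add: AE_all_countable)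
  with AE_orbit_Sig Omega_l_AE show ?thesis
    by eventually_elim (simp add: Omega_AY_def)
qed

lemma Omega_AY_invariant:
  assumes \<omega>: "\<omega> \<in> Omega_AY"
  shows "\<sigma> s \<omega> \<in> Omega_AY"
proof -
  have "\<sigma> s \<omega> \<in> rec_set y n" if "y \<in> net n" for y n
    unfolding rec_set_def
  proof (intro CollectI allI)
    fix N
    have "\<omega> \<in> rec_set y n" using \<omega> that by (simp add: Omega_AY_def)
    then obtain t where "t \<ge> N + s" "J (\<sigma> t \<omega>) \<in> ball y (inverse (real (Suc n)))"
      unfolding rec_set_def by blast
    then show "\<exists>t\<ge>N. J (\<sigma> t (\<sigma> s \<omega>)) \<in> ball y (inverse (real (Suc n)))"
      by (intro exI[of _ "t - s"]) (simp flip: flow_add)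
  qed
  then show ?thesis using \<omega> Omega_l_invariant[of \<omega> s]
    by (simp add: Omega_AY_def flip: flow_add)
qed

lemma Omega_AY_nonempty: "\<exists>\<omega>. \<omega> \<in> Omega_AY"
proof (rule ccontr)
  assume "\<nexists>\<omega>. \<omega> \<in> Omega_AY"
  then have "emeasure m {} = 1" using emeasure_eq_1[OF Omega_AY_borel Omega_AY_AE] by (metis equals0I)
  then show False by simp
qed

lemma Omega_AY_visits:
  assumes \<omega>: "\<omega> \<in> Omega_AY" and z: "z \<in> Sig" and e: "e > 0"
  shows "\<exists>t\<ge>N. dist (J (\<sigma> t \<omega>)) z < e"
proof -
  obtain n where n: "inverse (real (Suc n)) < e / 2" using reals_Archimedean[of "e / 2"] e by auto
  obtain y where y: "y \<in> net n" "z \<in> ball y (inverse (real (Suc n)))" using net(3)[of n] z by blast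
  have "\<omega> \<in> rec_set y n" using \<omega> y(1) by (simp add: Omega_AY_def)
  then obtain t where t: "t \<ge> N" "J (\<sigma> t \<omega>) \<in> ball y (inverse (real (Suc n)))"
    unfolding rec_set_def by blast
  have "dist (J (\<sigma> t \<omega>)) z < e"
    using dist_triangle[of "J (\<sigma> t \<omega>)" z y] t(2) y(2) n by (simp add: dist_commute)
  then show ?thesis using t(1) by blast
qed

lemma Omega_AY_Sig: "\<omega> \<in> Omega_AY \<Longrightarrow> J (\<sigma> t \<omega>) \<in> Sig"
  by (simp add: Omega_AY_def)

section \<open>The supports: transitivity, pinching, sensitivity\<close>

abbreviation "S c \<equiv> Supp (mu c)"

lemma eta_in_S: "\<omega> \<in> Omega_AY \<Longrightarrow> (\<omega>, eta c \<omega>) \<in> S c"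
  using Omega_AY_Sig[of \<omega> 0] by (simp add: Supp_mu flip: proj_J)

lemma compact_S: "compact (S c)"
  unfolding Supp_mu using compact_Sig continuous_proj
  by (intro compact_continuous_image) (auto intro: continuous_on_subset)

lemma mu_A: "c \<in> {0..1} \<Longrightarrow> emeasure (mu c) (- A) = 0"
  using compact_imp_closed[OF compact_A] eta_A by (subst emeasure_mu) auto

lemma S_subset_A: "c \<in> {0..1} \<Longrightarrow> S c \<subseteq> A"
  by (intro Supp_subset_closed compact_imp_closed compact_A mu_A)

text \<open>Over \<open>Omega_AY\<close> the orbit in question is the image under
  \<open>proj c\<close> of the orbit of \<open>J\<close>. Late visits of the latter near every point
  of \<open>Sig\<close> project to late visits near every point of the support; closedness gives the
  other inclusion.\<close>

lemma S_omega_limit: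
  assumes \<omega>: "\<omega> \<in> Omega_AY" and c: "c \<in> {0..1}"
  shows "S c = omega_limit \<tau> (\<omega>, eta c \<omega>)"
proof -
  have \<tau>J: "\<tau> t (\<omega>, eta c \<omega>) = proj c (J (\<sigma> t \<omega>))" for t
    using \<tau>_eta[of \<omega> c t] \<omega> Omega_AY_subset c by (auto simp: proj_J)
  show ?thesis
  proof (intro set_eqI iffI)
    fix y assume "y \<in> S c"
    then obtain z where z: "z \<in> Sig" "y = proj c z" unfolding Supp_mu by blast
    show "y \<in> omega_limit \<tau> (\<omega>, eta c \<omega>)"
      unfolding omega_limit_iff \<tau>J
    proof (intro allI impI)
      fix e N :: real assume e: "e > 0"
      have "\<exists>d>0. \<forall>x'\<in>UNIV. dist x' z < d \<longrightarrow> dist (proj c x') (proj c z) < e"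
        using continuous_proj[of c, unfolded continuous_on_iff] e by blast
      then obtain d where d: "d > 0" "\<And>x'. dist x' z < d \<Longrightarrow> dist (proj c x') (proj c z) < e" by blast
      from Omega_AY_visits[OF \<omega> z(1) d(1), of N] d(2) z(2)
      show "\<exists>t\<ge>N. dist (proj c (J (\<sigma> t \<omega>))) y < e" by blast
    qed
  next
    fix y assume "y \<in> omega_limit \<tau> (\<omega>, eta c \<omega>)"
    then obtain t where lim: "(\<lambda>n. proj c (J (\<sigma> (t n) \<omega>))) \<longlonglongrightarrow> y" unfolding omega_limit_def \<tau>J by blast
    have in_S: "proj c (J (\<sigma> (t n) \<omega>)) \<in> S c" for n
      unfolding Supp_mu using Omega_AY_Sig[OF \<omega>] by blast
    from closed_sequentially[OF compact_imp_closed[OF compact_S] in_S lim] show "y \<in> S c" .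
  qed
qed

lemma S_closed_under_flow:
  assumes c: "c \<in> {0..1}" and y: "y \<in> S c"
  shows "\<tau> t y \<in> S c"
proof -
  obtain \<omega> where \<omega>: "\<omega> \<in> Omega_AY" using Omega_AY_nonempty by blast
  note S = S_omega_limit[OF \<omega> c]
  have "(\<omega>, eta c \<omega>) \<in> A" by (rule eta_A[OF c])
  then show ?thesis using y omega_limit_invariant(4)[OF compact_A subset_refl \<tau>_A_closed]
    unfolding S by blast
qed

lemma S_invariant: "c \<in> {0..1} \<Longrightarrow> invariant_set D \<tau> (S c)"
  by (rule invariant_set_subset_A) (auto simp: S_subset_A S_closed_under_flow)

lemma S_flow: "c \<in> {0..1} \<Longrightarrow> continuous_flow_on (S c) \<tau>"
  by (rule continuous_flow_on_subset_A) (auto simp: S_subset_A S_closed_under_flow)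

lemma S_nonempty: "S c \<noteq> {}"
  using Omega_AY_nonempty eta_in_S by blast

lemma S_transitive_flow:
  assumes "\<omega> \<in> Omega_AY" "c \<in> {0..1}"
  shows "compact_transitive_flow (S c) \<tau> (\<omega>, eta c \<omega>)"
  by (intro compact_transitive_flow.intro S_flow compact_S eta_in_S S_omega_limit assms)

lemma S_transitive: "c \<in> {0..1} \<Longrightarrow> transitive_on (S c) \<tau>"
  using Omega_AY_nonempty S_transitive_flow compact_transitive_flow.transitive by blast

lemma fiber_nonempty:
  assumes "compact K" "K \<noteq> {}" "invariant_set D \<tau> K"
  shows "\<exists>x. (\<omega>, x) \<in> K"
  using projection_UNIV[OF assms] by (metis UNIV_I imageE prod.collapse)

lemma fiber_singleton_subset:
  assumes f: "fiber A \<omega> = {x}" and K: "K \<subseteq> A" and y: "(\<omega>, y) \<in> K"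
  shows "y = x" "fiber K \<omega> = {x}"
proof -
  have *: "z = x" if "(\<omega>, z) \<in> K" for z
  proof -
    have "z \<in> fiber A \<omega>" using that K by (auto simp: fiber_def)
    then show ?thesis using f by simp
  qed
  then show "y = x" using y .
  then show "fiber K \<omega> = {x}" using * y by (auto simp: fiber_def)
qed

lemma S_pinched:
  assumes c: "c \<in> {0..1}"
  shows "pinched D \<tau> (S c)"
proof -
  obtain \<omega> x where f: "fiber A \<omega> = {x}" using pinch by blast
  obtain x' where "(\<omega>, x') \<in> S c" using fiber_nonempty[OF compact_S S_nonempty S_invariant[OF c]] by blast
  then have "fiber (S c) \<omega> = {x}" by (rule fiber_singleton_subset[OF f S_subset_A[OF c]])
  then show ?thesis using compact_S S_invariant[OF c] unfolding pinched_def by blast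
qed

text \<open>Over the base point with a singleton fibre, \<open>K\<close> and \<open>M\<close> must
  have the same point. Its omega limit set is \<open>M\<close> by minimality and stays in
  \<open>K\<close> by invariance.\<close>

lemma M_subset:
  assumes K: "compact K" "K \<noteq> {}" "invariant_set D \<tau> K"
  shows "M \<subseteq> K"
proof -
  obtain \<omega> x where f: "fiber A \<omega> = {x}" using pinch by blast
  have KA: "K \<subseteq> A" by (rule invariant_subset_A[OF K(1,3)])
  obtain x' where x': "(\<omega>, x') \<in> K" using fiber_nonempty[OF K] by blast
  obtain x'' where x'': "(\<omega>, x'') \<in> M" using fiber_nonempty[OF M_props] by blast
  have "x' = x''"
    using fiber_singleton_subset(1)[OF f KA x'] fiber_singleton_subset(1)[OF f M_subset_A x''] by simp
  then have i: "(\<omega>, x') \<in> K" "(\<omega>, x') \<in> M" using x' x'' by auto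
  have cl: "\<tau> t y \<in> K" if "y \<in> K" for t y using K(3) that unfolding invariant_set_def by blast
  from omega_limit_invariant(1)[OF K(1) KA cl i(1)] show ?thesis
    unfolding minimal_set_omega_limit[OF M_minimal i(2)] .
qed

lemma S_returns:
  assumes c: "c \<in> {0..1}" and U: "open U" "U \<inter> S c \<noteq> {}"
  shows "\<exists>L\<ge>0. \<forall>T\<ge>0. \<exists>s\<in>{T..T + L}. \<exists>u\<in>U \<inter> S c. \<tau> s u \<in> U"
proof -
  \<comment> \<open>Intersecting with \<open>Omega_AY\<close> keeps the measure and ensures that the
    graph points over \<open>W\<close> belong to the support and move along the graph of
    \<open>eta c\<close>.\<close>
  define W where "W = {\<omega>. (\<omega>, eta c \<omega>) \<in> U} \<inter> Omega_AY"
  have b: "{\<omega>. (\<omega>, eta c \<omega>) \<in> U} \<in> sets borel"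
    using measurable_sets[OF eta_measurable, of U c] U(1) by (simp add: vimage_def sets_m)
  then have W: "W \<in> sets borel" unfolding W_def using Omega_AY_borel by simp
  have "emeasure (mu c) U \<noteq> 0" using U unfolding Supp_def by auto
  then have "emeasure m {\<omega>. (\<omega>, eta c \<omega>) \<in> U} \<noteq> 0" using U(1) by (simp add: emeasure_mu)
  moreover have "emeasure m {\<omega>. (\<omega>, eta c \<omega>) \<in> U} = emeasure m W"
    by (rule emeasure_eq_AE) (use Omega_AY_AE b W in \<open>auto simp: W_def sets_m\<close>)
  ultimately obtain L where L: "L \<ge> 0" "\<And>T. T \<ge> 0 \<Longrightarrow> \<exists>s\<in>{T..T + L}. \<exists>\<omega>\<in>W. \<sigma> s \<omega> \<in> W"
    using syndetic_returns[OF W] by auto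
  have "\<exists>s\<in>{T..T + L}. \<exists>u\<in>U \<inter> S c. \<tau> s u \<in> U" if T: "T \<ge> 0" for T
  proof -
    obtain s \<omega> where s: "s \<in> {T..T + L}" "\<omega> \<in> W" "\<sigma> s \<omega> \<in> W" using L(2)[OF T] by blast
    have "\<tau> s (\<omega>, eta c \<omega>) = (\<sigma> s \<omega>, eta c (\<sigma> s \<omega>))"
      by (rule \<tau>_eta[OF _ c]) (use s(2) Omega_AY_subset in \<open>auto simp: W_def\<close>)
    then have "\<tau> s (\<omega>, eta c \<omega>) \<in> U" using s(3) by (simp add: W_def)
    moreover have "(\<omega>, eta c \<omega>) \<in> U \<inter> S c" using s(2) eta_in_S by (simp add: W_def)
    ultimately show ?thesis using s(1) by blast
  qed
  then show ?thesis using L(1) by blast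
qed

text \<open>A function with compact graph is continuous, since preimages of closed rays are
  projections of compact sets.\<close>

lemma copy_of_base_if_fibers_trivial:
  assumes u: "\<And>\<omega> x y. (\<omega>, x) \<in> M \<Longrightarrow> (\<omega>, y) \<in> M \<Longrightarrow> x = y"
  shows "copy_of_base \<sigma> D \<tau> M"
proof -
  have "\<forall>\<omega>. \<exists>x. (\<omega>, x) \<in> M" using fiber_nonempty[OF M_props] by blast
  then obtain e where e: "\<And>\<omega>. (\<omega>, e \<omega>) \<in> M" by metis
  have Me: "M = range (\<lambda>\<omega>. (\<omega>, e \<omega>))" using e u by (auto simp: image_iff)
  have "closed {\<omega>. e \<omega> \<in> C}" if "closed C" for C
  proof -
    have "compact (M \<inter> UNIV \<times> C)" using that by (intro compact_Int_closed M_props closed_Times) auto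
    then have "closed (fst ` (M \<inter> UNIV \<times> C))"
      by (intro compact_imp_closed compact_continuous_image continuous_intros)
    also have "fst ` (M \<inter> UNIV \<times> C) = {\<omega>. e \<omega> \<in> C}" unfolding Me by force
    finally show ?thesis .
  qed
  from this[of "{.._}"] this[of "{_..}"] have "continuous_on UNIV e"
    by (intro continuous_on_if_rays_closed) auto
  moreover have "equilibrium \<sigma> D \<tau> e"
    unfolding equilibrium_def
  proof (intro allI conjI)
    fix \<omega> t
    show "D (\<omega>, e \<omega>) = UNIV" using e M_subset_A D_A by blast
    have "(\<sigma> t \<omega>, sol \<sigma> (\<lambda>\<omega> x. a \<omega> * x + b \<omega> + g \<omega> x) t \<omega> (e \<omega>)) \<in> M" by (rule invariant_setD(3)[OF M_props(3) e])
    then show "\<tau> t (\<omega>, e \<omega>) = (\<sigma> t \<omega>, e (\<sigma> t \<omega>))" using u[OF _ e] by (simp add: \<tau>_Pair)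
  qed
  ultimately show ?thesis using Me unfolding copy_of_base_def by blast
qed

lemma S_sensitive:
  assumes c: "c \<in> {0..1}" and h: "M \<noteq> S c \<or> \<not> copy_of_base \<sigma> D \<tau> M"
  shows "sensitive_on sum_dist (S c) \<tau>"
proof (rule ccontr)
  assume ns: "\<not> sensitive_on sum_dist (S c) \<tau>"
  have non: "\<exists>y\<in>S c. \<exists>d>0. \<forall>y'\<in>S c. dist y y' < d \<longrightarrow> (\<forall>t\<ge>0. dist (\<tau> t y) (\<tau> t y') \<le> e)"
    if "e > 0" for e
    by (rule not_sensitive_onD[OF ns that]) blast
  obtain \<omega> where \<omega>: "\<omega> \<in> Omega_AY" using Omega_AY_nonempty by blast
  interpret T: compact_transitive_flow "S c" \<tau> "(\<omega>, eta c \<omega>)" by (rule S_transitive_flow[OF \<omega> c])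
  have MS: "M \<subseteq> S c" by (rule M_subset[OF compact_S S_nonempty S_invariant[OF c]])
  have Mcl: "\<tau> t y \<in> M" if "y \<in> M" for t y using M_props(3) that unfolding invariant_set_def by blast
  have "S c \<subseteq> M"
    by (rule T.nonsensitive_subset[OF non MS M_props(2) compact_imp_closed[OF M_props(1)] Mcl S_returns[OF c]])
  then have eq: "S c = M" using MS by blast
  then have ncopy: "\<not> copy_of_base \<sigma> D \<tau> M" using h by blast
  \<comment> \<open>Every orbit in the minimal set is dense, so the one through the singleton fibre
    can serve as the transitive orbit when insensitivity is used a second time.\<close>
  obtain \<omega>0 x0 where f: "fiber A \<omega>0 = {x0}" using pinch by blast
  obtain x' where x': "(\<omega>0, x') \<in> M" using fiber_nonempty[OF M_props] by blast
  then have x0: "(\<omega>0, x0) \<in> M" "fiber M \<omega>0 = {x0}"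
    using fiber_singleton_subset[OF f M_subset_A x'] by simp_all
  have tr: "compact_transitive_flow M \<tau> (\<omega>0, x0)"
    using S_flow[OF c] minimal_set_omega_limit[OF M_minimal x0(1)] unfolding eq
    by (intro compact_transitive_flow.intro M_props x0) auto
  have "copy_of_base \<sigma> D \<tau> M"
    by (rule copy_of_base_if_fibers_trivial,
        rule nonsensitive_fibers_trivial[OF tr fst_\<tau> x0(2) non[unfolded eq]])
  then show False using ncopy by blast
qed

lemma eta_inj:
  assumes "\<omega> \<in> Omega_l" "eta c \<omega> = eta d \<omega>"
  shows "c = d"
proof -
  have "\<alpha> \<omega> < \<beta> \<omega>" using assms(1) by (intro \<alpha>_less_\<beta>) (simp add: Omega_l_def)
  moreover have "(c - d) * (\<alpha> \<omega> - \<beta> \<omega>) = 0" using assms(2) by (simp add: eta_def algebra_simps)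
  ultimately show ?thesis by simp
qed

lemma eta_onto:
  assumes \<omega>: "\<omega> \<in> Omega_l" and x: "(\<omega>, x) \<in> A"
  shows "\<exists>c\<in>{0..1}. x = eta c \<omega>"
proof -
  have lt: "\<alpha> \<omega> < \<beta> \<omega>" using \<omega> by (intro \<alpha>_less_\<beta>) (simp add: Omega_l_def)
  have x': "\<alpha> \<omega> \<le> x" "x \<le> \<beta> \<omega>" using x by (auto simp: A_iff)
  define c where "c = (\<beta> \<omega> - x) / (\<beta> \<omega> - \<alpha> \<omega>)"
  have "c * (\<beta> \<omega> - \<alpha> \<omega>) = \<beta> \<omega> - x" using lt by (simp add: c_def)
  moreover have "eta c \<omega> = \<beta> \<omega> - c * (\<beta> \<omega> - \<alpha> \<omega>)" by (simp add: eta_def algebra_simps)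
  ultimately have "x = eta c \<omega>" by simp
  moreover have "c \<in> {0..1}" using lt x' by (simp add: c_def)
  ultimately show ?thesis by blast
qed

text \<open>Over a point of \<open>Omega_AY\<close> the value of the equilibrium is a convex
  combination of the two bounds with some weight \<open>c0\<close>, and \<open>M\<close> and
  \<open>S c0\<close> are both the omega limit set of that one point. The bounds differ there, which
  makes the weight unique.\<close>

lemma copy_of_base_S:
  assumes "copy_of_base \<sigma> D \<tau> M"
  shows "\<exists>c0\<in>{0..1}. \<forall>c\<in>{0..1}. M = S c \<longleftrightarrow> c = c0"
proof -
  obtain e where M: "M = range (\<lambda>\<omega>. (\<omega>, e \<omega>))" using assms unfolding copy_of_base_def by blast
  obtain \<omega> where \<omega>: "\<omega> \<in> Omega_AY" using Omega_AY_nonempty by blast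
  have \<omega>l: "\<omega> \<in> Omega_l" using \<omega> Omega_AY_subset by blast
  have eM: "(\<omega>, e \<omega>) \<in> M" using M by blast
  obtain c0 where c0: "c0 \<in> {0..1}" "e \<omega> = eta c0 \<omega>" using eta_onto[OF \<omega>l] eM M_subset_A by blast
  have "S c0 = M"
    using S_omega_limit[OF \<omega> c0(1)] minimal_set_omega_limit[OF M_minimal eM] c0(2) by simp
  moreover have "c = c0" if "M = S c" for c
  proof -
    have "(\<omega>, eta c \<omega>) \<in> M" using eta_in_S[OF \<omega>] that by simp
    then have "eta c \<omega> = eta c0 \<omega>" using M c0(2) by auto
    then show ?thesis by (rule eta_inj[OF \<omega>l])
  qed
  ultimately show ?thesis using c0(1) by blast
qed

end

section \<open>Time averages and approximate limits\<close>

definition time_average :: "(real \<Rightarrow> real) \<Rightarrow> real \<Rightarrow> real" where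
  "time_average k t = 1 / t * (LBINT s=0..t. k s)"

text \<open>A Cauchy criterion along a filter: two approximate limits are compared at a common
  argument, so the approximate limits themselves form a Cauchy sequence.\<close>

lemma tendsto_of_approximate_limits:
  fixes f :: "'b \<Rightarrow> real"
  assumes F: "F \<noteq> bot" and h: "\<And>e. e > 0 \<Longrightarrow> \<exists>l. \<forall>\<^sub>F x in F. \<bar>f x - l\<bar> < e"
  shows "\<exists>L. (f \<longlongrightarrow> L) F"
proof -
  have "\<exists>l. \<forall>\<^sub>F x in F. \<bar>f x - l\<bar> < inverse (real (Suc n))" for n by (rule h) simp
  then obtain l where l: "\<And>n. \<forall>\<^sub>F x in F. \<bar>f x - l n\<bar> < inverse (real (Suc n))" by metis
  have d: "\<bar>l j - l k\<bar> < inverse (real (Suc j)) + inverse (real (Suc k))" for j k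
  proof -
    have "\<forall>\<^sub>F x in F. \<bar>l j - l k\<bar> < inverse (real (Suc j)) + inverse (real (Suc k))"
      using l[of j] l[of k] by eventually_elim linarith
    from eventually_happens'[OF F this] show ?thesis by blast
  qed
  have "Cauchy l"
  proof (rule metric_CauchyI)
    fix e :: real assume "e > 0"
    then obtain N where N: "inverse (real (Suc N)) < e / 2" using reals_Archimedean[of "e / 2"] by auto
    have i: "inverse (real (Suc j)) < e / 2" if "j \<ge> N" for j
    proof -
      have "inverse (real (Suc j)) \<le> inverse (real (Suc N))" using that by (intro le_imp_inverse_le) auto
      then show ?thesis using N by linarith
    qed
    have "dist (l j) (l k) < e" if "j \<ge> N" "k \<ge> N" for j k
      using d[of j k] i[OF that(1)] i[OF that(2)] by (simp add: dist_real_def)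
    then show "\<exists>N. \<forall>j\<ge>N. \<forall>k\<ge>N. dist (l j) (l k) < e" by blast
  qed
  then obtain L where L: "l \<longlonglongrightarrow> L" using Cauchy_convergent convergent_def by blast
  have "(f \<longlongrightarrow> L) F"
  proof (rule tendstoI)
    fix e :: real assume e: "e > 0"
    then have "\<forall>\<^sub>F n in sequentially. dist (l n) L < e / 2" by (intro tendstoD[OF L]) simp
    moreover have "\<forall>\<^sub>F n in sequentially. inverse (real (Suc n)) < e / 2"
      using LIMSEQ_inverse_real_of_nat e by (intro order_tendstoD(2)) auto
    ultimately have "\<forall>\<^sub>F n in sequentially. dist (l n) L < e / 2 \<and> inverse (real (Suc n)) < e / 2"
      by eventually_elim auto
    then obtain n where n: "dist (l n) L < e / 2" "inverse (real (Suc n)) < e / 2"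
      using eventually_happens'[OF sequentially_bot] by blast
    show "\<forall>\<^sub>F x in F. dist (f x) L < e"
      using l[of n] by eventually_elim (use n in \<open>unfold dist_real_def, linarith\<close>)
  qed
  then show ?thesis by blast
qed

context pinched_linear_zone_family
begin

subsection \<open>The invariant measures\<close>

lemma \<tau>_image:
  assumes B: "B \<in> sets borel" "B \<subseteq> A"
  shows "\<tau> t ` B = {y \<in> A. \<tau> (- t) y \<in> B}" "\<tau> t ` B \<in> sets borel"
proof -
  show eq: "\<tau> t ` B = {y \<in> A. \<tau> (- t) y \<in> B}"
  proof (intro set_eqI iffI)
    fix y assume "y \<in> \<tau> t ` B"
    then obtain z where z: "z \<in> B" "y = \<tau> t z" by blast
    then have "\<tau> (- t) y = z" using \<tau>_A_add[of z "- t" t] \<tau>_A_0[of z] B(2) by auto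
    then show "y \<in> {y \<in> A. \<tau> (- t) y \<in> B}" using z B(2) \<tau>_A_closed[of z t] by auto
  next
    fix y assume "y \<in> {y \<in> A. \<tau> (- t) y \<in> B}"
    then have y: "y \<in> A" "\<tau> (- t) y \<in> B" by auto
    then have "y = \<tau> t (\<tau> (- t) y)" using \<tau>_A_add[of y t "- t"] \<tau>_A_0[of y] by simp
    then show "y \<in> \<tau> t ` B" using y(2) by (rule image_eqI)
  qed
  have A: "A \<in> sets borel" using compact_imp_closed[OF compact_A] by simp
  \<comment> \<open>Continuity of the flow map is known on \<open>A\<close>; extending it by the
    identity gives a Borel map of the whole space.\<close>
  have "(\<lambda>y. if y \<in> A then \<tau> (- t) y else y) \<in> borel_measurable borel"
    by (rule borel_measurable_continuous_on_if[OF A \<tau>_continuous_on_A continuous_on_id])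
  from measurable_sets[OF this B(1)] A
  have "A \<inter> (\<lambda>y. if y \<in> A then \<tau> (- t) y else y) -` B \<in> sets borel" by simp
  also have "A \<inter> (\<lambda>y. if y \<in> A then \<tau> (- t) y else y) -` B = {y \<in> A. \<tau> (- t) y \<in> B}" by auto
  finally show "\<tau> t ` B \<in> sets borel" unfolding eq .
qed

lemma eta_vimage_borel: "B \<in> sets borel \<Longrightarrow> {\<omega>. (\<omega>, eta c \<omega>) \<in> B} \<in> sets borel"
  using measurable_sets[OF eta_measurable, of B c] by (simp add: vimage_def sets_m)

lemma mu_flow:
  assumes c: "c \<in> {0..1}" and B: "B \<in> sets borel" "B \<subseteq> A"
  shows "emeasure (mu c) (\<tau> t ` B) = emeasure (mu c) B"
proof -
  let ?E = "{\<omega>. (\<omega>, eta c \<omega>) \<in> B}"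
  have E: "?E \<in> sets borel" by (rule eta_vimage_borel[OF B(1)])
  have "emeasure (mu c) (\<tau> t ` B) = emeasure m {\<omega>. (\<omega>, eta c \<omega>) \<in> \<tau> t ` B}"
    by (rule emeasure_mu[OF \<tau>_image(2)[OF B]])
  also have "\<dots> = emeasure m {\<omega>. \<sigma> (- t) \<omega> \<in> ?E}"
  proof (rule emeasure_eq_AE)
    show "AE \<omega> in m. \<omega> \<in> {\<omega>. (\<omega>, eta c \<omega>) \<in> \<tau> t ` B} \<longleftrightarrow> \<omega> \<in> {\<omega>. \<sigma> (- t) \<omega> \<in> ?E}"
      using Omega_l_AE
    proof eventually_elim
      case (elim \<omega>)
      then show ?case using eta_A[OF c, of \<omega>] \<tau>_eta[OF elim c, of "- t"] by (simp add: \<tau>_image(1)[OF B])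
    qed
    show "{\<omega>. (\<omega>, eta c \<omega>) \<in> \<tau> t ` B} \<in> sets m"
      using eta_vimage_borel[OF \<tau>_image(2)[OF B]] by (simp add: sets_m)
    show "{\<omega>. \<sigma> (- t) \<omega> \<in> ?E} \<in> sets m"
      using measurable_sets[OF flow_measurable E, of "- t"] by (simp add: vimage_def)
  qed
  also have "\<dots> = emeasure m ?E" by (rule emeasure_flow[OF E])
  also have "\<dots> = emeasure (mu c) B" by (rule emeasure_mu[OF B(1), symmetric])
  finally show ?thesis .
qed

lemma A_borel: "A \<in> sets borel"
  using compact_imp_closed[OF compact_A] by simp

lemma mu_A_1: "c \<in> {0..1} \<Longrightarrow> emeasure (mu c) A = 1"
  using eta_A emeasure_space_1 by (simp add: emeasure_mu[OF A_borel])

lemma mu_ergodic: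
  assumes c: "c \<in> {0..1}"
  shows "ergodic_measure \<tau> A (mu c)"
  unfolding ergodic_measure_def
proof (intro conjI ballI impI)
  show "invariant_measure \<tau> A (mu c)"
    unfolding invariant_measure_def using prob_mu sets_mu mu_A_1[OF c] mu_flow[OF c] by blast
  fix B assume "B \<in> sets borel" "B \<subseteq> A \<and> (\<forall>t. \<tau> t ` B = B)"
  then have B: "B \<in> sets borel" "B \<subseteq> A" "\<forall>t. \<tau> t ` B = B" by auto
  \<comment> \<open>Over \<open>Omega_l\<close> the graph of \<open>eta c\<close> is carried along
    itself pointwise, so this trace of \<open>B\<close> on the base is exactly invariant and not
    just up to a null set.\<close>
  let ?E = "{\<omega>. (\<omega>, eta c \<omega>) \<in> B} \<inter> Omega_l"
  have E: "?E \<in> sets borel" using eta_vimage_borel[OF B(1)] Omega_l_borel by simp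
  have inv: "\<sigma> t \<omega> \<in> ?E" if "\<omega> \<in> ?E" for t \<omega>
  proof -
    have "\<tau> t (\<omega>, eta c \<omega>) \<in> \<tau> t ` B" using that by blast
    then have "(\<sigma> t \<omega>, eta c (\<sigma> t \<omega>)) \<in> B" using B(3) \<tau>_eta[OF _ c, of \<omega> t] that by simp
    then show ?thesis using that Omega_l_invariant by simp
  qed
  have eq: "emeasure (mu c) B = emeasure m ?E"
    unfolding emeasure_mu[OF B(1)]
    by (rule emeasure_eq_AE) (use Omega_l_AE E eta_vimage_borel[OF B(1)] in \<open>auto simp: sets_m\<close>)
  show "emeasure (mu c) B = 0 \<or> emeasure (mu c) B = 1"
  proof (cases "emeasure m ?E = 0")
    case False
    then show ?thesis using emeasure_eq_1[OF E AE_invariant[OF E inv]] by (simp add: eq)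
  qed (simp add: eq)
qed

lemma indicator_A_measurable:
  fixes h :: "'a \<times> real \<Rightarrow> real"
  shows "continuous_on A h \<Longrightarrow> (\<lambda>y. indicator A y *\<^sub>R h y) \<in> borel_measurable borel"
  by (rule borel_measurable_indicator_scaleR_continuous[OF compact_A])

lemma eta_integrable:
  fixes h :: "'a \<times> real \<Rightarrow> real"
  assumes c: "c \<in> {0..1}" and h: "continuous_on A h"
  shows "integrable m (\<lambda>\<omega>. h (\<omega>, eta c \<omega>))"
proof -
  obtain C where C: "C \<ge> 0" "\<And>y. y \<in> A \<Longrightarrow> \<bar>h y\<bar> \<le> C" using compact_continuous_bounded[OF compact_A h] by blast
  have "(\<lambda>\<omega>. indicator A (\<omega>, eta c \<omega>) *\<^sub>R h (\<omega>, eta c \<omega>)) \<in> borel_measurable m"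
    by (rule measurable_compose[OF eta_measurable indicator_A_measurable[OF h]])
  then have "(\<lambda>\<omega>. h (\<omega>, eta c \<omega>)) \<in> borel_measurable m" using eta_A[OF c] by simp
  then show ?thesis using C(2)[OF eta_A[OF c]] by (intro integrable_bounded)
qed

lemma mu_represents:
  assumes c: "c \<in> {0..1}"
  shows "{\<nu>. represents_functional A (\<lambda>h. \<integral>\<omega>. h (\<omega>, eta c \<omega>) \<partial>m) \<nu>} = {mu c}"
proof (rule represents_functional_unique[OF _ sets_mu compact_A mu_A[OF c]])
  show "finite_measure (mu c)" using prob_mu by (rule prob_space.axioms)
  fix h :: "'a \<times> real \<Rightarrow> real" assume h: "continuous_on A h"
  have "(LINT y:A|mu c. h y) = (\<integral>\<omega>. indicator A (\<omega>, eta c \<omega>) *\<^sub>R h (\<omega>, eta c \<omega>) \<partial>m)"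
    unfolding set_lebesgue_integral_def mu_def by (rule integral_distr[OF eta_measurable indicator_A_measurable[OF h]])
  then show "(\<integral>\<omega>. h (\<omega>, eta c \<omega>) \<partial>m) = (LINT y:A|mu c. h y)" using eta_A[OF c] by simp
qed

abbreviation "U01 \<equiv> restrict_space lborel {0..1::real}"

text \<open>The weight \<open>c\<close> is drawn uniformly and independently of the base point,
  which makes the iterated integral over \<open>c\<close> and \<omega> a case of Fubini.\<close>

definition mu' :: "('a \<times> real) measure" where
  "mu' = distr (U01 \<Otimes>\<^sub>M m) borel (\<lambda>(c, \<omega>). (\<omega>, eta c \<omega>))"

lemma prob_U01: "prob_space U01"
  by (rule prob_spaceI) (simp add: emeasure_restrict_space space_restrict_space)

lemma space_U01: "space U01 = {0..1}"
  by (simp add: space_restrict_space)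

lemma pair_prob: "pair_prob_space U01 m"
  unfolding pair_prob_space_def pair_sigma_finite_def
  using prob_U01 prob_space_axioms by (auto intro: prob_space_imp_sigma_finite)

lemma eta_measurable2: "(\<lambda>(c, \<omega>). (\<omega>, eta c \<omega>)) \<in> borel_measurable (U01 \<Otimes>\<^sub>M m)"
proof -
  have s: "snd \<in> measurable (U01 \<Otimes>\<^sub>M m) m" by (rule measurable_snd)
  then have s': "snd \<in> borel_measurable (U01 \<Otimes>\<^sub>M m)"
    using measurable_cong_sets[OF refl sets_m, of "U01 \<Otimes>\<^sub>M m"] by blast
  have "(\<lambda>c. c) \<in> borel_measurable U01" by (rule measurable_restrict_space1) simp
  from measurable_compose[OF measurable_fst this]
  have f: "fst \<in> borel_measurable (U01 \<Otimes>\<^sub>M m)" .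
  have ab: "(\<lambda>z. \<alpha> (snd z)) \<in> borel_measurable (U01 \<Otimes>\<^sub>M m)" "(\<lambda>z. \<beta> (snd z)) \<in> borel_measurable (U01 \<Otimes>\<^sub>M m)"
    using measurable_compose[OF s' \<alpha>_borel] measurable_compose[OF s' \<beta>_borel] .
  have "(\<lambda>z. eta (fst z) (snd z)) \<in> borel_measurable (U01 \<Otimes>\<^sub>M m)"
    unfolding eta_def using f ab by (intro borel_measurable_add borel_measurable_times borel_measurable_diff borel_measurable_const)
  from borel_measurable_Pair_second_countable[OF s' this] show ?thesis by (simp add: case_prod_beta)
qed

lemma prob_mu': "prob_space mu'" and sets_mu': "sets mu' = sets borel"
proof -
  interpret PP: pair_prob_space U01 m by (rule pair_prob)
  show "prob_space mu'" unfolding mu'_def by (rule PP.prob_space_distr[OF eta_measurable2])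
qed (simp add: mu'_def)

lemma emeasure_mu':
  assumes B: "B \<in> sets borel"
  shows "emeasure mu' B = (\<integral>\<^sup>+c. emeasure (mu c) B \<partial>U01)"
proof -
  let ?X = "(\<lambda>(c, \<omega>). (\<omega>, eta c \<omega>)) -` B \<inter> space (U01 \<Otimes>\<^sub>M m)"
  have "emeasure mu' B = emeasure (U01 \<Otimes>\<^sub>M m) ?X"
    unfolding mu'_def by (rule emeasure_distr[OF eta_measurable2 B])
  also have "\<dots> = (\<integral>\<^sup>+c. emeasure m (Pair c -` ?X) \<partial>U01)"
    by (rule emeasure_pair_measure_alt[OF measurable_sets[OF eta_measurable2 B]])
  also have "\<dots> = (\<integral>\<^sup>+c. emeasure (mu c) B \<partial>U01)"
  proof (rule nn_integral_cong)
    fix c assume "c \<in> space U01"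
    then have "Pair c -` ?X = {\<omega>. (\<omega>, eta c \<omega>) \<in> B}" by (auto simp: space_pair_measure)
    then show "emeasure m (Pair c -` ?X) = emeasure (mu c) B" by (simp add: emeasure_mu[OF B])
  qed
  finally show ?thesis .
qed

lemma mu'_invariant: "invariant_measure \<tau> A mu'"
  unfolding invariant_measure_def
proof (intro conjI allI ballI impI)
  interpret U: prob_space U01 by (rule prob_U01)
  have "emeasure mu' A = (\<integral>\<^sup>+c. 1 \<partial>U01)"
    unfolding emeasure_mu'[OF A_borel] by (rule nn_integral_cong) (simp add: mu_A_1 space_U01)
  then show "emeasure mu' A = 1" using U.emeasure_space_1 by simp
  fix t B assume B: "B \<in> sets borel" "B \<subseteq> A"
  show "emeasure mu' (\<tau> t ` B) = emeasure mu' B"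
    unfolding emeasure_mu'[OF B(1)] emeasure_mu'[OF \<tau>_image(2)[OF B]]
    by (rule nn_integral_cong) (simp add: mu_flow B space_U01)
qed (rule prob_mu', rule sets_mu')

lemma mu'_A: "emeasure mu' (- A) = 0"
proof -
  have b: "- A \<in> sets borel" using compact_imp_closed[OF compact_A] by auto
  have "emeasure mu' (- A) = (\<integral>\<^sup>+c. 0 \<partial>U01)"
    unfolding emeasure_mu'[OF b] by (rule nn_integral_cong) (simp add: mu_A space_U01)
  then show ?thesis by simp
qed

lemma mu'_functional:
  fixes h :: "'a \<times> real \<Rightarrow> real"
  assumes h: "continuous_on A h"
  shows "set_integrable lborel {0..1} (\<lambda>c. \<integral>\<omega>. h (\<omega>, eta c \<omega>) \<partial>m)"
    "(LBINT c=0..1. (\<integral>\<omega>. h (\<omega>, eta c \<omega>) \<partial>m)) = (LINT y:A|mu'. h y)"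
proof -
  interpret PP: pair_prob_space U01 m by (rule pair_prob)
  define k where "k y = indicator A y *\<^sub>R h y" for y
  have km: "k \<in> borel_measurable borel" unfolding k_def[abs_def] by (rule indicator_A_measurable[OF h])
  obtain C where C: "C \<ge> 0" "\<And>y. y \<in> A \<Longrightarrow> \<bar>h y\<bar> \<le> C" using compact_continuous_bounded[OF compact_A h] by blast
  define H where "H = (\<lambda>(c, \<omega>). k (\<omega>, eta c \<omega>))"
  have Hm: "H \<in> borel_measurable (U01 \<Otimes>\<^sub>M m)"
    using measurable_compose[OF eta_measurable2 km] by (simp add: H_def case_prod_beta)
  have kb: "\<bar>k y\<bar> \<le> C" for y unfolding k_def using C by (auto simp: indicator_def)
  have Hi: "integrable (U01 \<Otimes>\<^sub>M m) H"
    by (rule PP.integrable_const_bound[of _ C]) (use Hm kb in \<open>auto simp: H_def\<close>)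
  have Heq: "(\<integral>\<omega>. H (c, \<omega>) \<partial>m) = (\<integral>\<omega>. h (\<omega>, eta c \<omega>) \<partial>m)" if "c \<in> {0..1}" for c
    using eta_A[OF that] by (simp add: H_def k_def)
  have ind: "(\<lambda>c. indicator {0..1} c *\<^sub>R (\<integral>\<omega>. H (c, \<omega>) \<partial>m)) = (\<lambda>c. indicator {0..1} c *\<^sub>R (\<integral>\<omega>. h (\<omega>, eta c \<omega>) \<partial>m))"
    by (intro ext) (simp add: indicator_def Heq)
  have ss: "{0..1::real} \<inter> space lborel \<in> sets lborel" by simp
  have "integrable U01 (\<lambda>c. \<integral>\<omega>. H (c, \<omega>) \<partial>m)" by (rule PP.integrable_fst'[OF Hi])
  then show "set_integrable lborel {0..1} (\<lambda>c. \<integral>\<omega>. h (\<omega>, eta c \<omega>) \<partial>m)"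
    unfolding integrable_restrict_space[OF ss] ind set_integrable_def .
  have "(LINT y:A|mu'. h y) = integral\<^sup>L (U01 \<Otimes>\<^sub>M m) H"
    unfolding set_lebesgue_integral_def mu'_def k_def[symmetric] H_def
    by (subst integral_distr[OF eta_measurable2 km]) (simp add: case_prod_unfold)
  also have "\<dots> = (\<integral>c. (\<integral>\<omega>. H (c, \<omega>) \<partial>m) \<partial>U01)" by (rule PP.integral_fst'[OF Hi, symmetric])
  also have "\<dots> = (LINT c:{0..1}|lborel. (\<integral>\<omega>. h (\<omega>, eta c \<omega>) \<partial>m))"
    unfolding integral_restrict_space[OF ss] ind set_lebesgue_integral_def ..
  also have "\<dots> = (LBINT c=0..1. (\<integral>\<omega>. h (\<omega>, eta c \<omega>) \<partial>m))"
    unfolding zero_ereal_def one_ereal_def by (rule interval_integral_Icc[symmetric]) simp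
  finally show "(LBINT c=0..1. (\<integral>\<omega>. h (\<omega>, eta c \<omega>) \<partial>m)) = (LINT y:A|mu'. h y)" ..
qed

lemma mu'_represents:
  "{\<nu>. represents_functional A (\<lambda>h. LBINT c=0..1. (\<integral>\<omega>. h (\<omega>, eta c \<omega>) \<partial>m)) \<nu>} = {mu'}"
proof (rule represents_functional_unique[OF _ sets_mu' compact_A mu'_A])
  show "finite_measure mu'" using prob_mu' by (rule prob_space.axioms)
qed (rule mu'_functional(2))

definition S' :: "('a \<times> real) set" where
  "S' = (\<Union>c\<in>{0..1}. S c)"

lemma S'_A: "S' \<subseteq> A"
  using S_subset_A unfolding S'_def by blast

text \<open>A union of compact sets need not be compact; this one is the image of the compact set
  \<open>{0..1} \<times> Sig\<close> under a jointly continuous map.\<close>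

lemma compact_S': "compact S'"
proof -
  have "S' = (\<lambda>(c, z). proj c z) ` ({0..1} \<times> Sig)" by (force simp: S'_def Supp_mu)
  also have "compact \<dots>"
    by (intro compact_continuous_image compact_Times compact_Sig compact_Icc continuous_on_subset[OF continuous_proj2]) simp
  finally show ?thesis .
qed

lemma S'_invariant: "invariant_set D \<tau> S'"
  by (rule invariant_set_subset_A[OF S'_A]) (auto simp: S'_def intro: S_closed_under_flow)

text \<open>A single \<open>c\<close> has weight zero, so one support alone contributes no mass. But
  a neighbourhood of \<open>proj c0 z\<close> captures the graph points over one fixed set of
  positive measure for all \<open>c\<close> near \<open>c0\<close>, and these fill an interval of
  positive length.\<close>

lemma Supp_mu': "Supp mu' = S'"
proof
  show "Supp mu' \<subseteq> S'"
  proof (rule Supp_subset_closed[OF compact_imp_closed[OF compact_S']])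
    have b: "- S' \<in> sets borel" using compact_imp_closed[OF compact_S'] by auto
    have "emeasure (mu c) (- S') = 0" if c: "c \<in> {0..1}" for c
    proof -
      have "emeasure (mu c) (- S') \<le> emeasure (mu c) (- S c)"
        using c compact_imp_closed[OF compact_S, of c] by (intro emeasure_mono) (auto simp: S'_def sets_mu)
      also have "\<dots> = 0" by (rule emeasure_Compl_Supp[OF sets_mu compact_A mu_A[OF c]])
      finally show ?thesis by simp
    qed
    then have "emeasure mu' (- S') = (\<integral>\<^sup>+c. 0 \<partial>U01)"
      unfolding emeasure_mu'[OF b] by (intro nn_integral_cong) (simp add: space_U01)
    then show "emeasure mu' (- S') = 0" by simp
  qed
  show "S' \<subseteq> Supp mu'"
  proof
    fix y assume "y \<in> S'"
    then obtain c0 z where c0: "c0 \<in> {0..1}" "z \<in> Sig" "y = proj c0 z" unfolding S'_def Supp_mu by blast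
    show "y \<in> Supp mu'" unfolding Supp_def
    proof (intro CollectI allI impI, elim conjE)
      fix U :: "('a \<times> real) set" assume U: "open U" "y \<in> U"
      have "open ((\<lambda>(c, z). proj c z) -` U)" by (rule open_vimage[OF U(1) continuous_proj2])
      moreover have "(c0, z) \<in> (\<lambda>(c, z). proj c z) -` U" using U(2) c0(3) by simp
      ultimately obtain V W where VW: "open V" "open W" "c0 \<in> V" "z \<in> W" "V \<times> W \<subseteq> (\<lambda>(c, z). proj c z) -` U"
        using open_prod_elim by (metis mem_Times_iff fst_conv snd_conv)
      obtain e where e: "e > 0" "ball c0 e \<subseteq> V" using VW(1,3) openE by blast
      let ?p = "emeasure m {\<omega>. J \<omega> \<in> W}"
      have p: "?p \<noteq> 0" by (rule emeasure_J_pos[OF c0(2) VW(2,4)])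
      have low: "?p \<le> emeasure (mu c) U" if "c \<in> ball c0 e" for c
      proof -
        have sub: "(\<omega>, eta c \<omega>) \<in> U" if "J \<omega> \<in> W" for \<omega>
        proof -
          have "(c, J \<omega>) \<in> V \<times> W" using e(2) \<open>c \<in> ball c0 e\<close> that by blast
          from subsetD[OF VW(5) this] show ?thesis by (simp add: proj_J)
        qed
        have "{\<omega>. J \<omega> \<in> W} \<subseteq> {\<omega>. (\<omega>, eta c \<omega>) \<in> U}" by (rule Collect_mono) (use sub in blast)
        then show ?thesis unfolding emeasure_mu[OF borel_open[OF U(1)]]
          using eta_vimage_borel[OF borel_open[OF U(1)]] by (intro emeasure_mono) (auto simp: sets_m)
      qed
      \<comment> \<open>Half the radius keeps the closed interval inside the open ball, and clipping
        to the unit interval leaves positive length even when \<open>c0\<close> is an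
        endpoint.\<close>
      define l where "l = max 0 (c0 - e / 2)"
      define r where "r = min 1 (c0 + e / 2)"
      have lr: "l < r" "{l..r} \<subseteq> {0..1}" "{l..r} \<subseteq> ball c0 e"
        using c0(1) e(1) by (auto simp: l_def r_def dist_real_def)
      have "0 < ?p * ennreal (r - l)" using p lr(1) by (simp add: ennreal_zero_less_mult_iff zero_less_iff_neq_zero)
      also have "?p * ennreal (r - l) = ?p * emeasure U01 {l..r}"
        using lr by (simp add: emeasure_restrict_space)
      also have "\<dots> = (\<integral>\<^sup>+c. ?p * indicator {l..r} c \<partial>U01)"
        using lr by (subst nn_integral_cmult_indicator) (auto simp: sets_restrict_space_iff)
      also have "\<dots> \<le> (\<integral>\<^sup>+c. emeasure (mu c) U \<partial>U01)"
        using low lr(3) by (intro nn_integral_mono) (auto simp: indicator_def)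
      also have "\<dots> = emeasure mu' U" by (rule emeasure_mu'[OF borel_open[OF U(1)], symmetric])
      finally show "0 < emeasure mu' U" .
    qed
  qed
qed

subsection \<open>The set of all supports\<close>

lemma sensitive_point_mono:
  assumes s: "sensitive_on sum_dist Y \<tau>" and y: "y \<in> Y" and Z: "Y \<subseteq> Z"
  shows "sensitive_point sum_dist Z \<tau> y"
proof -
  obtain e where e: "e > 0" "eps_sensitive_point sum_dist Y \<tau> e y"
    using s y unfolding sensitive_on_def by blast
  then have "eps_sensitive_point sum_dist Z \<tau> e y"
    using Z unfolding eps_sensitive_point_def by (meson subsetD)
  then show ?thesis using e(1) unfolding sensitive_point_def by blast
qed

text \<open>Care is needed only when \<open>S c\<close> is a copy of the base equal to
  \<open>M\<close>. Its points belong to every other support as well, and such a support is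
  sensitive at them.\<close>

lemma S'_sensitive:
  assumes y: "y \<in> S'"
  shows "sensitive_point sum_dist S' \<tau> y"
proof -
  obtain c where c: "c \<in> {0..1}" "y \<in> S c" using y unfolding S'_def by blast
  have sub: "S d \<subseteq> S'" if "d \<in> {0..1}" for d using that by (auto simp: S'_def)
  show ?thesis
  proof (cases "M \<noteq> S c \<or> \<not> copy_of_base \<sigma> D \<tau> M")
    case True
    show ?thesis by (rule sensitive_point_mono[OF S_sensitive[OF c(1) True] c(2) sub[OF c(1)]])
  next
    case False
    obtain c0 where c0: "\<forall>c\<in>{0..1}. M = S c \<longleftrightarrow> c = c0" using copy_of_base_S False by blast
    \<comment> \<open>Any weight different from \<open>c\<close> would do; one of the two endpoints
      always is.\<close>
    define d where "d = (if c = 0 then 1 else 0 :: real)"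
    have d: "d \<in> {0..1}" "d \<noteq> c" by (auto simp: d_def)
    have "c = c0" using c0 c(1) False by auto
    then have "M \<noteq> S d" using c0 d by auto
    moreover have "y \<in> S d" using M_subset[OF compact_S S_nonempty S_invariant[OF d(1)]] c(2) False by blast
    ultimately show ?thesis using sensitive_point_mono[OF S_sensitive[OF d(1)] _ sub[OF d(1)]] by blast
  qed
qed

text \<open>A point \<open>p\<close> of \<open>M\<close> lies in all supports and serves as a
  crossing: two links inside \<open>S c\<close> lead to it and two inside \<open>S c'\<close> lead
  away from it.\<close>

lemma S'_chain_recurrent: "chain_recurrent_on sum_dist S' \<tau>"
  unfolding chain_recurrent_on_def
proof (intro allI impI ballI)
  fix e T :: real and y y'
  assume e: "e > 0" and T: "T > 0" and y: "y \<in> S'" "y' \<in> S'"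
  obtain c where c: "c \<in> {0..1}" "y \<in> S c" using y(1) unfolding S'_def by blast
  obtain c' where c': "c' \<in> {0..1}" "y' \<in> S c'" using y(2) unfolding S'_def by blast
  obtain p where p: "p \<in> M" using M_props(2) by blast
  have pS: "p \<in> S d" if "d \<in> {0..1}" for d using M_subset[OF compact_S S_nonempty S_invariant[OF that]] p by blast
  obtain \<omega> where \<omega>: "\<omega> \<in> Omega_AY" using Omega_AY_nonempty by blast
  interpret T1: compact_transitive_flow "S c" \<tau> "(\<omega>, eta c \<omega>)" by (rule S_transitive_flow[OF \<omega> c(1)])
  interpret T2: compact_transitive_flow "S c'" \<tau> "(\<omega>, eta c' \<omega>)" by (rule S_transitive_flow[OF \<omega> c'(1)])
  \<comment> \<open>The links are found in the product metric, and \<open>sum_dist\<close> is at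
    most twice as large.\<close>
  have e2: "e / 2 > 0" using e by simp
  obtain z s where z: "z \<in> S c" "s \<ge> T" "dist (\<tau> T y) z < e / 2" "dist (\<tau> s z) p < e / 2"
    using T1.two_step_chain[OF c(2) pS[OF c(1)] e2, of T] by blast
  obtain z' s' where z': "z' \<in> S c'" "s' \<ge> T" "dist (\<tau> T p) z' < e / 2" "dist (\<tau> s' z') y' < e / 2"
    using T2.two_step_chain[OF pS[OF c'(1)] c'(2) e2, of T] by blast
  have sd: "sum_dist u v < e" if "dist u v < e / 2" for u v :: "'a \<times> real"
    using sum_dist_le[of u v] that by linarith
  let ?p = "\<lambda>i. [y, z, p, z', y'] ! i" and ?s = "\<lambda>i. [T, s, T, s'] ! i"
  show "\<exists>k\<ge>1. \<exists>p s. p 0 = y \<and> p k = y' \<and> (\<forall>i\<le>k. p i \<in> S') \<and>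
      (\<forall>i<k. s i \<ge> T \<and> sum_dist (\<tau> (s i) (p i)) (p (Suc i)) < e)"
  proof (intro exI[of _ "4::nat"] conjI exI[of _ ?p] exI[of _ ?s] allI impI)
    have "z \<in> S'" "z' \<in> S'" "p \<in> S'" using z(1) z'(1) c(1) c'(1) pS by (auto simp: S'_def)
    then show "?p i \<in> S'" if "i \<le> 4" for i
      using that y by (auto simp: le_Suc_eq numeral_eq_Suc)
    show "?s i \<ge> T" if "i < 4" for i using that z(2) z'(2) by (auto simp: less_Suc_eq numeral_eq_Suc)
    show "sum_dist (\<tau> (?s i) (?p i)) (?p (Suc i)) < e" if "i < 4" for i
      using that sd[OF z(3)] sd[OF z(4)] sd[OF z'(3)] sd[OF z'(4)] by (auto simp: less_Suc_eq numeral_eq_Suc)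
  qed auto
qed

text \<open>A positive gap at a continuity point persists nearby, where the dense orbit of the
  pinched base point passes; along that orbit the two bounds coincide.\<close>

lemma singleton_if_continuity_point:
  assumes "isCont \<alpha> \<omega>" "isCont \<beta> \<omega>"
  shows "\<alpha> \<omega> = \<beta> \<omega>"
proof (rule ccontr)
  assume "\<alpha> \<omega> \<noteq> \<beta> \<omega>"
  then have p: "\<beta> \<omega> - \<alpha> \<omega> \<in> {0<..}" using \<alpha>_le_\<beta>[of \<omega>] by simp
  have "isCont (\<lambda>x. \<beta> x - \<alpha> x) \<omega>" using assms by (intro continuous_intros)
  then obtain U where U: "open U" "\<omega> \<in> U" "\<And>x. x \<in> U \<Longrightarrow> \<beta> x - \<alpha> x > 0"
    using p unfolding continuous_at_open by (metis greaterThan_iff open_greaterThan)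
  obtain \<omega>0 x0 where f: "fiber A \<omega>0 = {x0}" using pinch by blast
  have "\<alpha> \<omega>0 \<in> fiber A \<omega>0" "\<beta> \<omega>0 \<in> fiber A \<omega>0" using \<alpha>_A \<beta>_A by (auto simp: fiber_def)
  then have eq: "\<alpha> \<omega>0 = \<beta> \<omega>0" using f by simp
  obtain t where "\<sigma> t \<omega>0 \<in> U" using forward_orbit_dense[OF U(1), of 0 \<omega>0] U(2) by blast
  moreover have "\<alpha> (\<sigma> t \<omega>0) = \<beta> (\<sigma> t \<omega>0)"
    using sol_\<alpha>[of t \<omega>0] sol_\<beta>[of t \<omega>0] eq by simp
  ultimately show False using U(3) by fastforce
qed

text \<open>Over \<open>Omega_AY\<close> the convex combinations sweep out the whole fibre. At a
  common continuity point the fibre of \<open>A\<close> is a singleton, and \<open>S'\<close> has a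
  point over every base point.\<close>

lemma fiber_S':
  assumes "\<omega> \<in> Omega_AY \<union> {\<omega>. isCont \<alpha> \<omega> \<and> isCont \<beta> \<omega>}"
  shows "fiber A \<omega> = fiber S' \<omega>"
proof
  show "fiber S' \<omega> \<subseteq> fiber A \<omega>" using S'_A by (auto simp: fiber_def)
  show "fiber A \<omega> \<subseteq> fiber S' \<omega>"
    using assms
  proof
    assume \<omega>: "\<omega> \<in> Omega_AY"
    show ?thesis
    proof
      fix x assume "x \<in> fiber A \<omega>"
      then have xA: "(\<omega>, x) \<in> A" by (simp add: fiber_def)
      have "\<omega> \<in> Omega_l" using \<omega> Omega_AY_subset by blast
      from eta_onto[OF this xA] obtain c where "c \<in> {0..1}" "x = eta c \<omega>" by blast
      moreover from this have "(\<omega>, x) \<in> S c" using eta_in_S[OF \<omega>] by simp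
      ultimately show "x \<in> fiber S' \<omega>" unfolding fiber_def S'_def by blast
    qed
  next
    assume "\<omega> \<in> {\<omega>. isCont \<alpha> \<omega> \<and> isCont \<beta> \<omega>}"
    then have eq: "\<alpha> \<omega> = \<beta> \<omega>" using singleton_if_continuity_point by blast
    have ne: "S' \<noteq> {}" using S_nonempty[of 0] by (auto simp: S'_def intro!: exI[of _ "0::real"])
    obtain x where x: "(\<omega>, x) \<in> S'" using fiber_nonempty[OF compact_S' ne S'_invariant] by blast
    then have "(\<omega>, x) \<in> A" using S'_A by blast
    then show ?thesis using x eq by (auto simp: fiber_def A_iff)
  qed
qed

subsection \<open>Generic points\<close>

definition weight :: "nat \<Rightarrow> 'a \<times> real \<times> real \<Rightarrow> 'a \<times> real \<times> real \<Rightarrow> real" where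
  "weight n y z = max 0 (inverse (real (Suc n)) - dist z y)"

definition total :: "nat \<Rightarrow> 'a \<times> real \<times> real \<Rightarrow> real" where
  "total n z = (\<Sum>y\<in>net n. weight n y z)"

text \<open>Some positive lower bound of \<open>total n\<close> on \<open>Sig\<close>; it exists
  because the net balls cover this compact set.\<close>

definition floor_total :: "nat \<Rightarrow> real" where
  "floor_total n = (SOME k. k > 0 \<and> (\<forall>z\<in>Sig. k \<le> total n z))"

text \<open>A partition of unity on \<open>Sig\<close>; the maximum only serves to keep the quotient continuous
  outside of \<open>Sig\<close>.\<close>

definition bump :: "nat \<Rightarrow> 'a \<times> real \<times> real \<Rightarrow> 'a \<times> real \<times> real \<Rightarrow> real" where
  "bump n y z = weight n y z / max (floor_total n) (total n z)"

lemma weight_nonneg: "0 \<le> weight n y z"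
  by (simp add: weight_def)

lemma continuous_weight: "continuous_on UNIV (weight n y)"
  unfolding weight_def[abs_def] by (intro continuous_intros)

lemma continuous_total: "continuous_on UNIV (total n)"
  unfolding total_def[abs_def] by (intro continuous_on_sum continuous_weight)

lemma floor_total: "floor_total n > 0" "z \<in> Sig \<Longrightarrow> floor_total n \<le> total n z"
proof -
  have pos: "total n z > 0" if "z \<in> Sig" for z
  proof -
    obtain y where y: "y \<in> net n" "z \<in> ball y (inverse (real (Suc n)))" using net(3)[of n] \<open>z \<in> Sig\<close> by blast
    then have "weight n y z > 0" by (simp add: weight_def dist_commute)
    then show ?thesis unfolding total_def using net(1) y(1) weight_nonneg by (intro sum_pos2) auto
  qed
  have "Sig \<noteq> {}" using S_nonempty[of 0] by (auto simp: Supp_mu)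
  then obtain z0 where z0: "z0 \<in> Sig" "\<forall>z\<in>Sig. total n z0 \<le> total n z"
    using continuous_attains_inf[OF compact_Sig _ continuous_on_subset[OF continuous_total]] by blast
  then have "\<exists>k. k > 0 \<and> (\<forall>z\<in>Sig. k \<le> total n z)" using pos by blast
  from someI_ex[OF this] show "floor_total n > 0" "z \<in> Sig \<Longrightarrow> floor_total n \<le> total n z"
    unfolding floor_total_def by blast+
qed

lemma continuous_bump: "continuous_on UNIV (bump n y)"
  unfolding bump_def[abs_def]
  by (intro continuous_on_divide continuous_on_max continuous_weight continuous_total continuous_on_const)
     (use floor_total(1)[of n] in auto)

lemma bump_bound: "\<bar>bump n y z\<bar> \<le> inverse (real (Suc n)) / floor_total n"
proof -
  have "weight n y z \<le> inverse (real (Suc n))" by (simp add: weight_def)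
  moreover have "floor_total n \<le> max (floor_total n) (total n z)" by simp
  ultimately show ?thesis unfolding bump_def
    using floor_total(1)[of n] weight_nonneg[of n y z] by (simp add: abs_div_pos frac_le)
qed

lemma bump_nonneg: "0 \<le> bump n y z"
  unfolding bump_def using weight_nonneg floor_total(1)[of n] by (intro divide_nonneg_nonneg) auto

lemma sum_bump:
  assumes "z \<in> Sig"
  shows "(\<Sum>y\<in>net n. bump n y z) = 1"
proof -
  have "max (floor_total n) (total n z) = total n z" "total n z > 0"
    using floor_total(1)[of n] floor_total(2)[OF assms, of n] by auto
  then show ?thesis unfolding bump_def sum_divide_distrib[symmetric] total_def[symmetric] by simp
qed

text \<open>On \<open>Sig\<close> the bumps sum to 1 and each vanishes at distances beyond the mesh
  size, so the weighted mean of values at net points misses \<open>h z\<close> by at most its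
  oscillation at that scale.\<close>

lemma bump_approx:
  assumes h: "\<And>y. y \<in> Sig \<Longrightarrow> dist z y < inverse (real (Suc n)) \<Longrightarrow> \<bar>h z - h y\<bar> \<le> e" and z: "z \<in> Sig"
  shows "\<bar>h z - (\<Sum>y\<in>net n. h y * bump n y z)\<bar> \<le> e"
proof -
  have "h z - (\<Sum>y\<in>net n. h y * bump n y z) = (\<Sum>y\<in>net n. (h z - h y) * bump n y z)"
    using sum_bump[OF z, of n] by (simp add: left_diff_distrib sum_subtractf flip: sum_distrib_left)
  also have "\<bar>\<dots>\<bar> \<le> (\<Sum>y\<in>net n. e * bump n y z)"
  proof (rule order_trans[OF sum_abs sum_mono])
    fix y assume y: "y \<in> net n"
    show "\<bar>(h z - h y) * bump n y z\<bar> \<le> e * bump n y z"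
    proof (cases "dist z y < inverse (real (Suc n))")
      case True
      then have "\<bar>h z - h y\<bar> \<le> e" using h y net(2) by blast
      then show ?thesis using bump_nonneg by (simp add: abs_mult mult_right_mono)
    next
      case False
      then show ?thesis by (simp add: bump_def weight_def)
    qed
  qed
  also have "\<dots> = e" using sum_bump[OF z, of n] by (simp flip: sum_distrib_left)
  finally show ?thesis .
qed

text \<open>The null set in Birkhoff's theorem depends on the function. For the countably many bumps
  one base point works for all, and every continuous function on the compact set \<open>Sig\<close>
  is a uniform limit of finite combinations of bumps.\<close>

lemma exists_generic_base_point:
  "\<exists>\<omega>\<in>Omega_AY. \<forall>h :: 'a \<times> real \<times> real \<Rightarrow> real. continuous_on Sig h \<longrightarrow>
     (\<exists>L. (time_average (\<lambda>s. h (J (\<sigma> s \<omega>))) \<longlongrightarrow> L) at_top)"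
proof -
  have Jb: "J \<in> borel_measurable borel" using J_measurable by (simp add: measurable_m)
  have oc: "orbit_continuous (\<lambda>\<omega>. bump n y (J \<omega>))" for n y
    unfolding orbit_continuous_def
    by (intro allI continuous_on_compose2[OF continuous_bump J_orbit]) simp
  have "AE \<omega> in m. \<exists>L. ((\<lambda>t. 1 / t * cocycle_int \<sigma> (\<lambda>\<omega>. bump n y (J \<omega>)) \<omega> t) \<longlongrightarrow> L) at_top" for n y
  proof -
    have "(\<lambda>\<omega>. bump n y (J \<omega>)) \<in> borel_measurable borel"
      by (rule measurable_compose[OF Jb borel_measurable_continuous_onI[OF continuous_bump]])
    from birkhoff[OF this oc bump_bound] show ?thesis by eventually_elim blast
  qed
  then have "AE \<omega> in m. \<forall>y\<in>net n. \<exists>L. ((\<lambda>t. 1 / t * cocycle_int \<sigma> (\<lambda>\<omega>. bump n y (J \<omega>)) \<omega> t) \<longlongrightarrow> L) at_top" for n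
    by (subst AE_ball_countable[OF countable_finite[OF net(1)]]) blast
  then have "AE \<omega> in m. \<forall>n. \<forall>y\<in>net n. \<exists>L. ((\<lambda>t. 1 / t * cocycle_int \<sigma> (\<lambda>\<omega>. bump n y (J \<omega>)) \<omega> t) \<longlongrightarrow> L) at_top"
    by (simp add: AE_all_countable)
  with Omega_AY_AE have ae: "AE \<omega> in m. \<omega> \<in> Omega_AY \<and>
      (\<forall>n. \<forall>y\<in>net n. \<exists>L. ((\<lambda>t. 1 / t * cocycle_int \<sigma> (\<lambda>\<omega>. bump n y (J \<omega>)) \<omega> t) \<longlongrightarrow> L) at_top)"
    by eventually_elim blast
  have "ae_filter m \<noteq> bot" using emeasure_space_1 by (simp add: ae_filter_eq_bot_iff)
  from eventually_happens'[OF this ae] obtain \<omega> where \<omega>: "\<omega> \<in> Omega_AY" and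
    lim: "\<forall>n. \<forall>y\<in>net n. \<exists>L. ((\<lambda>t. 1 / t * cocycle_int \<sigma> (\<lambda>\<omega>. bump n y (J \<omega>)) \<omega> t) \<longlongrightarrow> L) at_top"
    by (elim exE conjE)
  show ?thesis
  proof (intro bexI[OF _ \<omega>] allI impI)
    fix h :: "'a \<times> real \<times> real \<Rightarrow> real" assume h: "continuous_on Sig h"
    define P where "P t = (LBINT s=0..t. h (J (\<sigma> s \<omega>)))" for t :: real
    have JS: "J (\<sigma> s \<omega>) \<in> Sig" for s by (rule Omega_AY_Sig[OF \<omega>])
    have ch: "continuous_on UNIV (\<lambda>s. h (J (\<sigma> s \<omega>)))"
      by (rule continuous_on_compose2[OF h J_orbit]) (use JS in blast)
    have dP: "(P has_real_derivative h (J (\<sigma> t \<omega>))) (at t)" for t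
      unfolding P_def[abs_def] by (rule interval_integral_has_real_derivative[OF ch])
    have P0: "P 0 = 0" by (simp add: P_def flip: zero_ereal_def)
    show "\<exists>L. (time_average (\<lambda>s. h (J (\<sigma> s \<omega>))) \<longlongrightarrow> L) at_top"
      unfolding time_average_def[abs_def] P_def[symmetric]
    proof (rule tendsto_of_approximate_limits)
      fix e :: real assume e: "e > 0"
      have "uniformly_continuous_on Sig h" by (rule compact_uniformly_continuous[OF h compact_Sig])
      then obtain d where d: "d > 0" "\<And>x x'. x \<in> Sig \<Longrightarrow> x' \<in> Sig \<Longrightarrow> dist x' x < d \<Longrightarrow> dist (h x') (h x) < e / 2"
        using half_gt_zero[OF e] unfolding uniformly_continuous_on_def by blast
      obtain n where n: "inverse (real (Suc n)) < d" using reals_Archimedean[OF d(1)] by blast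
      define Q where "Q t = (\<Sum>y\<in>net n. h y * cocycle_int \<sigma> (\<lambda>\<omega>. bump n y (J \<omega>)) \<omega> t)" for t
      have dQ: "(Q has_real_derivative (\<Sum>y\<in>net n. h y * bump n y (J (\<sigma> t \<omega>)))) (at t)" for t
        unfolding Q_def[abs_def] by (intro DERIV_sum DERIV_cmult cocycle_int_deriv oc)
      have close: "\<bar>h z - (\<Sum>y\<in>net n. h y * bump n y z)\<bar> \<le> e / 2" if z: "z \<in> Sig" for z
      proof (rule bump_approx[OF _ z])
        fix y assume "y \<in> Sig" "dist z y < inverse (real (Suc n))"
        then show "\<bar>h z - h y\<bar> \<le> e / 2" using d(2)[of y z] z n by (simp add: dist_real_def)
      qed
      \<comment> \<open>The integrands differ by at most \<open>e / 2\<close> along the orbit, which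
        stays in \<open>Sig\<close>; the mean value theorem turns this into a bound for the
        integrals that survives division by \<open>t\<close>.\<close>
      have PQ: "\<bar>P t - Q t\<bar> \<le> e / 2 * t" if t: "t > 0" for t
      proof -
        have "\<exists>z>0. z < t \<and> (P t - Q t) - (P 0 - Q 0) =
            (t - 0) * (h (J (\<sigma> z \<omega>)) - (\<Sum>y\<in>net n. h y * bump n y (J (\<sigma> z \<omega>))))"
          by (rule MVT2[OF t]) (rule DERIV_diff[OF dP dQ])
        then obtain z where "P t - Q t = t * (h (J (\<sigma> z \<omega>)) - (\<Sum>y\<in>net n. h y * bump n y (J (\<sigma> z \<omega>))))"
          using P0 by (auto simp: Q_def)
        then have "\<bar>P t - Q t\<bar> = t * \<bar>h (J (\<sigma> z \<omega>)) - (\<Sum>y\<in>net n. h y * bump n y (J (\<sigma> z \<omega>)))\<bar>"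
          using t by (simp add: abs_mult)
        also have "\<dots> \<le> t * (e / 2)" using close[OF JS, of z] t by (intro mult_left_mono) auto
        finally show ?thesis by (simp add: mult.commute)
      qed
      have "\<forall>y\<in>net n. \<exists>L. ((\<lambda>t. 1 / t * cocycle_int \<sigma> (\<lambda>\<omega>. bump n y (J \<omega>)) \<omega> t) \<longlongrightarrow> L) at_top"
        using lim by (rule spec)
      from bchoice[OF this]
      obtain l where l: "\<And>y. y \<in> net n \<Longrightarrow>
          ((\<lambda>t. 1 / t * cocycle_int \<sigma> (\<lambda>\<omega>. bump n y (J \<omega>)) \<omega> t) \<longlongrightarrow> l y) at_top"
        by blast
      have "((\<lambda>t. \<Sum>y\<in>net n. h y * (1 / t * cocycle_int \<sigma> (\<lambda>\<omega>. bump n y (J \<omega>)) \<omega> t)) \<longlongrightarrow>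
          (\<Sum>y\<in>net n. h y * l y)) at_top"
        by (intro tendsto_sum tendsto_mult tendsto_const l)
      moreover have "(\<Sum>y\<in>net n. h y * (1 / t * cocycle_int \<sigma> (\<lambda>\<omega>. bump n y (J \<omega>)) \<omega> t)) = 1 / t * Q t" for t
        by (simp add: Q_def sum_distrib_left mult.left_commute)
      ultimately have "((\<lambda>t. 1 / t * Q t) \<longlongrightarrow> (\<Sum>y\<in>net n. h y * l y)) at_top" by simp
      then have "\<forall>\<^sub>F t in at_top. dist (1 / t * Q t) (\<Sum>y\<in>net n. h y * l y) < e / 2"
        using half_gt_zero[OF e] by (simp only: tendsto_iff)
      moreover have "\<forall>\<^sub>F t in at_top. (t::real) > 0" by (rule eventually_gt_at_top)
      ultimately have "\<forall>\<^sub>F t in at_top. \<bar>1 / t * P t - (\<Sum>y\<in>net n. h y * l y)\<bar> < e"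
      proof eventually_elim
        case (elim t)
        have "1 / t * P t - 1 / t * Q t = (P t - Q t) / t" by (simp add: diff_divide_distrib)
        then have "\<bar>1 / t * P t - 1 / t * Q t\<bar> = \<bar>P t - Q t\<bar> / t"
          using elim(2) by (simp only: abs_divide abs_of_pos)
        also have "\<dots> \<le> e / 2" using PQ[OF elim(2)] elim(2) by (simp add: pos_divide_le_eq)
        finally show ?case using elim(1) unfolding dist_real_def by linarith
      qed
      then show "\<exists>l. \<forall>\<^sub>F t in at_top. \<bar>1 / t * P t - l\<bar> < e" by blast
    qed simp
  qed
qed

text \<open>Shifting changes the integral by boundary terms and the normalization by a factor
  \<open>1 + r / t\<close>, which tends to 1. It makes genericity hold along a whole orbit.\<close>

lemma shifted_average:
  fixes k :: "real \<Rightarrow> real" and L :: real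
  assumes k: "continuous_on UNIV k" and L: "(time_average (\<lambda>s. k s) \<longlongrightarrow> L) at_top"
  shows "(time_average (\<lambda>s. k (s + r)) \<longlongrightarrow> L) at_top"
proof -
  define P where "P t = (LBINT s=0..t. k s)" for t :: real
  have dP: "(P has_real_derivative k t) (at t)" for t
    unfolding P_def[abs_def] by (rule interval_integral_has_real_derivative[OF k])
  have ck: "continuous_on UNIV (\<lambda>s. k (s + r))"
    by (rule continuous_on_compose2[OF k]) (auto intro!: continuous_intros)
  have eq: "(LBINT s=0..t. k (s + r)) = P (t + r) - P r" for t
  proof -
    let ?d = "\<lambda>t. (LBINT s=0..t. k (s + r)) - P (t + r)"
    have "(?d has_real_derivative 0) (at t)" for t
    proof -
      have "((\<lambda>t. P (t + r)) has_real_derivative k (t + r)) (at t)" using dP[of "t + r"] by (simp add: DERIV_shift)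
      from DERIV_diff[OF interval_integral_has_real_derivative[OF ck] this] show ?thesis by simp
    qed
    then have "?d t = ?d 0" using DERIV_isconst_all[of ?d] by blast
    then show ?thesis by (simp flip: zero_ereal_def)
  qed
  have "filterlim (\<lambda>t. r + t) at_top at_top"
    by (rule filterlim_tendsto_add_at_top[OF tendsto_const filterlim_ident])
  then have sh: "filterlim (\<lambda>t. t + r) at_top at_top" by (simp only: add.commute)
  have z: "((\<lambda>t. x / t) \<longlongrightarrow> 0) at_top" for x :: real
    by (intro tendsto_divide_0[OF tendsto_const] filterlim_at_top_imp_at_infinity filterlim_ident)
  have "((\<lambda>t. (1 + r / t) * (1 / (t + r) * P (t + r)) - P r / t) \<longlongrightarrow> (1 + 0) * L - 0) at_top"
    by (intro tendsto_intros z) (rule filterlim_compose[OF L[unfolded time_average_def[abs_def], folded P_def] sh])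
  moreover have "\<forall>\<^sub>F t in at_top. (1 + r / t) * (1 / (t + r) * P (t + r)) - P r / t = 1 / t * (P (t + r) - P r)"
    using eventually_gt_at_top[of 0] eventually_gt_at_top[of "- r"]
  proof eventually_elim
    case (elim t)
    then have "t + r \<noteq> 0" "1 + r / t = (t + r) / t" by (auto simp: add_divide_distrib)
    then show ?case by (simp add: diff_divide_distrib)
  qed
  ultimately have "((\<lambda>t. 1 / t * (P (t + r) - P r)) \<longlongrightarrow> (1 + 0) * L - 0) at_top"
    by (rule Lim_transform_eventually)
  then show ?thesis by (simp add: time_average_def[abs_def] eq)
qed

text \<open>\<open>X\<close> consists of all convex combinations over a single generic base orbit.
  One base point serves every \<open>c\<close>, because a test function composed with
  \<open>proj c\<close> is continuous on \<open>Sig\<close>; density follows as the orbits over it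
  fill each support in the limit.\<close>

lemma generic_points:
  "\<exists>X\<subseteq>S'. S' \<subseteq> closure X \<and> invariant_set D \<tau> X \<and> (\<forall>y\<in>X. generic_point S' \<tau> y)"
proof -
  obtain \<omega> where \<omega>: "\<omega> \<in> Omega_AY" and gen: "\<And>h :: 'a \<times> real \<times> real \<Rightarrow> real. continuous_on Sig h \<Longrightarrow>
      \<exists>L. (time_average (\<lambda>s. h (J (\<sigma> s \<omega>))) \<longlongrightarrow> L) at_top"
    using exists_generic_base_point by blast
  have \<omega>l: "\<omega> \<in> Omega_l" using \<omega> Omega_AY_subset by blast
  define X where "X = {(\<sigma> t \<omega>, eta c (\<sigma> t \<omega>)) | t c. c \<in> {0..1}}"
  have \<tau>X: "\<tau> s (\<sigma> t \<omega>, eta c (\<sigma> t \<omega>)) = (\<sigma> (s + t) \<omega>, eta c (\<sigma> (s + t) \<omega>))" if "c \<in> {0..1}" for s t c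
    using \<tau>_eta[OF Omega_l_invariant[OF \<omega>l] that, of s t] by (simp add: flow_add)
  have XS: "X \<subseteq> S'"
    unfolding X_def S'_def using eta_in_S[OF Omega_AY_invariant[OF \<omega>]] by blast
  moreover have "S' \<subseteq> closure X"
  proof
    fix y assume "y \<in> S'"
    then obtain c where c: "c \<in> {0..1}" "y \<in> S c" unfolding S'_def by blast
    show "y \<in> closure X" unfolding closure_approachable
    proof (intro allI impI)
      fix e :: real assume e: "e > 0"
      have "y \<in> omega_limit \<tau> (\<omega>, eta c \<omega>)" using c S_omega_limit[OF \<omega> c(1)] by blast
      then obtain t where "dist (\<tau> t (\<omega>, eta c \<omega>)) y < e" using e unfolding omega_limit_iff by blast
      moreover have "\<tau> t (\<omega>, eta c \<omega>) \<in> X" using \<tau>_eta[OF \<omega>l c(1)] c(1) by (auto simp: X_def)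
      ultimately show "\<exists>x\<in>X. dist x y < e" by blast
    qed
  qed
  moreover have "invariant_set D \<tau> X"
  proof (rule invariant_set_subset_A)
    show "X \<subseteq> A" using XS S'_A by blast
    show "\<tau> s y \<in> X" if "y \<in> X" for s y using that \<tau>X unfolding X_def by blast
  qed
  moreover have "generic_point S' \<tau> y" if y: "y \<in> X" for y
    unfolding generic_point_def time_average_def[symmetric]
  proof (intro allI impI)
    fix f :: "'a \<times> real \<Rightarrow> real" assume f: "continuous_on S' f"
    obtain r c where y: "y = (\<sigma> r \<omega>, eta c (\<sigma> r \<omega>))" and c: "c \<in> {0..1}" using y unfolding X_def by blast
    have h: "continuous_on Sig (\<lambda>z. f (proj c z))"
      by (rule continuous_on_compose2[OF f continuous_on_subset[OF continuous_proj]])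
        (use c in \<open>auto simp: S'_def Supp_mu\<close>)
    obtain L where L: "(time_average (\<lambda>s. f (proj c (J (\<sigma> s \<omega>)))) \<longlongrightarrow> L) at_top"
      using gen[OF h] by blast
    have "continuous_on UNIV (\<lambda>s. f (proj c (J (\<sigma> s \<omega>))))"
      by (rule continuous_on_compose2[OF h J_orbit]) (use Omega_AY_Sig[OF \<omega>] in blast)
    from shifted_average[OF this L, of r]
    show "\<exists>L. (time_average (\<lambda>s. f (\<tau> s y)) \<longlongrightarrow> L) at_top"
      by (auto simp: y \<tau>X[OF c] proj_J)
  qed
  ultimately show ?thesis by blast
qed

end

section \<open>Ergodicity, transitivity, chaos and the union of the supports combined\<close>

theorem theorem3p15:
  fixes \<sigma> :: "real \<Rightarrow> 'w::metric_space \<Rightarrow> 'w"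
    and a b :: "'w \<Rightarrow> real"
    and g g_x :: "'w \<Rightarrow> real \<Rightarrow> real"
    and r1 r2 :: real
    and D :: "'w \<times> real \<Rightarrow> real set"
    and \<tau> :: "real \<Rightarrow> 'w \<times> real \<Rightarrow> 'w \<times> real"
    and A M :: "('w \<times> real) set"
    and \<alpha> \<beta> :: "'w \<Rightarrow> real"
    and m :: "'w measure"
    and \<Omega>\<^sub>c \<Omega>\<^sub>l :: "'w set"
    and \<eta> :: "real \<Rightarrow> 'w \<Rightarrow> real"
  assumes flow: "continuous_flow_on UNIV \<sigma>"
    and minimal: "minimal_set (\<lambda>_. UNIV) \<sigma> UNIV"
    and cont_a: "continuous_on UNIV a"
    and cont_b: "continuous_on UNIV b"
    and r12: "r1 < r2"
    and g_deriv: "\<And>\<omega> x. (g \<omega> has_real_derivative g_x \<omega> x) (at x)"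
    and cont_g: "continuous_on UNIV (\<lambda>(\<omega>, x). g \<omega> x)"
    and cont_g_x: "continuous_on UNIV (\<lambda>(\<omega>, x). g_x \<omega> x)"
    and g_zero: "\<And>\<omega> x. r1 \<le> x \<Longrightarrow> x \<le> r2 \<Longrightarrow> g \<omega> x = 0"
    and g_pos: "\<And>\<omega> x. x < r1 \<Longrightarrow> g \<omega> x > 0"
    and g_neg: "\<And>\<omega> x. x > r2 \<Longrightarrow> g \<omega> x < 0"
    and g_coercive_top: "\<And>K. \<forall>\<^sub>F x in at_top. \<forall>\<omega>. g \<omega> x / x < K"
    and g_coercive_bot: "\<And>K. \<forall>\<^sub>F x in at_bot. \<forall>\<omega>. g \<omega> x / x < K"
    and g_x_neg: "\<And>\<omega> x. x \<notin> {r1..r2} \<Longrightarrow> g_x \<omega> x < 0"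
    and \<tau>_eq: "\<tau> = skew_flow \<sigma> (\<lambda>\<omega> x. a \<omega> * x + b \<omega> + g \<omega> x)"
    and D_eq: "D = skew_dom \<sigma> (\<lambda>\<omega> x. a \<omega> * x + b \<omega> + g \<omega> x)"
    and attractor: "global_attractor D \<tau> A"
    and \<alpha>_le_\<beta>: "\<And>\<omega>. \<alpha> \<omega> \<le> \<beta> \<omega>"
    and A_eq: "A = (\<Union>\<omega>. {\<omega>} \<times> {\<alpha> \<omega>..\<beta> \<omega>})"
    and \<Omega>\<^sub>c_eq: "\<Omega>\<^sub>c = {\<omega>. isCont \<alpha> \<omega> \<and> isCont \<beta> \<omega>}"
    and A_pinched: "pinched D \<tau> A"
    and M_only_minimal: "{K. minimal_set D \<tau> K} = {M}"
    and M_in: "M \<subseteq> UNIV \<times> {r1..<r2} \<or> M \<subseteq> UNIV \<times> {r1<..r2}"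
    and spectrum: "Sup (sacker_sell \<sigma> a) = 0"
    and m_erg: "ergodic_measure \<sigma> UNIV m"
    and a_R: "a \<in> R_class \<sigma> m"
    and \<Omega>\<^sub>l_eq: "\<Omega>\<^sub>l = {\<omega> \<in> Omega_sup \<sigma> a.
                    \<forall>t. r1 \<le> \<alpha> (\<sigma> t \<omega>) \<and> \<alpha> (\<sigma> t \<omega>) \<le> \<beta> (\<sigma> t \<omega>) \<and> \<beta> (\<sigma> t \<omega>) \<le> r2}"
    and \<eta>_eq: "\<eta> = (\<lambda>c \<omega>. c * \<alpha> \<omega> + (1 - c) * \<beta> \<omega>)"
  shows
    "invariant_set (\<lambda>_. UNIV) \<sigma> \<Omega>\<^sub>l \<and> emeasure m \<Omega>\<^sub>l = 1 \<and>
     (\<exists>(\<mu> :: real \<Rightarrow> ('w \<times> real) measure) \<Omega>_AY.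
        let S = (\<lambda>c. Supp (\<mu> c)); S' = (\<Union>c\<in>{0..1}. S c) in
        \<comment> \<open>(i)\<close>
        (\<forall>c\<in>{0..1}.
           (\<forall>h :: 'w \<times> real \<Rightarrow> real. continuous_on A h \<longrightarrow> integrable m (\<lambda>\<omega>. h (\<omega>, \<eta> c \<omega>))) \<and>
           {\<nu>. represents_functional A (\<lambda>h. \<integral>\<omega>. h (\<omega>, \<eta> c \<omega>) \<partial>m) \<nu>} = {\<mu> c} \<and>
           ergodic_measure \<tau> A (\<mu> c)) \<and>
        \<comment> \<open>(ii)\<close>
        \<Omega>_AY \<subseteq> \<Omega>\<^sub>l \<and> invariant_set (\<lambda>_. UNIV) \<sigma> \<Omega>_AY \<and> emeasure m \<Omega>_AY = 1 \<and>
        (\<forall>\<omega>\<in>\<Omega>_AY. \<forall>c\<in>{0..1}. (\<omega>, \<eta> c \<omega>) \<in> S c \<and> S c = omega_limit \<tau> (\<omega>, \<eta> c \<omega>)) \<and>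
        (\<forall>c\<in>{0..1}. pinched D \<tau> (S c) \<and> continuous_flow_on (S c) \<tau> \<and> transitive_on (S c) \<tau>) \<and>
        \<comment> \<open>(iii)\<close>
        ((copy_of_base \<sigma> D \<tau> M \<and>
          (\<exists>c0\<in>{0..1}. (\<forall>c\<in>{0..1}. M = S c \<longleftrightarrow> c = c0) \<and>
             (\<forall>c\<in>{0..1}. c \<noteq> c0 \<longrightarrow> auslander_yorke_chaotic sum_dist (S c) \<tau>))) \<or>
         (\<not> copy_of_base \<sigma> D \<tau> M \<and>
          (\<forall>c\<in>{0..1}. auslander_yorke_chaotic sum_dist (S c) \<tau>))) \<and>
        \<comment> \<open>(iv)\<close>
        S' \<subseteq> A \<and> compact S' \<and> invariant_set D \<tau> S' \<and>
        (\<forall>y\<in>S'. sensitive_point sum_dist S' \<tau> y) \<and>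
        chain_recurrent_on sum_dist S' \<tau> \<and>
        (\<forall>\<omega>\<in>\<Omega>_AY \<union> \<Omega>\<^sub>c. fiber A \<omega> = fiber S' \<omega>) \<and>
        (\<forall>h :: 'w \<times> real \<Rightarrow> real. continuous_on A h \<longrightarrow>
           set_integrable lborel {0..1} (\<lambda>c. \<integral>\<omega>. h (\<omega>, \<eta> c \<omega>) \<partial>m)) \<and>
        (\<exists>\<mu>'. {\<nu>. represents_functional A (\<lambda>h. LBINT c=0..1. (\<integral>\<omega>. h (\<omega>, \<eta> c \<omega>) \<partial>m)) \<nu>} = {\<mu>'} \<and>
              invariant_measure \<tau> A \<mu>' \<and> S' = Supp \<mu>') \<and>
        (\<exists>X\<subseteq>S'. S' \<subseteq> closure X \<and> invariant_set D \<tau> X \<and> (\<forall>y\<in>X. generic_point S' \<tau> y)))"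
proof -
  let ?f = "\<lambda>\<omega> x. a \<omega> * x + b \<omega> + g \<omega> x"
  have M_min: "minimal_set D \<tau> M" using M_only_minimal by blast
  interpret P: pinched_linear_zone_family \<sigma> m a b g g_x r1 r2 A M \<alpha> \<beta>
  proof (unfold_locales)
    show "continuous_flow_on UNIV \<sigma>" by (rule flow)
    show "ergodic_measure \<sigma> UNIV m" by (rule m_erg)
    show "minimal_set (\<lambda>_. UNIV) \<sigma> UNIV" by (rule minimal)
    show "global_attractor (skew_dom \<sigma> ?f) (skew_flow \<sigma> ?f) A"
      using attractor unfolding D_eq \<tau>_eq .
    show "minimal_set (skew_dom \<sigma> ?f) (skew_flow \<sigma> ?f) M"
      using M_min unfolding D_eq \<tau>_eq .
    show "\<exists>\<omega> x. fiber A \<omega> = {x}" using A_pinched by (simp add: pinched_def)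
  qed (fact cont_a cont_b r12 g_deriv cont_g cont_g_x g_zero g_pos g_neg g_x_neg \<alpha>_le_\<beta> A_eq M_in a_R)+
  have Dt: "D = P.D" "\<tau> = P.\<tau>" by (simp_all add: D_eq \<tau>_eq)
  have eta: "\<eta> = P.eta" by (intro ext) (simp add: \<eta>_eq P.eta_def)
  have Ol: "\<Omega>\<^sub>l = P.Omega_l" by (simp add: \<Omega>\<^sub>l_eq P.Omega_l_def)
  have inv: "invariant_set (\<lambda>_. UNIV) \<sigma> B" if "\<And>t \<omega>. \<omega> \<in> B \<Longrightarrow> \<sigma> t \<omega> \<in> B" for B
    using P.flow_invariant_imageI[of B] that by (simp add: invariant_set_def)
  have 1: "invariant_set (\<lambda>_. UNIV) \<sigma> P.Omega_l" "emeasure m P.Omega_l = 1"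
    using inv[OF P.Omega_l_invariant] P.emeasure_eq_1[OF P.Omega_l_borel P.Omega_l_AE] by simp_all
  have 2: "invariant_set (\<lambda>_. UNIV) \<sigma> P.Omega_AY" "emeasure m P.Omega_AY = 1"
    using inv[OF P.Omega_AY_invariant] P.emeasure_eq_1[OF P.Omega_AY_borel P.Omega_AY_AE] by simp_all
  have 3: "\<forall>c\<in>{0..1}. (\<forall>h :: 'w \<times> real \<Rightarrow> real. continuous_on A h \<longrightarrow> integrable m (\<lambda>\<omega>. h (\<omega>, P.eta c \<omega>))) \<and>
      {\<nu>. represents_functional A (\<lambda>h. \<integral>\<omega>. h (\<omega>, P.eta c \<omega>) \<partial>m) \<nu>} = {P.mu c} \<and>
      ergodic_measure P.\<tau> A (P.mu c)"
    using P.eta_integrable P.mu_represents P.mu_ergodic by blast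
  have 4: "\<forall>\<omega>\<in>P.Omega_AY. \<forall>c\<in>{0..1}. (\<omega>, P.eta c \<omega>) \<in> P.S c \<and> P.S c = omega_limit P.\<tau> (\<omega>, P.eta c \<omega>)"
    by (intro ballI conjI P.eta_in_S P.S_omega_limit)
  have 5: "\<forall>c\<in>{0..1}. pinched P.D P.\<tau> (P.S c) \<and> continuous_flow_on (P.S c) P.\<tau> \<and> transitive_on (P.S c) P.\<tau>"
    using P.S_pinched P.S_flow P.S_transitive by blast
  have chaotic: "auslander_yorke_chaotic sum_dist (P.S c) P.\<tau>"
    if "c \<in> {0..1}" "M \<noteq> P.S c \<or> \<not> copy_of_base \<sigma> P.D P.\<tau> M" for c
    using P.S_transitive[OF that(1)] P.S_sensitive[OF that] by (simp add: auslander_yorke_chaotic_def)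
  have 6: "(copy_of_base \<sigma> P.D P.\<tau> M \<and>
      (\<exists>c0\<in>{0..1}. (\<forall>c\<in>{0..1}. M = P.S c \<longleftrightarrow> c = c0) \<and>
         (\<forall>c\<in>{0..1}. c \<noteq> c0 \<longrightarrow> auslander_yorke_chaotic sum_dist (P.S c) P.\<tau>))) \<or>
     (\<not> copy_of_base \<sigma> P.D P.\<tau> M \<and>
      (\<forall>c\<in>{0..1}. auslander_yorke_chaotic sum_dist (P.S c) P.\<tau>))"
  proof (cases "copy_of_base \<sigma> P.D P.\<tau> M")
    case True
    then obtain c0 where c0: "c0 \<in> {0..1}" "\<forall>c\<in>{0..1}. M = P.S c \<longleftrightarrow> c = c0"
      using P.copy_of_base_S by blast
    then have "\<forall>c\<in>{0..1}. c \<noteq> c0 \<longrightarrow> auslander_yorke_chaotic sum_dist (P.S c) P.\<tau>"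
      using chaotic by auto
    then show ?thesis using True c0 by blast
  next
    case False
    then show ?thesis using chaotic by blast
  qed
  have 7: "\<forall>y\<in>P.S'. sensitive_point sum_dist P.S' P.\<tau> y"
    "\<forall>\<omega>\<in>P.Omega_AY \<union> {\<omega>. isCont \<alpha> \<omega> \<and> isCont \<beta> \<omega>}. fiber A \<omega> = fiber P.S' \<omega>"
    using P.S'_sensitive P.fiber_S' by blast+
  have 8: "\<forall>h :: 'w \<times> real \<Rightarrow> real. continuous_on A h \<longrightarrow>
      set_integrable lborel {0..1} (\<lambda>c. \<integral>\<omega>. h (\<omega>, P.eta c \<omega>) \<partial>m)"
    using P.mu'_functional(1) by blast
  have 9: "\<exists>\<mu>'. {\<nu>. represents_functional A (\<lambda>h. LBINT c=0..1. (\<integral>\<omega>. h (\<omega>, P.eta c \<omega>) \<partial>m)) \<nu>} = {\<mu>'} \<and>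
      invariant_measure P.\<tau> A \<mu>' \<and> P.S' = Supp \<mu>'"
    by (rule exI[of _ P.mu']) (simp add: P.mu'_represents P.mu'_invariant P.Supp_mu')
  show ?thesis
    unfolding Let_def Dt eta Ol \<Omega>\<^sub>c_eq
    by (intro conjI exI[of _ P.mu] exI[of _ P.Omega_AY], unfold P.S'_def[symmetric])
      (fact 1 2 3 P.Omega_AY_subset 4 5 6 P.S'_A P.compact_S' P.S'_invariant 7 P.S'_chain_recurrent 8 9
        P.generic_points)+
qed

end
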